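(* Let $G$ be a finite innately transitive permutation group on $\Omega$ of diagonal type. Then $\mathrm{CD}(G)\neq\emptyset$ if and only if $G$ is a quasiprimitive group with compound diagonal type. Moreover, if $G$ is of compound diagonal type then $\mathrm{CD}(G)=\mathrm{CD}_{\mathrm S}(G)\neq\emptyset$.
   Context: A permutation group is innately transitive if it has a transitive minimal normal subgroup; such a subgroup is called a plinth. It is quasiprimitive if all its minimal normal subgroups are transitive. Diagonal type: let $G$ be innately transitive on $\Omega$ with a non-abelian, non-simple plinth $M=T_1\times\cdots\times T_k$, the $T_i$ being non-abelian simple groups all isomorphic to $T$, and let $\sigma_i:M\to T_i$ be the natural projections. A subgroup $K\le M$ is subdirect if $\sigma_i(K)=T_i$ for all $i$. $G$ has diagonal type if $M_\omega$ is subdirect in $M$ for $\omega\in\Omega$. In this case $M_\omega\cong T^m$ for some $m\leq k$; $G$ has simple diagonal type if $M_\omega\cong T$, and compound diagonal type otherwise. A Cartesian decomposition of $\Omega$ is a set $\{\Gamma_1,\ldots,\Gamma_\ell\}$ of $\ell\geq 2$ partitions of $\Omega$, each with at least two blocks, such that $|\gamma_1\cap\cdots\cap\gamma_\ell|=1$ for all $\gamma_1\in\Gamma_1,\ldots,\gamma_\ell\in\Gamma_\ell$. It is $G$-invariant if $G$ permutes the partitions. $\mathrm{CD}(G)$ is the set of $G$-invariant Cartesian decompositions of $\Omega$. For $\mathcal E=\{\Gamma_1,\ldots,\Gamma_\ell\}\in\mathrm{CD}(G)$, each $\Gamma_j$ is $M$-invariant. For $\omega\in\Omega$ let $\gamma_j\in\Gamma_j$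 be the block containing $\omega$, let $K_j=M_{\gamma_j}$ be the setwise stabiliser of $\gamma_j$ in $M$, and put $\mathcal K_\omega(\mathcal E)=\{K_1,\ldots,K_\ell\}$. $\mathrm{CD}_{\mathrm S}(G)$ is the set of $\mathcal E\in\mathrm{CD}(G)$ such that $G$ acts transitively on $\mathcal E$ and all elements of $\mathcal K_\omega(\mathcal E)$ are subdirect subgroups of $M$ (this does not depend on $\omega$). *)

theory Defs
  imports
    "HOL-Algebra.Group_Action"
    "HOL-Algebra.SimpleGroups"
    "HOL-Algebra.Product_Groups"
    "HOL-Library.Disjoint_Sets"
begin

section \<open>Groups\<close>

definition minimal_normal_subgroup :: "'g set \<Rightarrow> ('g, 'm) monoid_scheme \<Rightarrow> bool" where
  "minimal_normal_subgroup N G \<longleftrightarrow>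
     N \<lhd> G \<and> N \<noteq> {\<one>\<^bsub>G\<^esub>} \<and> (\<forall>L. L \<lhd> G \<and> L \<subseteq> N \<longrightarrow> L = {\<one>\<^bsub>G\<^esub>} \<or> L = N)"

definition nonabelian_simple_group :: "('g, 'm) monoid_scheme \<Rightarrow> bool" where
  "nonabelian_simple_group G \<longleftrightarrow> simple_group G \<and> \<not> comm_group G"

text \<open>The product \<open>t 0 \<otimes> t 1 \<otimes> \<dots> \<otimes> t (k - 1)\<close>; the factors \<open>T\<^sub>1, \<dots>, T\<^sub>k\<close> of a direct
  product are indexed by \<open>0, \<dots>, k - 1\<close> here.\<close>

definition ordered_prod :: "('g, 'm) monoid_scheme \<Rightarrow> nat \<Rightarrow> (nat \<Rightarrow> 'g) \<Rightarrow> 'g" where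
  "ordered_prod M k t = foldr (\<lambda>i y. t i \<otimes>\<^bsub>M\<^esub> y) [0..<k] \<one>\<^bsub>M\<^esub>"

definition external_prod ::
    "('g, 'm) monoid_scheme \<Rightarrow> nat \<Rightarrow> (nat \<Rightarrow> 'g set) \<Rightarrow> (nat \<Rightarrow> 'g) monoid" where
  "external_prod M k S = product_group {..<k} (\<lambda>i. M\<lparr>carrier := S i\<rparr>)"

definition internal_direct_product ::
    "('g, 'm) monoid_scheme \<Rightarrow> nat \<Rightarrow> (nat \<Rightarrow> 'g set) \<Rightarrow> bool" where
  "internal_direct_product M k S \<longleftrightarrow>
     (\<forall>i<k. subgroup (S i) M) \<and> ordered_prod M k \<in> iso (external_prod M k S) M"

definition factor_proj ::
    "('g, 'm) monoid_scheme \<Rightarrow> nat \<Rightarrow> (nat \<Rightarrow> 'g set) \<Rightarrow> nat \<Rightarrow> 'g \<Rightarrow> 'g" where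
  "factor_proj M k S i x = inv_into (carrier (external_prod M k S)) (ordered_prod M k) x i"

definition subdirect ::
    "('g, 'm) monoid_scheme \<Rightarrow> nat \<Rightarrow> (nat \<Rightarrow> 'g set) \<Rightarrow> 'g set \<Rightarrow> bool" where
  "subdirect M k S K \<longleftrightarrow> subgroup K M \<and> (\<forall>i<k. factor_proj M k S i ` K = S i)"


section \<open>Permutation groups\<close>

text \<open>A permutation group on \<open>\<Omega>\<close> is given by its underlying set \<open>G\<close>, a subgroup of
  \<open>BijGroup \<Omega>\<close>. It acts on points by \<open>\<lambda>g. g\<close>, on subsets of \<open>\<Omega>\<close> by \<open>image\<close>, and on
  partitions of \<open>\<Omega>\<close> by \<open>\<lambda>g. image (image g)\<close>.\<close>

abbreviation perm_grp :: "'a set \<Rightarrow> ('a \<Rightarrow> 'a) set \<Rightarrow> ('a \<Rightarrow> 'a) monoid" where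
  "perm_grp \<Omega> G \<equiv> (BijGroup \<Omega>)\<lparr>carrier := G\<rparr>"

definition permutation_group :: "'a set \<Rightarrow> ('a \<Rightarrow> 'a) set \<Rightarrow> bool" where
  "permutation_group \<Omega> G \<longleftrightarrow> subgroup G (BijGroup \<Omega>)"

definition plinth :: "'a set \<Rightarrow> ('a \<Rightarrow> 'a) set \<Rightarrow> ('a \<Rightarrow> 'a) set \<Rightarrow> bool" where
  "plinth \<Omega> G M \<longleftrightarrow>
     minimal_normal_subgroup M (perm_grp \<Omega> G) \<and> transitive_action (perm_grp \<Omega> M) \<Omega> (\<lambda>g. g)"

definition innately_transitive :: "'a set \<Rightarrow> ('a \<Rightarrow> 'a) set \<Rightarrow> bool" where
  "innately_transitive \<Omega> G \<longleftrightarrow> permutation_group \<Omega> G \<and> (\<exists>M. plinth \<Omega> G M)"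

definition quasiprimitive :: "'a set \<Rightarrow> ('a \<Rightarrow> 'a) set \<Rightarrow> bool" where
  "quasiprimitive \<Omega> G \<longleftrightarrow> permutation_group \<Omega> G \<and>
     (\<forall>N. minimal_normal_subgroup N (perm_grp \<Omega> G) \<longrightarrow>
        transitive_action (perm_grp \<Omega> N) \<Omega> (\<lambda>g. g))"


section \<open>Diagonal types\<close>

text \<open>The plinth \<open>M\<close>, its simple direct factors \<open>S 0, \<dots>, S (k - 1)\<close> and the group \<open>T\<close>
  isomorphic to each of them are explicit parameters.\<close>

definition diagonal_type ::
    "'a set \<Rightarrow> ('a \<Rightarrow> 'a) set \<Rightarrow> ('a \<Rightarrow> 'a) set \<Rightarrow> nat \<Rightarrow> (nat \<Rightarrow> ('a \<Rightarrow> 'a) set) \<Rightarrow>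
     ('t, 'm) monoid_scheme \<Rightarrow> bool" where
  "diagonal_type \<Omega> G M k S T \<longleftrightarrow>
     innately_transitive \<Omega> G \<and> plinth \<Omega> G M \<and>
     \<not> comm_group (perm_grp \<Omega> M) \<and> \<not> simple_group (perm_grp \<Omega> M) \<and>
     internal_direct_product (perm_grp \<Omega> M) k S \<and>
     nonabelian_simple_group T \<and>
     (\<forall>i<k. nonabelian_simple_group (perm_grp \<Omega> (S i)) \<and> perm_grp \<Omega> (S i) \<cong> T) \<and>
     (\<forall>\<omega>\<in>\<Omega>. subdirect (perm_grp \<Omega> M) k S (stabilizer (perm_grp \<Omega> M) (\<lambda>g. g) \<omega>))"

definition simple_diagonal_type ::
    "'a set \<Rightarrow> ('a \<Rightarrow> 'a) set \<Rightarrow> ('a \<Rightarrow> 'a) set \<Rightarrow> nat \<Rightarrow> (nat \<Rightarrow> ('a \<Rightarrow> 'a) set) \<Rightarrow>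
     ('t, 'm) monoid_scheme \<Rightarrow> bool" where
  "simple_diagonal_type \<Omega> G M k S T \<longleftrightarrow>
     diagonal_type \<Omega> G M k S T \<and>
     (\<forall>\<omega>\<in>\<Omega>. perm_grp \<Omega> (stabilizer (perm_grp \<Omega> M) (\<lambda>g. g) \<omega>) \<cong> T)"

definition compound_diagonal_type ::
    "'a set \<Rightarrow> ('a \<Rightarrow> 'a) set \<Rightarrow> ('a \<Rightarrow> 'a) set \<Rightarrow> nat \<Rightarrow> (nat \<Rightarrow> ('a \<Rightarrow> 'a) set) \<Rightarrow>
     ('t, 'm) monoid_scheme \<Rightarrow> bool" where
  "compound_diagonal_type \<Omega> G M k S T \<longleftrightarrow>
     diagonal_type \<Omega> G M k S T \<and> \<not> simple_diagonal_type \<Omega> G M k S T"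


section \<open>Cartesian decompositions\<close>

definition cartesian_decomposition :: "'a set \<Rightarrow> 'a set set set \<Rightarrow> bool" where
  "cartesian_decomposition \<Omega> \<E> \<longleftrightarrow>
     finite \<E> \<and> 2 \<le> card \<E> \<and>
     (\<forall>\<Gamma>\<in>\<E>. partition_on \<Omega> \<Gamma> \<and> (\<exists>\<gamma>\<in>\<Gamma>. \<exists>\<delta>\<in>\<Gamma>. \<gamma> \<noteq> \<delta>)) \<and>
     (\<forall>c. (\<forall>\<Gamma>\<in>\<E>. c \<Gamma> \<in> \<Gamma>) \<longrightarrow> card (\<Inter>\<Gamma>\<in>\<E>. c \<Gamma>) = 1)"

definition CD :: "'a set \<Rightarrow> ('a \<Rightarrow> 'a) set \<Rightarrow> 'a set set set set" where
  "CD \<Omega> G = {\<E>. cartesian_decomposition \<Omega> \<E> \<and> (\<forall>g\<in>G. image (image g) ` \<E> = \<E>)}"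

definition block_stabilizers ::
    "'a set \<Rightarrow> ('a \<Rightarrow> 'a) set \<Rightarrow> 'a \<Rightarrow> 'a set set set \<Rightarrow> ('a \<Rightarrow> 'a) set set" where
  "block_stabilizers \<Omega> M \<omega> \<E> = {stabilizer (perm_grp \<Omega> M) image \<gamma> | \<gamma> \<Gamma>. \<Gamma> \<in> \<E> \<and> \<gamma> \<in> \<Gamma> \<and> \<omega> \<in> \<gamma>}"

definition CD_S ::
    "'a set \<Rightarrow> ('a \<Rightarrow> 'a) set \<Rightarrow> ('a \<Rightarrow> 'a) set \<Rightarrow> nat \<Rightarrow> (nat \<Rightarrow> ('a \<Rightarrow> 'a) set) \<Rightarrow>
     'a set set set set" where
  "CD_S \<Omega> G M k S = {\<E> \<in> CD \<Omega> G.
     (\<forall>\<Gamma>\<in>\<E>. \<forall>\<Delta>\<in>\<E>. \<exists>g\<in>G. image (image g) \<Gamma> = \<Delta>) \<and>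
     (\<forall>\<omega>\<in>\<Omega>. \<forall>K\<in>block_stabilizers \<Omega> M \<omega> \<E>. subdirect (perm_grp \<Omega> M) k S K)}"

end

theory Submission
  imports Defs "HOL-Combinatorics.Permutations"
begin

text \<open>
  Let \<open>M\<close> be the plinth, \<open>T\<^sub>0, \<dots>, T\<^sub>k\<^sub>-\<^sub>1\<close> its simple factors, \<open>\<omega>\<close> a point and \<open>M\<^sub>\<omega>\<close> its stabiliser
  in \<open>M\<close>. Everything is read off the kernels of the \<open>k\<close> coordinate projections of \<open>M\<close>, which
  conjugation by \<open>G\<close> permutes transitively because \<open>M\<close> is minimal normal in \<open>G\<close>; as \<open>M\<close> is
  transitive on \<open>\<Omega>\<close> and normalises each kernel, already the stabiliser \<open>G\<^sub>\<omega>\<close> permutes them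
  transitively.

  For a subdirect subgroup \<open>K\<close> of \<open>M\<close>, two coordinates are linked if their projections have the same
  kernel on \<open>K\<close>. An argument in the spirit of Goursat and Scott shows that \<open>K\<close> is determined by its
  projections to pairs of linked coordinates (\<open>mem_if_linked_agree\<close>): \<open>K\<close> is a product of full diagonal
  subgroups, one for each class of linked coordinates. Hence \<open>K\<close> contains every factor whose
  coordinate is not tied, that is, not linked to another one (\<open>mem_if_agree_on_tied\<close>); \<open>K\<close> is its
  own normaliser (\<open>full_self_normalizing\<close>); and \<open>K\<close> has at most as many elements as a product of
  copies of \<open>T\<close>, one for each class (\<open>card_subgroup_tied_le\<close>).

  Groups of diagonal type are always quasiprimitive. A minimal normal subgroup other than \<open>M\<close> would
  centralise \<open>M\<close>; an element \<open>c\<close> of it moves \<open>\<omega>\<close> as some \<open>m \<in> M\<close> does, so \<open>m\<close> normalises \<open>M\<^sub>\<omega>\<close>, hence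
  lies in it, and \<open>c\<close> fixes \<open>\<omega>\<close>, for every \<open>\<omega>\<close>.

  Let \<open>\<E>\<close> be a \<open>G\<close>-invariant Cartesian decomposition. If \<open>M\<close> moved a partition in \<open>\<E>\<close>, it would act
  faithfully on the \<open>G\<close>-orbit of that partition. With \<open>l\<close> partitions in the orbit, having \<open>n\<close> blocks
  each, \<open>n ^ l\<close> would divide \<open>card \<Omega>\<close>, hence \<open>card M\<close>, hence \<open>l!\<close>, which is impossible
  (\<open>prime_power_not_dvd_fact\<close>). So \<open>M\<close> fixes each \<open>\<Gamma> \<in> \<E>\<close>, and the stabiliser \<open>K\<^sub>\<Gamma>\<close> of the block
  of \<open>\<Gamma>\<close> containing \<open>\<omega>\<close> contains \<open>M\<^sub>\<omega>\<close>, which makes it subdirect. Each coordinate is tied in the same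
  number \<open>d\<close> of the groups \<open>K\<^sub>\<Gamma>\<close>. Comparing \<open>card \<Omega> < card M = card T ^ k\<close> with the product of the
  indices \<open>card \<Gamma>\<close> of the \<open>K\<^sub>\<Gamma>\<close> yields \<open>d * k < 2 * k\<close>, that is, \<open>d \<le> 1\<close>. On the other hand, each
  \<open>K\<^sub>\<Gamma>\<close> is a proper subgroup and therefore has tied coordinates. So the sets of tied coordinates of the
  \<open>K\<^sub>\<Gamma>\<close> are nonempty and pairwise disjoint, and \<open>G\<^sub>\<omega>\<close> permutes them as it permutes \<open>\<E>\<close>. Transitivity on
  coordinates gives transitivity on \<open>\<E>\<close>. Moreover, \<open>M\<^sub>\<omega>\<close>, being the intersection of the \<open>K\<^sub>\<Gamma>\<close>,
  splits along these sets, so it is not simple, and the type is compound.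

  Conversely, if the type is compound, the coordinates fall into at least two classes with respect to
  \<open>M\<^sub>\<omega>\<close>. For each class let \<open>N\<close> be the subgroup of \<open>M\<close> of all elements that are trivial on the
  class. The partitions of \<open>\<Omega>\<close> into orbits of these groups \<open>N\<close> form a \<open>G\<close>-invariant Cartesian
  decomposition.
\<close>

section \<open>Subdirect subgroups of a product of nonabelian simple groups\<close>

text \<open>The centre is a normal subgroup, and it is not the whole group.\<close>

lemma nonabelian_simple_center:
  fixes T (structure)
  assumes T: "nonabelian_simple_group T" and z: "z \<in> carrier T"
    and comm: "\<And>x. x \<in> carrier T \<Longrightarrow> x \<otimes> z = z \<otimes> x"
  shows "z = \<one>"
proof -
  interpret simple_group T using T by (simp add: nonabelian_simple_group_def)
  let ?Z = "{z \<in> carrier T. \<forall>x\<in>carrier T. x \<otimes> z = z \<otimes> x}"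
  have "subgroup ?Z T"
  proof (rule subgroupI)
    fix a assume a: "a \<in> ?Z"
    have "x \<otimes> inv a = inv a \<otimes> x" if x: "x \<in> carrier T" for x
    proof -
      have c: "a \<in> carrier T" and e: "a \<otimes> x = x \<otimes> a" using a x by auto
      have "x \<otimes> inv a = inv a \<otimes> (a \<otimes> x) \<otimes> inv a" using c x by (simp add: m_assoc[symmetric])
      also have "\<dots> = inv a \<otimes> x" unfolding e using c x by (simp add: m_assoc)
      finally show ?thesis .
    qed
    then show "inv a \<in> ?Z" using a by simp
  next
    fix a b assume a: "a \<in> ?Z" and b: "b \<in> ?Z"
    have "x \<otimes> (a \<otimes> b) = a \<otimes> b \<otimes> x" if x: "x \<in> carrier T" for x
    proof -
      have c: "a \<in> carrier T" "b \<in> carrier T" and e: "x \<otimes> a = a \<otimes> x" "x \<otimes> b = b \<otimes> x"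
        using a b x by auto
      have "x \<otimes> (a \<otimes> b) = (x \<otimes> a) \<otimes> b" using m_assoc[OF x c] by simp
      also have "\<dots> = a \<otimes> (x \<otimes> b)" unfolding e(1) by (rule m_assoc[OF c(1) x c(2)])
      also have "\<dots> = a \<otimes> b \<otimes> x" unfolding e(2) using m_assoc[OF c x] by simp
      finally show ?thesis .
    qed
    moreover have "a \<otimes> b \<in> carrier T" using a b by (intro m_closed) auto
    ultimately show "a \<otimes> b \<in> ?Z" by blast
  qed auto
  then have "?Z \<lhd> T"
  proof (rule normal_invI)
    fix x h assume x: "x \<in> carrier T" and h: "h \<in> ?Z"
    have c: "h \<in> carrier T" and e: "x \<otimes> h = h \<otimes> x" using h x by auto
    have "x \<otimes> h \<otimes> inv x = h" unfolding e using c x by (simp add: m_assoc)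
    with h show "x \<otimes> h \<otimes> inv x \<in> ?Z" by simp
  qed
  then have "?Z = carrier T \<or> ?Z = {\<one>}" by (rule no_real_normal_subgroup)
  moreover have "?Z \<noteq> carrier T"
  proof
    assume "?Z = carrier T"
    then have "comm_group T" by (intro group_comm_groupI) auto
    with T show False by (simp add: nonabelian_simple_group_def)
  qed
  ultimately show ?thesis using z comm by auto
qed

text \<open>The direct product is given by its coordinate maps. This keeps the arguments independent of how the
factors sit inside \<open>M\<close>, and it lets the kernels of these maps, which are invariants of \<open>M\<close> up to order,
play the role of the factors.\<close>

locale simple_product = group M for M (structure) +
  fixes I :: "'i set" and T :: "'i \<Rightarrow> ('b, 'c) monoid_scheme" and p :: "'i \<Rightarrow> 'a \<Rightarrow> 'b"
  assumes finite_I: "finite I"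
    and nonabelian_simple: "i \<in> I \<Longrightarrow> nonabelian_simple_group (T i)"
    and p_hom: "i \<in> I \<Longrightarrow> p i \<in> hom M (T i)"
    and coords_eqI: "\<lbrakk>x \<in> carrier M; y \<in> carrier M; \<And>i. i \<in> I \<Longrightarrow> p i x = p i y\<rbrakk> \<Longrightarrow> x = y"
    and coords_ex: "(\<And>i. i \<in> I \<Longrightarrow> t i \<in> carrier (T i)) \<Longrightarrow> \<exists>x\<in>carrier M. \<forall>i\<in>I. p i x = t i"
begin

lemma simple_T: "i \<in> I \<Longrightarrow> simple_group (T i)"
  using nonabelian_simple by (simp add: nonabelian_simple_group_def)

lemma group_T [simp]: "i \<in> I \<Longrightarrow> group (T i)"
  using simple_T by (simp add: simple_group_def)

lemma p_group_hom: "i \<in> I \<Longrightarrow> group_hom M (T i) (p i)"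
  using p_hom is_group by (simp add: group_hom_def group_hom_axioms_def)

lemma p_closed [simp]: "\<lbrakk>i \<in> I; x \<in> carrier M\<rbrakk> \<Longrightarrow> p i x \<in> carrier (T i)"
  using p_hom by (auto simp: hom_def)

lemma p_mult [simp]:
  "\<lbrakk>i \<in> I; x \<in> carrier M; y \<in> carrier M\<rbrakk> \<Longrightarrow> p i (x \<otimes> y) = p i x \<otimes>\<^bsub>T i\<^esub> p i y"
  using p_hom by (auto simp: hom_def)

lemma p_one [simp]: "i \<in> I \<Longrightarrow> p i \<one> = \<one>\<^bsub>T i\<^esub>"
  by (rule group_hom.hom_one[OF p_group_hom])

lemma p_inv [simp]: "\<lbrakk>i \<in> I; x \<in> carrier M\<rbrakk> \<Longrightarrow> p i (inv x) = inv\<^bsub>T i\<^esub> (p i x)"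
  by (rule group_hom.hom_inv[OF p_group_hom])

lemma T_mult_one [simp]:
  assumes "i \<in> I" "x \<in> carrier (T i)"
  shows "x \<otimes>\<^bsub>T i\<^esub> \<one>\<^bsub>T i\<^esub> = x" "\<one>\<^bsub>T i\<^esub> \<otimes>\<^bsub>T i\<^esub> x = x"
    "x \<otimes>\<^bsub>T i\<^esub> inv\<^bsub>T i\<^esub> x = \<one>\<^bsub>T i\<^esub>" "inv\<^bsub>T i\<^esub> x \<otimes>\<^bsub>T i\<^esub> x = \<one>\<^bsub>T i\<^esub>"
    "inv\<^bsub>T i\<^esub> x \<in> carrier (T i)" 
  using assms group.is_monoid[OF group_T[OF assms(1)]]
  by (auto simp: monoid.r_one monoid.l_one group.r_inv group.l_inv group.inv_closed)

lemma T_one [simp]: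
  assumes "i \<in> I"
  shows "\<one>\<^bsub>T i\<^esub> \<in> carrier (T i)" "inv\<^bsub>T i\<^esub> \<one>\<^bsub>T i\<^esub> = \<one>\<^bsub>T i\<^esub>"
  using group.is_monoid[OF group_T[OF assms]] group_T[OF assms]
  by (auto simp: monoid.one_closed monoid.inv_one)

lemma p_diff_eq_one:
  assumes "i \<in> I" "x \<in> carrier M" "y \<in> carrier M"
  shows "p i (x \<otimes> inv y) = \<one>\<^bsub>T i\<^esub> \<longleftrightarrow> p i x = p i y"
proof -
  interpret Ti: group "T i" using assms(1) by simp
  show ?thesis using assms by (simp add: Ti.inv_solve_right')
qed

definition factor_ker :: "'i \<Rightarrow> 'a set" where
  "factor_ker i = {x \<in> carrier M. p i x = \<one>\<^bsub>T i\<^esub>}"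

text \<open>The subdirect subgroups with respect to the maps \<open>p\<close>.\<close>

definition full :: "'a set \<Rightarrow> bool" where
  "full K \<longleftrightarrow> subgroup K M \<and> (\<forall>i\<in>I. p i ` K = carrier (T i))"

text \<open>If \<open>K\<close> is subdirect and the projections to the factors \<open>i\<close> and \<open>j\<close> have the same kernel on \<open>K\<close>, then \<open>K\<close>
projects onto the graph of an isomorphism \<open>T i \<cong> T j\<close>. The classes of this relation are the
supports of the full diagonal subgroups (strips) of which \<open>K\<close> is the product.\<close>

definition linked :: "'a set \<Rightarrow> 'i \<Rightarrow> 'i \<Rightarrow> bool" where
  "linked K i j \<longleftrightarrow> K \<inter> factor_ker i = K \<inter> factor_ker j"

definition tied :: "'a set \<Rightarrow> 'i set" where
  "tied K = {i \<in> I. \<exists>j\<in>I. j \<noteq> i \<and> linked K i j}"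

lemma coords_single:
  assumes i: "i \<in> I" and t: "t \<in> carrier (T i)"
  shows "\<exists>x\<in>carrier M. p i x = t \<and> (\<forall>j\<in>I. j \<noteq> i \<longrightarrow> p j x = \<one>\<^bsub>T j\<^esub>)"
proof -
  have "\<exists>x\<in>carrier M. \<forall>j\<in>I. p j x = (if j = i then t else \<one>\<^bsub>T j\<^esub>)"
    by (rule coords_ex) (use t in auto)
  then show ?thesis by (rule bexE) (intro bexI conjI; use i in simp)
qed

lemma full_carrier: "full (carrier M)"
proof -
  have "p i ` carrier M = carrier (T i)" if "i \<in> I" for i
    using that coords_single[OF that] by (fastforce simp: image_iff)
  then show ?thesis by (simp add: full_def subgroup_self)
qed

lemma full_sub: "full K \<Longrightarrow> x \<in> K \<Longrightarrow> x \<in> carrier M"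
  by (auto simp: full_def dest: subgroup.mem_carrier)

lemma full_mono: "\<lbrakk>full K; subgroup L M; K \<subseteq> L\<rbrakk> \<Longrightarrow> full L"
  unfolding full_def by (metis p_closed image_mono image_subsetI subgroup.mem_carrier subset_antisym)

lemma full_ex: "\<lbrakk>full K; i \<in> I; t \<in> carrier (T i)\<rbrakk> \<Longrightarrow> \<exists>x\<in>K. p i x = t"
  unfolding full_def by (metis imageE)

lemma T_nontrivial: "i \<in> I \<Longrightarrow> \<exists>t\<in>carrier (T i). t \<noteq> \<one>\<^bsub>T i\<^esub>"
  using simple_group.simple_not_triv[OF simple_T] T_one(1) by blast

lemma T_noncommuting:
  assumes "i \<in> I"
  shows "\<exists>a\<in>carrier (T i). \<exists>b\<in>carrier (T i). a \<otimes>\<^bsub>T i\<^esub> b \<noteq> b \<otimes>\<^bsub>T i\<^esub> a"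
  using nonabelian_simple[OF assms] group.group_comm_groupI[OF group_T[OF assms]]
  unfolding nonabelian_simple_group_def by blast

lemma linked_refl: "linked K i i" and linked_sym: "linked K i j \<Longrightarrow> linked K j i"
  by (simp_all add: linked_def)

lemma linkedD: "\<lbrakk>linked K i j; x \<in> K; x \<in> carrier M; p i x = \<one>\<^bsub>T i\<^esub>\<rbrakk> \<Longrightarrow> p j x = \<one>\<^bsub>T j\<^esub>"
  unfolding linked_def factor_ker_def by blast

text \<open>On \<open>K\<close>, the coordinate \<open>j\<close> is a function of the coordinate \<open>i\<close>.\<close>

lemma linked_agree:
  assumes "linked K i j" "subgroup K M" "i \<in> I" "j \<in> I" "x \<in> K" "y \<in> K" "p i x = p i y"
  shows "p j x = p j y"
proof -
  have c: "x \<in> carrier M" "y \<in> carrier M" using assms(5,6) by (auto intro: subgroup.mem_carrier[OF assms(2)])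
  have "x \<otimes> inv y \<in> K" using assms by (simp add: subgroup.m_closed subgroup.m_inv_closed)
  moreover have "p i (x \<otimes> inv y) = \<one>\<^bsub>T i\<^esub>" using assms c by (simp add: p_diff_eq_one del: p_mult p_inv)
  ultimately have "p j (x \<otimes> inv y) = \<one>\<^bsub>T j\<^esub>" using linkedD assms(1) c by blast
  then show ?thesis using assms c by (simp add: p_diff_eq_one del: p_mult p_inv)
qed

text \<open>The image is a nontrivial normal subgroup of a simple group. It is
used for normal subgroups \<open>H\<close> of \<open>M\<close>, with \<open>K\<close> all of \<open>M\<close>, and for normal subgroups \<open>H\<close> of \<open>K\<close>.\<close>

lemma image_is_factor:
  assumes i: "i \<in> I" and K: "subgroup K M" "p i ` K = carrier (T i)" and H: "subgroup H M"
    and conj: "\<And>x h. \<lbrakk>x \<in> K; h \<in> H\<rbrakk> \<Longrightarrow> x \<otimes> h \<otimes> inv x \<in> H"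
    and h: "h \<in> H" "p i h \<noteq> \<one>\<^bsub>T i\<^esub>"
  shows "p i ` H = carrier (T i)"
proof -
  interpret Ti: simple_group "T i" using i by (rule simple_T)
  interpret ph: group_hom M "T i" "p i" using i by (rule p_group_hom)
  have "p i ` H \<lhd> T i"
  proof (rule Ti.normal_invI)
    show "subgroup (p i ` H) (T i)" using H by (rule ph.subgroup_img_is_subgroup)
    fix t s assume t: "t \<in> carrier (T i)" and s: "s \<in> p i ` H"
    from t K obtain x where x: "x \<in> K" "t = p i x" by blast
    from s obtain h where h: "h \<in> H" "s = p i h" by blast
    have "t \<otimes>\<^bsub>T i\<^esub> s \<otimes>\<^bsub>T i\<^esub> inv\<^bsub>T i\<^esub> t = p i (x \<otimes> h \<otimes> inv x)"
      using x h i subgroup.mem_carrier[OF K(1) x(1)] subgroup.mem_carrier[OF H h(1)] by simp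
    then show "t \<otimes>\<^bsub>T i\<^esub> s \<otimes>\<^bsub>T i\<^esub> inv\<^bsub>T i\<^esub> t \<in> p i ` H" using conj[OF x(1) h(1)] by simp
  qed
  then have "p i ` H = carrier (T i) \<or> p i ` H = {\<one>\<^bsub>T i\<^esub>}" by (rule Ti.no_real_normal_subgroup)
  with h show ?thesis by blast
qed

lemma trivial_on_subgroup:
  assumes "subgroup K M" "J \<subseteq> I"
  shows "subgroup {u \<in> K. \<forall>i\<in>J. p i u = \<one>\<^bsub>T i\<^esub>} M"
proof (rule subgroupI)
  have c: "x \<in> carrier M" if "x \<in> K" for x using that by (rule subgroup.mem_carrier[OF assms(1)])
  have I: "i \<in> I" if "i \<in> J" for i using that assms(2) by blast
  show "{u \<in> K. \<forall>i\<in>J. p i u = \<one>\<^bsub>T i\<^esub>} \<subseteq> carrier M" using c by blast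
  show "{u \<in> K. \<forall>i\<in>J. p i u = \<one>\<^bsub>T i\<^esub>} \<noteq> {}" using subgroup.one_closed[OF assms(1)] I by auto
  show "inv a \<in> {u \<in> K. \<forall>i\<in>J. p i u = \<one>\<^bsub>T i\<^esub>}" if "a \<in> {u \<in> K. \<forall>i\<in>J. p i u = \<one>\<^bsub>T i\<^esub>}" for a
    using that I c by (simp add: subgroup.m_inv_closed[OF assms(1)])
  show "a \<otimes> b \<in> {u \<in> K. \<forall>i\<in>J. p i u = \<one>\<^bsub>T i\<^esub>}"
    if "a \<in> {u \<in> K. \<forall>i\<in>J. p i u = \<one>\<^bsub>T i\<^esub>}" "b \<in> {u \<in> K. \<forall>i\<in>J. p i u = \<one>\<^bsub>T i\<^esub>}" for a b
    using that I c by (simp add: subgroup.m_closed[OF assms(1)])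
qed

lemma trivial_on_conj:
  assumes "subgroup K M" "J \<subseteq> I" "x \<in> K" "h \<in> {u \<in> K. \<forall>i\<in>J. p i u = \<one>\<^bsub>T i\<^esub>}"
  shows "x \<otimes> h \<otimes> inv x \<in> {u \<in> K. \<forall>i\<in>J. p i u = \<one>\<^bsub>T i\<^esub>}"
proof -
  have c: "x \<in> carrier M" "h \<in> carrier M" using assms(3,4) by (auto intro: subgroup.mem_carrier[OF assms(1)])
  have "p i (x \<otimes> h \<otimes> inv x) = \<one>\<^bsub>T i\<^esub>" if "i \<in> J" for i
    using that assms c by (auto simp: subset_iff)
  moreover have "x \<otimes> h \<otimes> inv x \<in> K"
    using assms by (simp add: subgroup.m_closed subgroup.m_inv_closed)
  ultimately show ?thesis by simp
qed

text \<open>By simplicity, the kernels of the projections of \<open>K\<close> are maximal normal subgroups of \<open>K\<close>, so one of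
them cannot lie properly inside another.\<close>

lemma linkedI:
  assumes K: "full K" and i: "i \<in> I" and j: "j \<in> I"
    and sub: "K \<inter> factor_ker i \<subseteq> factor_ker j"
  shows "linked K i j"
proof (rule ccontr)
  have sK: "subgroup K M" using K by (simp add: full_def)
  let ?H = "{u \<in> K. \<forall>i\<in>{j}. p i u = \<one>\<^bsub>T i\<^esub>}"
  assume "\<not> linked K i j"
  then obtain h where h: "h \<in> K" "h \<in> factor_ker j" "h \<notin> factor_ker i"
    using sub unfolding linked_def by blast
  have img: "p i ` ?H = carrier (T i)"
  proof (rule image_is_factor[OF i sK])
    show "p i ` K = carrier (T i)" using K i by (simp add: full_def)
    show "subgroup ?H M" using trivial_on_subgroup[OF sK] j by blast
    show "x \<otimes> h \<otimes> inv x \<in> ?H" if "x \<in> K" "h \<in> ?H" for x h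
      using trivial_on_conj[OF sK _ that] j by blast
    show "h \<in> ?H" using h by (simp add: factor_ker_def)
    show "p i h \<noteq> \<one>\<^bsub>T i\<^esub>" using h by (simp add: factor_ker_def)
  qed
  obtain t where t: "t \<in> carrier (T j)" "t \<noteq> \<one>\<^bsub>T j\<^esub>" using T_nontrivial[OF j] by blast
  then obtain x where x: "x \<in> K" "p j x = t" using full_ex[OF K j] by blast
  have "p i x \<in> p i ` ?H" using img x full_sub[OF K] i by simp
  then obtain y where y: "y \<in> K" "p j y = \<one>\<^bsub>T j\<^esub>" "p i y = p i x" by auto
  have c: "x \<in> carrier M" "y \<in> carrier M" using x y full_sub[OF K] by auto
  have "x \<otimes> inv y \<in> K" using x y sK by (simp add: subgroup.m_closed subgroup.m_inv_closed)
  moreover have "p i (x \<otimes> inv y) = \<one>\<^bsub>T i\<^esub>"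
    using y i c by (simp add: p_diff_eq_one del: p_mult p_inv)
  ultimately have "p j (x \<otimes> inv y) = \<one>\<^bsub>T j\<^esub>" using sub c unfolding factor_ker_def by blast
  then have "p j x = p j y" using j c by (simp add: p_diff_eq_one del: p_mult p_inv)
  with x y t show False by simp
qed

text \<open>Induction on \<open>J\<close>: the elements of \<open>K\<close> that are trivial on \<open>J\<close> form a group normalised by \<open>K\<close>, so it is
enough that one of them is nontrivial at \<open>j\<close>. In the step, the commutator of an element trivial on the
old \<open>J\<close> with one trivial at the new coordinate is trivial at all of them, and since both elements have
prescribed values at \<open>j\<close>, these can be chosen not to commute.\<close>

lemma isolate_coordinate:
  assumes K: "full K" and j: "j \<in> I" and J: "finite J" "J \<subseteq> I"
    and unl: "\<And>i. i \<in> J \<Longrightarrow> \<not> linked K i j" and t: "t \<in> carrier (T j)"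
  shows "\<exists>u\<in>K. p j u = t \<and> (\<forall>i\<in>J. p i u = \<one>\<^bsub>T i\<^esub>)"
  using J unl t
proof (induction arbitrary: t rule: finite_induct)
  case empty
  then show ?case using full_ex[OF K j] by simp
next
  case (insert i J)
  have sK: "subgroup K M" using K by (simp add: full_def)
  have i: "i \<in> I" and J: "J \<subseteq> I" using insert by auto
  have pK: "p j ` K = carrier (T j)" using K j by (simp add: full_def)
  interpret Tj: group "T j" using j by simp
  let ?H = "\<lambda>J. {u \<in> K. \<forall>i\<in>J. p i u = \<one>\<^bsub>T i\<^esub>}"
  have img: "p j ` ?H L = carrier (T j)" if L: "L \<subseteq> I" and h: "h \<in> ?H L" "p j h \<noteq> \<one>\<^bsub>T j\<^esub>" for L h
    using image_is_factor[OF j sK pK trivial_on_subgroup[OF sK L] trivial_on_conj[OF sK L] h] by blast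
  obtain a b where ab: "a \<in> carrier (T j)" "b \<in> carrier (T j)"
    "a \<otimes>\<^bsub>T j\<^esub> b \<noteq> b \<otimes>\<^bsub>T j\<^esub> a" using T_noncommuting[OF j] by blast
  obtain u where u: "u \<in> K" "p j u = a" "\<forall>i\<in>J. p i u = \<one>\<^bsub>T i\<^esub>"
    using insert.IH[OF J _ ab(1)] insert.prems by blast
  have "\<not> K \<inter> factor_ker i \<subseteq> factor_ker j" using linkedI[OF K i j] insert.prems by blast
  then obtain h where "h \<in> ?H {i}" "p j h \<noteq> \<one>\<^bsub>T j\<^esub>" by (auto simp: factor_ker_def)
  from img[OF _ this] i have "b \<in> p j ` ?H {i}" using ab by blast
  then obtain v where v: "v \<in> K" "p j v = b" "p i v = \<one>\<^bsub>T i\<^esub>" by auto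
  have c: "u \<in> carrier M" "v \<in> carrier M" using u v full_sub[OF K] by auto
  \<comment> \<open>A commutator of \<open>u\<close> and \<open>v\<close>: trivial wherever one of them is.\<close>
  let ?w = "u \<otimes> v \<otimes> inv (v \<otimes> u)"
  have "?w \<in> ?H (insert i J)"
  proof -
    have "?w \<in> K" using u v sK by (simp add: subgroup.m_closed subgroup.m_inv_closed)
    moreover have "p l ?w = \<one>\<^bsub>T l\<^esub>" if "l \<in> insert i J" for l
    proof -
      have l: "l \<in> I" using that i J by blast
      have "p l (u \<otimes> v) = p l (v \<otimes> u)" using that u v c l by (cases "l = i") auto
      then show ?thesis using l c by (simp add: p_diff_eq_one del: p_mult p_inv)
    qed
    ultimately show ?thesis by simp
  qed
  \<comment> \<open>At \<open>j\<close> it is the quotient of the two distinct products of \<open>a\<close> and \<open>b\<close>.\<close>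
  moreover have "p j ?w \<noteq> \<one>\<^bsub>T j\<^esub>"
    using p_diff_eq_one[OF j, of "u \<otimes> v" "v \<otimes> u"] c j u v ab by simp
  ultimately have "p j ` ?H (insert i J) = carrier (T j)" using img[of "insert i J"] i J by blast
  then have "t \<in> p j ` ?H (insert i J)" using insert.prems by blast
  then show ?case by blast
qed

text \<open>Scott's description of subdirect subgroups. An element of \<open>K\<close> agreeing with \<open>x\<close> is built one coordinate
at a time: a new coordinate that is linked to an earlier one is already right, and any other one is
corrected by an element of \<open>K\<close> that is trivial at the earlier coordinates.\<close>

lemma mem_if_linked_agree:
  assumes K: "full K" and x: "x \<in> carrier M"
    and agree: "\<And>i j. \<lbrakk>i \<in> I; j \<in> I; linked K i j\<rbrakk> \<Longrightarrow> \<exists>y\<in>K. p i y = p i x \<and> p j y = p j x"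
  shows "x \<in> K"
proof -
  have sK: "subgroup K M" using K by (simp add: full_def)
  have "finite J \<Longrightarrow> J \<subseteq> I \<Longrightarrow> \<exists>y\<in>K. \<forall>i\<in>J. p i y = p i x" for J
  proof (induction rule: finite_induct)
    case empty
    then show ?case using subgroup.one_closed[OF sK] by blast
  next
    case (insert j J)
    then obtain y where y: "y \<in> K" "\<forall>i\<in>J. p i y = p i x" by blast
    have j: "j \<in> I" and J: "J \<subseteq> I" using insert by auto
    interpret Tj: group "T j" using j by simp
    have yc: "y \<in> carrier M" using y full_sub[OF K] by blast
    show ?case
    proof (cases "\<exists>i\<in>J. linked K i j")
      case True
      then obtain i where i: "i \<in> J" "linked K i j" by blast
      then obtain z where z: "z \<in> K" "p i z = p i x" "p j z = p j x" using agree J j by blast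
      have "p j y = p j z" by (rule linked_agree[OF i(2) sK]) (use i j J y z in auto)
      with y z show ?thesis by auto
    next
      case False
      then obtain u where u: "u \<in> K" "p j u = inv\<^bsub>T j\<^esub> p j y \<otimes>\<^bsub>T j\<^esub> p j x" "\<forall>i\<in>J. p i u = \<one>\<^bsub>T i\<^esub>"
        using isolate_coordinate[OF K j insert.hyps(1) J, of "inv\<^bsub>T j\<^esub> p j y \<otimes>\<^bsub>T j\<^esub> p j x"] j x yc by auto
      have uc: "u \<in> carrier M" using u full_sub[OF K] by blast
      have "p j (y \<otimes> u) = p j x" using j x yc uc u by (simp add: Tj.m_assoc[symmetric])
      moreover have "p i (y \<otimes> u) = p i x" if "i \<in> J" for i using that u y yc uc J x by auto
      moreover have "y \<otimes> u \<in> K" using y u sK by (simp add: subgroup.m_closed)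
      ultimately show ?thesis by blast
    qed
  qed
  from this[OF finite_I] obtain y where y: "y \<in> K" "\<forall>i\<in>I. p i y = p i x" by blast
  then have "y = x" using coords_eqI x full_sub[OF K] by blast
  with y show ?thesis by simp
qed

text \<open>In particular, with \<open>x\<close> the identity, \<open>K\<close> contains each factor whose coordinate is not tied.\<close>

lemma mem_if_agree_on_tied:
  assumes K: "full K" and x: "x \<in> K" and y: "y \<in> carrier M"
    and agree: "\<And>i. i \<in> tied K \<Longrightarrow> p i y = p i x"
  shows "y \<in> K"
proof (rule mem_if_linked_agree[OF K y])
  fix i j assume ij: "i \<in> I" "j \<in> I" "linked K i j"
  show "\<exists>z\<in>K. p i z = p i y \<and> p j z = p j y"
  proof (cases "i = j")
    case True
    then show ?thesis using full_ex[OF K ij(1)] ij y by auto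
  next
    case False
    then have "i \<in> tied K" "j \<in> tied K" using ij linked_sym[OF ij(3)] by (auto simp: tied_def)
    then show ?thesis using agree x by auto
  qed
qed

text \<open>Let \<open>i\<close> and \<open>j\<close> be linked, and divide \<open>x\<close> by an element of \<open>K\<close> with the same coordinate \<open>i\<close>. The quotient
\<open>z\<close> normalises \<open>K\<close> too and is trivial at \<open>i\<close>, so conjugation by \<open>z\<close> changes neither the coordinate \<open>i\<close>
nor, therefore, the coordinate \<open>j\<close> of any element of \<open>K\<close>. So \<open>z\<close> is central, hence trivial, at \<open>j\<close>.\<close>

lemma full_self_normalizing:
  assumes K: "full K" and x: "x \<in> carrier M"
    and conj: "\<And>u. u \<in> K \<Longrightarrow> x \<otimes> u \<otimes> inv x \<in> K"
  shows "x \<in> K"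
proof (rule mem_if_linked_agree[OF K x])
  fix i j assume ij: "i \<in> I" "j \<in> I" "linked K i j"
  have sK: "subgroup K M" using K by (simp add: full_def)
  interpret Ti: group "T i" using ij by simp
  interpret Tj: group "T j" using ij by simp
  obtain y where y: "y \<in> K" "p i y = p i x" using full_ex[OF K ij(1) p_closed[OF ij(1) x]] by blast
  have yc: "y \<in> carrier M" using y full_sub[OF K] by blast
  define z where "z = x \<otimes> inv y"
  have zc: "z \<in> carrier M" using x yc by (simp add: z_def)
  have zi: "p i z = \<one>\<^bsub>T i\<^esub>"
    using ij x yc y by (simp add: z_def p_diff_eq_one del: p_mult p_inv)
  have "p j z = \<one>\<^bsub>T j\<^esub>"
  proof (rule nonabelian_simple_center[OF nonabelian_simple[OF ij(2)]])
    show zj: "p j z \<in> carrier (T j)" using ij zc by simp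
    fix t assume "t \<in> carrier (T j)"
    then obtain u where u: "u \<in> K" "p j u = t" using full_ex[OF K ij(2)] by blast
    have uc: "u \<in> carrier M" using u full_sub[OF K] by blast
    have "inv y \<otimes> u \<otimes> y \<in> K" using y u sK by (simp add: subgroup.m_closed subgroup.m_inv_closed)
    from conj[OF this] have "z \<otimes> u \<otimes> inv z \<in> K"
      using x yc uc by (simp add: z_def m_assoc inv_mult_group)
    moreover have "p i (z \<otimes> u \<otimes> inv z) = p i u" using zc uc ij zi by simp
    ultimately have "p j (z \<otimes> u \<otimes> inv z) = p j u"
      using linked_agree[OF ij(3) sK ij(1,2) _ u(1)] by blast
    then have "p j z \<otimes>\<^bsub>T j\<^esub> p j u \<otimes>\<^bsub>T j\<^esub> inv\<^bsub>T j\<^esub> p j z = p j u"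
      using ij zc uc by simp
    then show "t \<otimes>\<^bsub>T j\<^esub> p j z = p j z \<otimes>\<^bsub>T j\<^esub> t"
      using u(2) zj p_closed[OF ij(2) uc] Tj.inv_solve_right'[of "p j u" "p j z \<otimes>\<^bsub>T j\<^esub> p j u" "p j z"] by simp
  qed
  then have "p j y = p j x" using ij x yc by (simp add: z_def p_diff_eq_one del: p_mult p_inv)
  with y show "\<exists>y\<in>K. p i y = p i x \<and> p j y = p j x" by blast
qed


lemma factor_ker_subset: "factor_ker i \<subseteq> carrier M"
  by (auto simp: factor_ker_def)

lemma factor_ker_normal:
  assumes "i \<in> I"
  shows "factor_ker i \<lhd> M"
proof -
  interpret ph: group_hom M "T i" "p i" using assms by (rule p_group_hom)
  have "factor_ker i = kernel M (T i) (p i)" by (simp add: factor_ker_def kernel_def)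
  then show ?thesis using ph.normal_kernel by simp
qed

lemma factor_ker_proper: "i \<in> I \<Longrightarrow> factor_ker i \<noteq> carrier M"
  using full_ex[OF full_carrier, of i] T_nontrivial[of i] by (auto simp: factor_ker_def)

lemma factor_ker_inj:
  assumes i: "i \<in> I" and j: "j \<in> I" and sub: "factor_ker i \<subseteq> factor_ker j"
  shows "i = j"
proof (rule ccontr)
  assume ne: "i \<noteq> j"
  obtain t where t: "t \<in> carrier (T j)" "t \<noteq> \<one>\<^bsub>T j\<^esub>" using T_nontrivial[OF j] by blast
  obtain x where "x \<in> carrier M" "p j x = t" "\<forall>l\<in>I. l \<noteq> j \<longrightarrow> p l x = \<one>\<^bsub>T l\<^esub>"
    using coords_single[OF j t(1)] by blast
  then have "x \<in> factor_ker i" "x \<notin> factor_ker j" using i j t ne by (auto simp: factor_ker_def)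
  with sub show False by blast
qed

lemma normal_image_full:
  assumes L: "L \<lhd> M" and i: "i \<in> I" and "\<not> L \<subseteq> factor_ker i"
  shows "p i ` L = carrier (T i)"
proof -
  obtain l where l: "l \<in> L" "p i l \<noteq> \<one>\<^bsub>T i\<^esub>"
    using assms(3) normal_invE(1)[OF L] by (auto simp: factor_ker_def subgroup.mem_carrier)
  have "p i ` carrier M = carrier (T i)" using full_carrier i by (simp add: full_def)
  then show ?thesis
    using image_is_factor[OF i subgroup_self _ normal_invE[OF L] l] by simp
qed

text \<open>A normal subgroup contained in no kernel projects onto each factor; but a subdirect subgroup is its own
normaliser.\<close>

lemma normal_le_factor_ker:
  assumes L: "L \<lhd> M" and "L \<noteq> carrier M"
  shows "\<exists>i\<in>I. L \<subseteq> factor_ker i"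
proof (rule ccontr)
  assume "\<not> (\<exists>i\<in>I. L \<subseteq> factor_ker i)"
  then have "full L" using normal_image_full[OF L] normal_invE(1)[OF L] by (auto simp: full_def)
  then have "x \<in> L" if "x \<in> carrier M" for x
    using full_self_normalizing that normal_invE(2)[OF L] by blast
  then show False using assms(2) normal_invE(1)[OF L] by (auto dest: subgroup.mem_carrier)
qed

lemma factor_ker_maximal:
  assumes i: "i \<in> I" and L: "L \<lhd> M" and "L \<noteq> carrier M" and sub: "factor_ker i \<subseteq> L"
  shows "L = factor_ker i"
proof -
  obtain j where "j \<in> I" "L \<subseteq> factor_ker j" using normal_le_factor_ker[OF L] assms(3) by blast
  then show ?thesis using factor_ker_inj[OF i, of j] sub by blast
qed

text \<open>The kernels are exactly the maximal normal subgroups of \<open>M\<close>, and automorphisms permute these.\<close>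

lemma iso_factor_ker:
  assumes \<phi>: "\<phi> \<in> iso M M" and i: "i \<in> I"
  shows "\<exists>j\<in>I. \<phi> ` factor_ker i = factor_ker j"
proof -
  have bij: "bij_betw \<phi> (carrier M) (carrier M)" using \<phi> by (simp add: iso_def)
  define \<psi> where "\<psi> = inv_into (carrier M) \<phi>"
  have \<psi>: "\<psi> \<in> iso M M" unfolding \<psi>_def by (rule iso_set_sym[OF \<phi>])
  have normal_image: "\<chi> ` L \<lhd> M" if "\<chi> \<in> iso M M" "L \<lhd> M" for \<chi> L
  proof -
    have "group_hom M M \<chi>" using that is_group
      by (simp add: group_hom_def group_hom_axioms_def iso_def)
    moreover have "\<chi> ` carrier M = carrier M" using that by (simp add: iso_def bij_betw_def)
    ultimately show ?thesis by (rule normal.surj_hom_normal_subgroup[OF that(2)])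
  qed
  have \<psi>\<phi>: "\<psi> (\<phi> x) = x" if "x \<in> carrier M" for x
    using that bij by (simp add: \<psi>_def bij_betw_def)
  have \<phi>\<psi>: "\<phi> (\<psi> x) = x" if "x \<in> carrier M" for x
    using that bij by (simp add: \<psi>_def bij_betw_def f_inv_into_f)
  have \<phi>\<psi>_image: "\<phi> ` \<psi> ` L = L" if "L \<subseteq> carrier M" for L
  proof -
    have "\<phi> ` \<psi> ` L = (\<lambda>x. x) ` L"
      unfolding image_image by (rule image_cong) (use that \<phi>\<psi> in auto)
    then show ?thesis by simp
  qed
  have "\<phi> ` factor_ker i \<noteq> carrier M"
  proof
    assume "\<phi> ` factor_ker i = carrier M"
    then have "\<phi> ` factor_ker i = \<phi> ` carrier M" using bij by (simp add: bij_betw_def)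
    then have "factor_ker i = carrier M"
      using bij factor_ker_subset[of i] by (metis bij_betw_def inj_on_image_eq_iff order_refl)
    with factor_ker_proper[OF i] show False by simp
  qed
  then obtain j where j: "j \<in> I" "\<phi> ` factor_ker i \<subseteq> factor_ker j"
    using normal_le_factor_ker[OF normal_image[OF \<phi> factor_ker_normal[OF i]]] by blast
  have "\<psi> ` factor_ker j = factor_ker i"
  proof (rule factor_ker_maximal[OF i normal_image[OF \<psi> factor_ker_normal[OF j(1)]]])
    show "factor_ker i \<subseteq> \<psi> ` factor_ker j"
    proof
      fix x assume x: "x \<in> factor_ker i"
      then have "\<phi> x \<in> factor_ker j" using j by blast
      moreover have "x = \<psi> (\<phi> x)" using x factor_ker_subset \<psi>\<phi> by (metis subsetD)
      ultimately show "x \<in> \<psi> ` factor_ker j" by blast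
    qed
    show "\<psi> ` factor_ker j \<noteq> carrier M"
    proof
      assume "\<psi> ` factor_ker j = carrier M"
      then have "\<phi> ` \<psi> ` factor_ker j = carrier M" using bij by (simp add: bij_betw_def)
      moreover have "\<phi> ` \<psi> ` factor_ker j = factor_ker j"
        by (rule \<phi>\<psi>_image[OF factor_ker_subset])
      ultimately show False using factor_ker_proper[OF j(1)] by simp
    qed
  qed
  then have "\<phi> ` factor_ker i = \<phi> ` \<psi> ` factor_ker j" by simp
  also have "\<dots> = factor_ker j" by (rule \<phi>\<psi>_image[OF factor_ker_subset])
  finally show ?thesis using j by blast
qed

lemma iso_linked:
  assumes \<phi>: "\<phi> \<in> iso M M" and K: "K \<subseteq> carrier M" and "linked K i j"
    and i': "\<phi> ` factor_ker i = factor_ker i'" and j': "\<phi> ` factor_ker j = factor_ker j'"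
  shows "linked (\<phi> ` K) i' j'"
proof -
  have inj: "inj_on \<phi> (carrier M)" using \<phi> by (simp add: iso_def bij_betw_def)
  have "\<phi> ` K \<inter> factor_ker i' = \<phi> ` (K \<inter> factor_ker i)"
    unfolding i'[symmetric] using inj_on_image_Int[OF inj K factor_ker_subset] by simp
  moreover have "\<phi> ` K \<inter> factor_ker j' = \<phi> ` (K \<inter> factor_ker j)"
    unfolding j'[symmetric] using inj_on_image_Int[OF inj K factor_ker_subset] by simp
  ultimately show ?thesis using assms(3) by (simp add: linked_def)
qed

lemma iso_tied:
  assumes \<phi>: "\<phi> \<in> iso M M" and K: "K \<subseteq> carrier M" and i: "i \<in> tied K" and i': "i' \<in> I"
    and ii': "\<phi> ` factor_ker i = factor_ker i'"
  shows "i' \<in> tied (\<phi> ` K)"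
proof -
  have inj: "inj_on \<phi> (carrier M)" using \<phi> by (simp add: iso_def bij_betw_def)
  obtain j where j: "i \<in> I" "j \<in> I" "j \<noteq> i" "linked K i j" using i by (auto simp: tied_def)
  obtain j' where j': "j' \<in> I" "\<phi> ` factor_ker j = factor_ker j'"
    using iso_factor_ker[OF \<phi> j(2)] by blast
  have "j' \<noteq> i'"
  proof
    assume "j' = i'"
    then have "\<phi> ` factor_ker j = \<phi> ` factor_ker i" using j' ii' by simp
    then have "factor_ker j = factor_ker i"
      using inj_on_image_eq_iff[OF inj factor_ker_subset factor_ker_subset] by blast
    then show False using factor_ker_inj j by blast
  qed
  then show ?thesis using iso_linked[OF \<phi> K j(4) ii' j'(2)] i' j'(1) by (auto simp: tied_def)
qed

text \<open>An element of \<open>K\<close> is determined by its coordinates at a set \<open>R\<close> of representatives of the classes of linked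
coordinates. A class that has tied members has at least two, so at least half of the tied coordinates lie
outside \<open>R\<close>; the square avoids fractions.\<close>

lemma card_subgroup_tied_le:
  assumes K: "subgroup K M" and t: "\<And>i. i \<in> I \<Longrightarrow> card (carrier (T i)) = t" "0 < t"
  shows "card K ^ 2 * t ^ card (tied K) \<le> t ^ (2 * card I)"
proof -
  \<comment> \<open>The predicate depends only on the class of \<open>i\<close>, so \<open>r\<close> is constant on classes.\<close>
  define r where "r i = (SOME j. j \<in> I \<and> linked K i j)" for i
  have r: "r i \<in> I" "linked K i (r i)" if "i \<in> I" for i
    using someI[of "\<lambda>j. j \<in> I \<and> linked K i j" i] that linked_refl unfolding r_def by blast+
  have r_cong: "r i = r j" if "linked K i j" for i j using that by (simp add: r_def linked_def)
  define R where "R = r ` I"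
  have RI: "R \<subseteq> I" using r by (auto simp: R_def)
  then have finR: "finite R" using finite_I finite_subset by blast
  have rR: "r i = i" if "i \<in> R" for i using that r_cong[OF r(2)] by (auto simp: R_def)
  have fint: "finite (carrier (T i))" if "i \<in> I" for i using t that by (metis card.infinite less_irrefl)
  have cK: "card K \<le> t ^ card R"
  proof -
    have "inj_on (\<lambda>x. \<lambda>i\<in>R. p i x) K"
    proof (rule inj_onI)
      fix x y assume x: "x \<in> K" and y: "y \<in> K" and e: "(\<lambda>i\<in>R. p i x) = (\<lambda>i\<in>R. p i y)"
      show "x = y"
      proof (rule coords_eqI)
        show "x \<in> carrier M" "y \<in> carrier M" using x y subgroup.mem_carrier[OF K] by auto
        fix i assume i: "i \<in> I"
        have "r i \<in> R" using i by (simp add: R_def)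
        then have "p (r i) x = p (r i) y" using fun_cong[OF e, of "r i"] by simp
        then show "p i x = p i y"
          using linked_agree[OF linked_sym[OF r(2)[OF i]] K r(1)[OF i] i x y] by simp
      qed
    qed
    moreover have "(\<lambda>x. \<lambda>i\<in>R. p i x) ` K \<subseteq> (\<Pi>\<^sub>E i\<in>R. carrier (T i))"
      using RI subgroup.mem_carrier[OF K] by (auto simp: subset_iff)
    moreover have "finite (\<Pi>\<^sub>E i\<in>R. carrier (T i))" using RI fint finR by (intro finite_PiE) auto
    ultimately have "card K \<le> card (\<Pi>\<^sub>E i\<in>R. carrier (T i))" by (rule card_inj_on_le)
    also have "\<dots> = (\<Prod>i\<in>R. card (carrier (T i)))" using finR by (rule card_PiE)
    also have "\<dots> = t ^ card R" using t(1) RI by (subst prod.cong[of R R _ "\<lambda>_. t"]) auto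
    finally show ?thesis .
  qed
  have "card (tied K \<inter> R) \<le> card (I - R)"
  proof -
    have "\<exists>j\<in>I - R. linked K i j" if iR: "i \<in> tied K \<inter> R" for i
    proof -
      obtain j where j: "j \<in> I" "j \<noteq> i" "linked K i j" using iR by (auto simp: tied_def)
      have "j \<notin> R" using rR[of j] rR[of i] r_cong[OF j(3)] j(2) iR by auto
      with j show ?thesis by blast
    qed
    then obtain s where s: "\<And>i. i \<in> tied K \<inter> R \<Longrightarrow> s i \<in> I - R \<and> linked K i (s i)" by metis
    have "inj_on s (tied K \<inter> R)"
    proof (rule inj_onI)
      fix i j assume i: "i \<in> tied K \<inter> R" and j: "j \<in> tied K \<inter> R" and e: "s i = s j"
      have "r i = r j" using r_cong[of i "s i"] r_cong[of j "s j"] s[OF i] s[OF j] e by simp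
      then show "i = j" using rR i j by simp
    qed
    then show ?thesis using s finite_I by (intro card_inj_on_le[of s]) auto
  qed
  moreover have "card (tied K) \<le> card (tied K \<inter> R) + card (I - R)"
  proof -
    have "tied K \<subseteq> (tied K \<inter> R) \<union> (I - R)" by (auto simp: tied_def)
    then have "card (tied K) \<le> card ((tied K \<inter> R) \<union> (I - R))"
      using finite_I finR by (intro card_mono) auto
    also have "\<dots> \<le> card (tied K \<inter> R) + card (I - R)" by (rule card_Un_le)
    finally show ?thesis .
  qed
  moreover have "card I = card R + card (I - R)"
    using RI finR finite_I by (metis card_Un_disjoint Diff_disjoint Un_Diff_cancel Un_absorb1 finite_Diff)
  ultimately have le: "2 * card R + card (tied K) \<le> 2 * card I" by linarith
  have "card K ^ 2 * t ^ card (tied K) \<le> (t ^ card R) ^ 2 * t ^ card (tied K)"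
    using cK by (intro mult_right_mono power_mono) auto
  also have "\<dots> = t ^ (2 * card R + card (tied K))" by (simp add: power_add power_mult[symmetric] mult.commute)
  also have "\<dots> \<le> t ^ (2 * card I)" using le t(2) by (intro power_increasing) auto
  finally show ?thesis .
qed

lemma card_carrier:
  assumes t: "\<And>i. i \<in> I \<Longrightarrow> card (carrier (T i)) = t"
  shows "card (carrier M) = t ^ card I"
proof -
  have "bij_betw (\<lambda>x. \<lambda>i\<in>I. p i x) (carrier M) (\<Pi>\<^sub>E i\<in>I. carrier (T i))"
  proof (rule bij_betw_imageI)
    show "inj_on (\<lambda>x. \<lambda>i\<in>I. p i x) (carrier M)"
    proof (rule inj_onI)
      fix x y assume x: "x \<in> carrier M" and y: "y \<in> carrier M"
        and e: "(\<lambda>i\<in>I. p i x) = (\<lambda>i\<in>I. p i y)"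
      have "p i x = p i y" if "i \<in> I" for i using fun_cong[OF e, of i] that by simp
      then show "x = y" using coords_eqI x y by blast
    qed
    show "(\<lambda>x. \<lambda>i\<in>I. p i x) ` carrier M = (\<Pi>\<^sub>E i\<in>I. carrier (T i))"
    proof
      show "(\<Pi>\<^sub>E i\<in>I. carrier (T i)) \<subseteq> (\<lambda>x. \<lambda>i\<in>I. p i x) ` carrier M"
      proof
        fix f assume f: "f \<in> (\<Pi>\<^sub>E i\<in>I. carrier (T i))"
        then obtain x where x: "x \<in> carrier M" "\<forall>i\<in>I. p i x = f i" using coords_ex[of f] by blast
        then have "f = (\<lambda>i\<in>I. p i x)" using f by (auto simp: PiE_def extensional_def)
        with x show "f \<in> (\<lambda>x. \<lambda>i\<in>I. p i x) ` carrier M" by blast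
      qed
    qed auto
  qed
  then have "card (carrier M) = card (\<Pi>\<^sub>E i\<in>I. carrier (T i))" by (rule bij_betw_same_card)
  also have "\<dots> = (\<Prod>i\<in>I. card (carrier (T i)))" using finite_I by (rule card_PiE)
  also have "\<dots> = t ^ card I" using t by simp
  finally show ?thesis .
qed

lemma tied_nonempty:
  assumes K: "full K" and ne: "K \<noteq> carrier M"
  shows "tied K \<noteq> {}"
proof
  assume e: "tied K = {}"
  have one: "\<one> \<in> K" using K by (auto simp: full_def subgroup.one_closed)
  have "x \<in> K" if "x \<in> carrier M" for x
    using mem_if_agree_on_tied[OF K one that] e by simp
  then show False using ne full_sub[OF K] by blast
qed

end

section \<open>Prime powers and factorials\<close>

text \<open>The multiples of \<open>p\<close> among \<open>1, \<dots>, n\<close> contribute the first two factors, the other numbers \<open>c\<close>.\<close>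

lemma fact_prime_part:
  fixes p n :: nat
  assumes "prime p"
  shows "\<exists>c. coprime p c \<and> fact n = p ^ (n div p) * fact (n div p) * c"
proof (induction n)
  case 0
  then show ?case by (intro exI[of _ 1]) auto
next
  case (Suc n)
  then obtain c where c: "coprime p c" "fact n = p ^ (n div p) * fact (n div p) * c" by blast
  have "0 < p" using assms by (simp add: prime_gt_0_nat)
  show ?case
  proof (cases "p dvd Suc n")
    case True
    then have q: "Suc n div p = Suc (n div p)" by (simp add: div_Suc)
    have "Suc n = p * Suc (n div p)" using True q by (metis dvd_mult_div_cancel)
    then have "fact (Suc n) = p * Suc (n div p) * (p ^ (n div p) * fact (n div p) * c)"
      using c by (metis fact_Suc of_nat_id)
    also have "\<dots> = p ^ (Suc n div p) * fact (Suc n div p) * c"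
      unfolding q by (simp add: algebra_simps)
    finally show ?thesis using c by blast
  next
    case False
    then have q: "Suc n div p = n div p" by (simp add: div_Suc mod_eq_0_iff_dvd)
    have "coprime p (c * Suc n)" 
      using c(1) prime_imp_coprime[OF assms False] by (simp only: coprime_mult_right_iff)
    moreover have "fact (Suc n) = p ^ (Suc n div p) * fact (Suc n div p) * (c * Suc n)"
      unfolding q using c by (simp add: algebra_simps)
    ultimately show ?thesis by blast
  qed
qed

lemma prime_power_not_dvd_fact:
  fixes p n :: nat
  assumes p: "prime p" and "0 < n"
  shows "\<not> p ^ n dvd fact n"
  using assms(2)
proof (induction n rule: less_induct)
  case (less n)
  define q where "q = n div p"
  obtain c where c: "coprime p c" "fact n = p ^ q * fact q * c"
    using fact_prime_part[OF p] unfolding q_def by blast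
  have "p * q \<le> n" by (simp add: q_def)
  moreover have "2 * q \<le> p * q" using prime_ge_2_nat[OF p] by simp
  ultimately have qn: "2 * q \<le> n" by linarith
  show ?case
  proof
    assume d: "p ^ n dvd fact n"
    have "p ^ n = p ^ q * p ^ (n - q)" using qn by (simp add: power_add[symmetric])
    then have "p ^ (n - q) dvd fact q * c"
      using d prime_gt_0_nat[OF p] unfolding c(2) by (simp add: mult.assoc)
    then have d': "p ^ (n - q) dvd fact q" using c(1)
      by (simp add: coprime_dvd_mult_left_iff coprime_power_left_iff)
    show False
    proof (cases "q = 0")
      case True
      then have "p ^ n dvd 1" using d' by simp
      then show False using prime_ge_2_nat[OF p] less.prems by simp
    next
      case False
      have "p ^ q dvd p ^ (n - q)" using qn by (intro le_imp_power_dvd) simp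
      then have "p ^ q dvd fact q" using d' by (rule dvd_trans)
      then show False using less.IH[of q] False qn by simp
    qed
  qed
qed

section \<open>Counting in finite groups\<close>

text \<open>The orbit-stabiliser theorem, with the orbit map replaced by any map whose fibres are the left cosets of
\<open>K\<close>. It serves for points, where \<open>f\<close> is \<open>\<lambda>x. x \<omega>\<close>, and for blocks, where \<open>f\<close> is \<open>\<lambda>x. x ` \<gamma>\<close>.\<close>

lemma (in group) card_eq_card_image_times_fibre:
  assumes fin: "finite (carrier G)" and K: "subgroup K G"
    and fibre: "\<And>x y. \<lbrakk>x \<in> carrier G; y \<in> carrier G\<rbrakk> \<Longrightarrow> f x = f y \<longleftrightarrow> inv x \<otimes> y \<in> K"
  shows "card (carrier G) = card (f ` carrier G) * card K"
proof -
  have "card {y \<in> carrier G. f y = b} = card K" if b: "b \<in> f ` carrier G" for b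
  proof -
    obtain x where x: "x \<in> carrier G" "b = f x" using b by blast
    have "bij_betw (\<lambda>u. x \<otimes> u) K {y \<in> carrier G. f y = b}"
    proof (rule bij_betw_byWitness[where f' = "\<lambda>y. inv x \<otimes> y"])
      have c: "u \<in> carrier G" if "u \<in> K" for u using that by (rule subgroup.mem_carrier[OF K])
      show "\<forall>u\<in>K. inv x \<otimes> (x \<otimes> u) = u" using x c by (simp add: m_assoc[symmetric])
      show "\<forall>y\<in>{y \<in> carrier G. f y = b}. x \<otimes> (inv x \<otimes> y) = y"
        using x by (simp add: m_assoc[symmetric])
      show "(\<otimes>) x ` K \<subseteq> {y \<in> carrier G. f y = b}"
      proof
        fix y assume "y \<in> (\<otimes>) x ` K"
        then obtain u where u: "u \<in> K" "y = x \<otimes> u" by blast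
        have "inv x \<otimes> y \<in> K" using u x c by (simp add: m_assoc[symmetric])
        then show "y \<in> {y \<in> carrier G. f y = b}" using fibre[OF x(1), of y] u x c by simp
      qed
      show "(\<lambda>y. inv x \<otimes> y) ` {y \<in> carrier G. f y = b} \<subseteq> K" 
        using fibre[OF x(1)] x(2) by auto metis
    qed
    then show ?thesis by (simp add: bij_betw_same_card)
  qed
  then have "(\<Sum>b\<in>f ` carrier G. card {y \<in> carrier G. f y = b}) = card (f ` carrier G) * card K"
    by simp
  moreover have "(\<Sum>b\<in>f ` carrier G. card {y \<in> carrier G. f y = b}) = card (carrier G)"
    using sum.image_gen[OF fin, of "\<lambda>_. 1::nat" f] by simp
  ultimately show ?thesis by simp
qed

lemma card_Bij:
  assumes "finite X"
  shows "card (Bij X) = fact (card X)"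
proof -
  have "bij_betw (\<lambda>q. restrict q X) {q. q permutes X} (Bij X)"
  proof (rule bij_betw_byWitness[where f' = "\<lambda>f v. if v \<in> X then f v else v"])
    show "\<forall>q\<in>{q. q permutes X}. (\<lambda>v. if v \<in> X then restrict q X v else v) = q"
      by (auto simp: permutes_def fun_eq_iff)
    show "\<forall>f\<in>Bij X. restrict (\<lambda>v. if v \<in> X then f v else v) X = f"
      by (auto simp: Bij_def extensional_def fun_eq_iff)
    show "(\<lambda>q. restrict q X) ` {q. q permutes X} \<subseteq> Bij X"
      by (auto simp: Bij_def permutes_imp_bij)
    show "(\<lambda>f v. if v \<in> X then f v else v) ` Bij X \<subseteq> {q. q permutes X}"
    proof
      fix q assume "q \<in> (\<lambda>f v. if v \<in> X then f v else v) ` Bij X"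
      then obtain f where f: "f \<in> Bij X" "q = (\<lambda>v. if v \<in> X then f v else v)" by blast
      have "bij_betw q X X \<longleftrightarrow> bij_betw f X X" by (rule bij_betw_cong) (simp add: f)
      then have "q permutes X" using f by (intro bij_imp_permutes) (auto simp: Bij_def)
      then show "q \<in> {q. q permutes X}" by simp
    qed
  qed
  then show ?thesis using card_permutations[OF refl assms] by (simp add: bij_betw_same_card)
qed

text \<open>Lagrange's theorem in the symmetric group of \<open>X\<close>. Restricting \<open>\<phi> x\<close> to \<open>X\<close> turns it into
an element of \<open>BijGroup X\<close>.\<close>

lemma (in group) card_dvd_fact_if_faithful:
  assumes fin: "finite X"
    and bij: "\<And>x. x \<in> carrier G \<Longrightarrow> bij_betw (\<phi> x) X X"
    and mult: "\<And>x y v. \<lbrakk>x \<in> carrier G; y \<in> carrier G; v \<in> X\<rbrakk> \<Longrightarrow> \<phi> (x \<otimes> y) v = \<phi> x (\<phi> y v)"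
    and faithful: "\<And>x. \<lbrakk>x \<in> carrier G; \<And>v. v \<in> X \<Longrightarrow> \<phi> x v = v\<rbrakk> \<Longrightarrow> x = \<one>"
  shows "card (carrier G) dvd fact (card X)"
proof -
  interpret B: group "BijGroup X" by (rule group_BijGroup)
  let ?\<psi> = "\<lambda>x. restrict (\<phi> x) X"
  have B: "?\<psi> x \<in> Bij X" if "x \<in> carrier G" for x using bij[OF that] by (simp add: Bij_def)
  have "?\<psi> \<in> hom G (BijGroup X)"
  proof (rule homI)
    show "?\<psi> x \<in> carrier (BijGroup X)" if "x \<in> carrier G" for x
      using B[OF that] by (simp add: BijGroup_def)
    show "?\<psi> (x \<otimes> y) = ?\<psi> x \<otimes>\<^bsub>BijGroup X\<^esub> ?\<psi> y" if "x \<in> carrier G" "y \<in> carrier G" for x y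
      using that B mult bij_betwE[OF bij[OF that(2)]]
      by (auto simp: BijGroup_def compose_def fun_eq_iff)
  qed
  then interpret h: group_hom G "BijGroup X" ?\<psi>
    by (simp add: group_hom_def group_hom_axioms_def is_group B.is_group)
  have "inj_on ?\<psi> (carrier G)"
  proof (rule h.inj_on_one_iff[THEN iffD2], intro allI impI)
    fix x assume x: "x \<in> carrier G" and "?\<psi> x = \<one>\<^bsub>BijGroup X\<^esub>"
    then have "\<phi> x v = v" if "v \<in> X" for v
      using that fun_cong[of "?\<psi> x" "\<one>\<^bsub>BijGroup X\<^esub>" v]
      by (simp add: BijGroup_def fun_eq_iff)
    then show "x = \<one>" using faithful x by blast
  qed
  then have "card (carrier G) = card (?\<psi> ` carrier G)" by (simp add: card_image)
  also have "\<dots> dvd order (BijGroup X)"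
    using B.lagrange[OF h.img_is_subgroup] by (metis dvd_triv_right)
  also have "order (BijGroup X) = fact (card X)" using card_Bij[OF fin] by (simp add: order_def BijGroup_def)
  finally show ?thesis .
qed

section \<open>Cartesian decompositions\<close>

lemma cartesian_decomposition_block:
  assumes E: "cartesian_decomposition \<Omega> \<E>" and \<Gamma>: "\<Gamma> \<in> \<E>" and \<omega>: "\<omega> \<in> \<Omega>"
  shows "\<exists>!\<gamma>. \<gamma> \<in> \<Gamma> \<and> \<omega> \<in> \<gamma>"
proof -
  have P: "partition_on \<Omega> \<Gamma>" using E \<Gamma> by (simp add: cartesian_decomposition_def)
  then obtain \<gamma> where "\<gamma> \<in> \<Gamma>" "\<omega> \<in> \<gamma>" using \<omega> unfolding partition_on_def by blast
  moreover have "\<gamma>' = \<gamma>" if "\<gamma>' \<in> \<Gamma>" "\<omega> \<in> \<gamma>'" for \<gamma>'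
    using P that calculation unfolding partition_on_def disjoint_def by blast
  ultimately show ?thesis by blast
qed

lemma cartesian_decomposition_meet:
  assumes E: "cartesian_decomposition \<Omega> \<E>" and c: "\<And>\<Gamma>. \<Gamma> \<in> \<E> \<Longrightarrow> c \<Gamma> \<in> \<Gamma>"
  shows "\<exists>\<alpha>\<in>\<Omega>. (\<Inter>\<Gamma>\<in>\<E>. c \<Gamma>) = {\<alpha>}"
proof -
  have "card (\<Inter>\<Gamma>\<in>\<E>. c \<Gamma>) = 1" using E c unfolding cartesian_decomposition_def by blast
  then obtain \<alpha> where \<alpha>: "(\<Inter>\<Gamma>\<in>\<E>. c \<Gamma>) = {\<alpha>}" by (rule card_1_singletonE)
  have "\<E> \<noteq> {}" using E by (auto simp: cartesian_decomposition_def)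
  then obtain \<Gamma> where \<Gamma>: "\<Gamma> \<in> \<E>" by blast
  then have "\<alpha> \<in> c \<Gamma>" using \<alpha> by blast
  moreover have "c \<Gamma> \<subseteq> \<Omega>"
    using E c[OF \<Gamma>] \<Gamma> unfolding cartesian_decomposition_def partition_on_def by blast
  ultimately show ?thesis using \<alpha> by blast
qed

text \<open>A point corresponds to the family of the blocks that contain it.\<close>

lemma card_cartesian_decomposition:
  fixes \<Omega> :: "'a set"
  assumes E: "cartesian_decomposition \<Omega> \<E>"
  shows "card \<Omega> = (\<Prod>\<Gamma>\<in>\<E>. card \<Gamma>)"
proof -
  have fin: "finite \<E>" using E by (simp add: cartesian_decomposition_def)
  define b where "b \<alpha> \<Gamma> = (THE \<gamma>. \<gamma> \<in> \<Gamma> \<and> \<alpha> \<in> \<gamma>)" for \<alpha> :: 'a and \<Gamma>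
  have b: "b \<alpha> \<Gamma> \<in> \<Gamma> \<and> \<alpha> \<in> b \<alpha> \<Gamma>" if "\<alpha> \<in> \<Omega>" "\<Gamma> \<in> \<E>" for \<alpha> \<Gamma>
    unfolding b_def by (rule theI') (rule cartesian_decomposition_block[OF E that(2,1)])
  have b_eq: "b \<alpha> \<Gamma> = \<gamma>" if "\<alpha> \<in> \<Omega>" "\<Gamma> \<in> \<E>" "\<gamma> \<in> \<Gamma>" "\<alpha> \<in> \<gamma>" for \<alpha> \<Gamma> \<gamma>
    using cartesian_decomposition_block[OF E that(2,1)] b[OF that(1,2)] that(3,4) by blast
  have "bij_betw (\<lambda>\<alpha>. \<lambda>\<Gamma>\<in>\<E>. b \<alpha> \<Gamma>) \<Omega> (\<Pi>\<^sub>E \<Gamma>\<in>\<E>. \<Gamma>)"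
  proof (rule bij_betw_imageI)
    show "inj_on (\<lambda>\<alpha>. \<lambda>\<Gamma>\<in>\<E>. b \<alpha> \<Gamma>) \<Omega>"
    proof (rule inj_onI)
      fix \<alpha> \<beta> assume \<alpha>: "\<alpha> \<in> \<Omega>" and \<beta>: "\<beta> \<in> \<Omega>" and e: "(\<lambda>\<Gamma>\<in>\<E>. b \<alpha> \<Gamma>) = (\<lambda>\<Gamma>\<in>\<E>. b \<beta> \<Gamma>)"
      obtain \<delta> where \<delta>: "(\<Inter>\<Gamma>\<in>\<E>. b \<alpha> \<Gamma>) = {\<delta>}"
        using cartesian_decomposition_meet[OF E, of "b \<alpha>"] b[OF \<alpha>] by blast
      have "b \<alpha> \<Gamma> = b \<beta> \<Gamma>" if "\<Gamma> \<in> \<E>" for \<Gamma> using fun_cong[OF e, of \<Gamma>] that by simp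
      then have "\<alpha> \<in> (\<Inter>\<Gamma>\<in>\<E>. b \<alpha> \<Gamma>)" "\<beta> \<in> (\<Inter>\<Gamma>\<in>\<E>. b \<alpha> \<Gamma>)" using b[OF \<alpha>] b[OF \<beta>] by auto
      then show "\<alpha> = \<beta>" unfolding \<delta> by simp
    qed
    show "(\<lambda>\<alpha>. \<lambda>\<Gamma>\<in>\<E>. b \<alpha> \<Gamma>) ` \<Omega> = (\<Pi>\<^sub>E \<Gamma>\<in>\<E>. \<Gamma>)"
    proof
      show "(\<lambda>\<alpha>. \<lambda>\<Gamma>\<in>\<E>. b \<alpha> \<Gamma>) ` \<Omega> \<subseteq> (\<Pi>\<^sub>E \<Gamma>\<in>\<E>. \<Gamma>)" using b by auto
      show "(\<Pi>\<^sub>E \<Gamma>\<in>\<E>. \<Gamma>) \<subseteq> (\<lambda>\<alpha>. \<lambda>\<Gamma>\<in>\<E>. b \<alpha> \<Gamma>) ` \<Omega>"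
      proof
        fix c assume c: "c \<in> (\<Pi>\<^sub>E \<Gamma>\<in>\<E>. \<Gamma>)"
        then obtain \<alpha> where \<alpha>: "\<alpha> \<in> \<Omega>" "(\<Inter>\<Gamma>\<in>\<E>. c \<Gamma>) = {\<alpha>}"
          using cartesian_decomposition_meet[OF E, of c] by auto
        have "b \<alpha> \<Gamma> = c \<Gamma>" if "\<Gamma> \<in> \<E>" for \<Gamma>
          using b_eq[OF \<alpha>(1) that, of "c \<Gamma>"] \<alpha>(2) c that by blast
        then have "c = (\<lambda>\<Gamma>\<in>\<E>. b \<alpha> \<Gamma>)"
          using c by (auto simp: fun_eq_iff PiE_def extensional_def)
        then show "c \<in> (\<lambda>\<alpha>. \<lambda>\<Gamma>\<in>\<E>. b \<alpha> \<Gamma>) ` \<Omega>" using \<alpha>(1) by blast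
      qed
    qed
  qed
  then have "card \<Omega> = card (\<Pi>\<^sub>E \<Gamma>\<in>\<E>. \<Gamma>)" by (rule bij_betw_same_card)
  also have "\<dots> = (\<Prod>\<Gamma>\<in>\<E>. card \<Gamma>)" using fin by (rule card_PiE)
  finally show ?thesis .
qed

section \<open>Conjugation, and permutations acting on blocks and partitions\<close>

context group
begin

definition conj_by :: "'a \<Rightarrow> 'a \<Rightarrow> 'a" where
  "conj_by g x = g \<otimes> x \<otimes> inv g"

lemma conj_by_closed [simp]: "\<lbrakk>g \<in> carrier G; x \<in> carrier G\<rbrakk> \<Longrightarrow> conj_by g x \<in> carrier G"
  by (simp add: conj_by_def)

lemma conj_by_hom:
  "\<lbrakk>g \<in> carrier G; x \<in> carrier G; y \<in> carrier G\<rbrakk> \<Longrightarrow> conj_by g (x \<otimes> y) = conj_by g x \<otimes> conj_by g y"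
  by (simp add: conj_by_def m_assoc inv_solve_left)

lemma conj_by_mult:
  "\<lbrakk>g \<in> carrier G; h \<in> carrier G; x \<in> carrier G\<rbrakk> \<Longrightarrow> conj_by (g \<otimes> h) x = conj_by g (conj_by h x)"
  by (simp add: conj_by_def m_assoc inv_mult_group)

lemma conj_by_one [simp]: "x \<in> carrier G \<Longrightarrow> conj_by \<one> x = x"
  by (simp add: conj_by_def)

lemma conj_by_inv [simp]:
  assumes "g \<in> carrier G" "x \<in> carrier G"
  shows "conj_by g (conj_by (inv g) x) = x" "conj_by (inv g) (conj_by g x) = x"
  using assms by (simp_all add: conj_by_mult[symmetric])

lemma conj_by_commutator:
  "\<lbrakk>g \<in> carrier G; x \<in> carrier G\<rbrakk> \<Longrightarrow> conj_by g x \<otimes> inv x = g \<otimes> conj_by x (inv g)"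
  by (simp add: conj_by_def m_assoc)

lemma normal_in_subgroup_iff:
  assumes H: "subgroup H G"
  shows "N \<lhd> G\<lparr>carrier := H\<rparr> \<longleftrightarrow> subgroup N G \<and> N \<subseteq> H \<and> (\<forall>g\<in>H. \<forall>x\<in>N. conj_by g x \<in> N)"
proof -
  interpret H: group "G\<lparr>carrier := H\<rparr>" using subgroup.subgroup_is_group[OF H] is_group .
  have "subgroup N (G\<lparr>carrier := H\<rparr>) \<longleftrightarrow> subgroup N G \<and> N \<subseteq> H"
    using incl_subgroup[OF H] subgroup_incl[OF _ H] subgroup.subset by fastforce
  then show ?thesis
    unfolding H.normal_inv_iff using H by (simp add: conj_by_def)
qed

lemma conj_by_image:
  assumes H: "subgroup H G" and N: "\<And>g x. \<lbrakk>g \<in> H; x \<in> N\<rbrakk> \<Longrightarrow> conj_by g x \<in> N"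
    and sub: "N \<subseteq> carrier G" and g: "g \<in> H"
  shows "conj_by g ` N = N"
proof
  show "conj_by g ` N \<subseteq> N" using N g by blast
  show "N \<subseteq> conj_by g ` N"
  proof
    fix x assume x: "x \<in> N"
    have "x = conj_by g (conj_by (inv g) x)"
      using x sub subgroup.mem_carrier[OF H g] by auto
    then show "x \<in> conj_by g ` N" using N[OF subgroup.m_inv_closed[OF H g] x] by blast
  qed
qed

lemma conj_by_iso:
  assumes H: "subgroup H G" and N: "\<And>g x. \<lbrakk>g \<in> H; x \<in> N\<rbrakk> \<Longrightarrow> conj_by g x \<in> N"
    and sub: "N \<subseteq> carrier G" and g: "g \<in> H"
  shows "conj_by g \<in> iso (G\<lparr>carrier := N\<rparr>) (G\<lparr>carrier := N\<rparr>)"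
proof -
  have c: "g \<in> carrier G" using subgroup.mem_carrier[OF H g] .
  have "inj_on (conj_by g) N"
    by (rule inj_on_inverseI[where g = "conj_by (inv g)"]) (use sub c in auto)
  then show ?thesis
    using conj_by_image[OF assms] N[OF g] conj_by_hom[OF c] sub
    by (auto simp: iso_def hom_def bij_betw_def subset_iff)
qed

end

lemma BijGroup_carrier [simp]: "carrier (BijGroup \<Omega>) = Bij \<Omega>"
  by (simp add: BijGroup_def)

lemma Bij_apply_mem: "\<lbrakk>g \<in> Bij \<Omega>; \<alpha> \<in> \<Omega>\<rbrakk> \<Longrightarrow> g \<alpha> \<in> \<Omega>"
  by (rule funcset_mem[OF Bij_imp_funcset])

lemma Bij_eqI: "\<lbrakk>g \<in> Bij \<Omega>; h \<in> Bij \<Omega>; \<And>\<alpha>. \<alpha> \<in> \<Omega> \<Longrightarrow> g \<alpha> = h \<alpha>\<rbrakk> \<Longrightarrow> g = h"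
  by (rule extensionalityI[of _ \<Omega>]) (auto simp: Bij_def)

lemma BijGroup_mult_apply:
  "\<lbrakk>g \<in> Bij \<Omega>; h \<in> Bij \<Omega>; \<alpha> \<in> \<Omega>\<rbrakk> \<Longrightarrow> (g \<otimes>\<^bsub>BijGroup \<Omega>\<^esub> h) \<alpha> = g (h \<alpha>)"
  by (simp add: BijGroup_def compose_def)

lemma BijGroup_one_apply: "\<alpha> \<in> \<Omega> \<Longrightarrow> \<one>\<^bsub>BijGroup \<Omega>\<^esub> \<alpha> = \<alpha>"
  by (simp add: BijGroup_def)

lemma BijGroup_inv_apply:
  assumes "g \<in> Bij \<Omega>" "\<alpha> \<in> \<Omega>"
  shows "(inv\<^bsub>BijGroup \<Omega>\<^esub> g) (g \<alpha>) = \<alpha>" "g ((inv\<^bsub>BijGroup \<Omega>\<^esub> g) \<alpha>) = \<alpha>"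
    "inv\<^bsub>BijGroup \<Omega>\<^esub> g \<in> Bij \<Omega>"
proof -
  interpret group "BijGroup \<Omega>" by (rule group_BijGroup)
  show i: "inv\<^bsub>BijGroup \<Omega>\<^esub> g \<in> Bij \<Omega>" using inv_closed[of g] assms by simp
  show "(inv\<^bsub>BijGroup \<Omega>\<^esub> g) (g \<alpha>) = \<alpha>" "g ((inv\<^bsub>BijGroup \<Omega>\<^esub> g) \<alpha>) = \<alpha>"
    using assms i l_inv[of g] r_inv[of g]
      BijGroup_mult_apply[OF i assms(1,2)] BijGroup_mult_apply[OF assms(1) i assms(2)]
    by (simp_all add: BijGroup_one_apply)
qed

lemma BijGroup_mult_image:
  "\<lbrakk>g \<in> Bij \<Omega>; h \<in> Bij \<Omega>; A \<subseteq> \<Omega>\<rbrakk> \<Longrightarrow> (g \<otimes>\<^bsub>BijGroup \<Omega>\<^esub> h) ` A = g ` (h ` A)"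
  unfolding image_image by (rule image_cong) (auto simp: BijGroup_mult_apply)

lemma BijGroup_one_image: "A \<subseteq> \<Omega> \<Longrightarrow> \<one>\<^bsub>BijGroup \<Omega>\<^esub> ` A = A"
  by (auto simp: BijGroup_one_apply image_iff subset_iff)

lemma BijGroup_inv_image:
  assumes "g \<in> Bij \<Omega>" "A \<subseteq> \<Omega>"
  shows "(inv\<^bsub>BijGroup \<Omega>\<^esub> g) ` (g ` A) = A" "g ` ((inv\<^bsub>BijGroup \<Omega>\<^esub> g) ` A) = A"
proof -
  have "(\<lambda>x. (inv\<^bsub>BijGroup \<Omega>\<^esub> g) (g x)) ` A = (\<lambda>x. x) ` A"
    by (rule image_cong) (use assms(2) BijGroup_inv_apply(1)[OF assms(1)] in auto)
  moreover have "(\<lambda>x. g ((inv\<^bsub>BijGroup \<Omega>\<^esub> g) x)) ` A = (\<lambda>x. x) ` A"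
    by (rule image_cong) (use assms(2) BijGroup_inv_apply(2)[OF assms(1)] in auto)
  ultimately show "(inv\<^bsub>BijGroup \<Omega>\<^esub> g) ` (g ` A) = A" "g ` ((inv\<^bsub>BijGroup \<Omega>\<^esub> g) ` A) = A"
    by (simp_all add: image_image)
qed

lemma Bij_image_subset: "\<lbrakk>g \<in> Bij \<Omega>; A \<subseteq> \<Omega>\<rbrakk> \<Longrightarrow> g ` A \<subseteq> \<Omega>"
  by (auto intro: Bij_apply_mem)

lemma BijGroup_act_mult:
  assumes "g \<in> Bij \<Omega>" "h \<in> Bij \<Omega>" "\<Gamma> \<subseteq> Pow \<Omega>"
  shows "image (image (g \<otimes>\<^bsub>BijGroup \<Omega>\<^esub> h)) \<Gamma> = image (image g) (image (image h) \<Gamma>)"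
  unfolding image_image[of "image g"]
  by (rule image_cong[OF refl]) (use BijGroup_mult_image[OF assms(1,2)] assms(3) in auto)

lemma BijGroup_act_inv:
  assumes "g \<in> Bij \<Omega>" "\<Gamma> \<subseteq> Pow \<Omega>"
  shows "image (image (inv\<^bsub>BijGroup \<Omega>\<^esub> g)) (image (image g) \<Gamma>) = \<Gamma>"
    "image (image g) (image (image (inv\<^bsub>BijGroup \<Omega>\<^esub> g)) \<Gamma>) = \<Gamma>"
proof -
  have "(\<lambda>\<gamma>. (inv\<^bsub>BijGroup \<Omega>\<^esub> g) ` (g ` \<gamma>)) ` \<Gamma> = (\<lambda>\<gamma>. \<gamma>) ` \<Gamma>"
    by (rule image_cong[OF refl]) (use BijGroup_inv_image(1)[OF assms(1)] assms(2) in auto)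
  then show "image (image (inv\<^bsub>BijGroup \<Omega>\<^esub> g)) (image (image g) \<Gamma>) = \<Gamma>"
    unfolding image_image[of "image (inv\<^bsub>BijGroup \<Omega>\<^esub> g)"] by simp
  have "(\<lambda>\<gamma>. g ` ((inv\<^bsub>BijGroup \<Omega>\<^esub> g) ` \<gamma>)) ` \<Gamma> = (\<lambda>\<gamma>. \<gamma>) ` \<Gamma>"
    by (rule image_cong[OF refl]) (use BijGroup_inv_image(2)[OF assms(1)] assms(2) in auto)
  then show "image (image g) (image (image (inv\<^bsub>BijGroup \<Omega>\<^esub> g)) \<Gamma>) = \<Gamma>"
    unfolding image_image[of "image g"] by simp
qed

section \<open>The plinth of a group of diagonal type\<close>

text \<open>The factor projections are the components of the inverse of the product isomorphism.\<close>

lemma internal_direct_product_simple_product: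
  assumes M: "group M" and dp: "internal_direct_product M k S"
    and simple: "\<And>i. i < k \<Longrightarrow> nonabelian_simple_group (M\<lparr>carrier := S i\<rparr>)"
  shows "simple_product M {..<k} (\<lambda>i. M\<lparr>carrier := S i\<rparr>) (factor_proj M k S)"
proof -
  interpret group M by (rule M)
  let ?P = "external_prod M k S"
  have sub: "subgroup (S i) M" if "i < k" for i using dp that by (simp add: internal_direct_product_def)
  have grp: "group (M\<lparr>carrier := S i\<rparr>)" if "i < k" for i
    using subgroup.subgroup_is_group[OF sub[OF that] M] .
  have iso: "ordered_prod M k \<in> iso ?P M" using dp by (simp add: internal_direct_product_def)
  have P: "group ?P" unfolding external_prod_def by (rule product_group) (simp add: grp)
  have carP: "carrier ?P = (\<Pi>\<^sub>E i\<in>{..<k}. S i)" by (simp add: external_prod_def)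
  define q where "q = inv_into (carrier ?P) (ordered_prod M k)"
  have q: "q \<in> iso M ?P" unfolding q_def by (rule group.iso_set_sym[OF P iso])
  have surj: "q ` carrier M = carrier ?P" using q by (simp add: iso_def bij_betw_def)
  have proj: "factor_proj M k S i x = q x i" for i x by (simp add: factor_proj_def q_def)
  have qP: "q x \<in> (\<Pi>\<^sub>E i\<in>{..<k}. S i)" if "x \<in> carrier M" for x
    using q that carP by (auto simp: iso_def hom_def)
  show ?thesis
  proof (unfold_locales)
    show "factor_proj M k S i \<in> hom M (M\<lparr>carrier := S i\<rparr>)" if i: "i \<in> {..<k}" for i
    proof (rule homI)
      show "factor_proj M k S i x \<in> carrier (M\<lparr>carrier := S i\<rparr>)" if "x \<in> carrier M" for x
        using qP[OF that] i unfolding proj by auto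
      show "factor_proj M k S i (x \<otimes>\<^bsub>M\<^esub> y) = factor_proj M k S i x \<otimes>\<^bsub>M\<lparr>carrier := S i\<rparr>\<^esub> factor_proj M k S i y"
        if "x \<in> carrier M" "y \<in> carrier M" for x y
        using q i that by (auto simp: proj iso_def hom_def external_prod_def)
    qed
    show "x = y" if "x \<in> carrier M" "y \<in> carrier M"
      and "\<And>i. i \<in> {..<k} \<Longrightarrow> factor_proj M k S i x = factor_proj M k S i y" for x y
    proof -
      have "q x = q y" using qP[OF that(1)] qP[OF that(2)] that(3)
        unfolding proj by (intro PiE_ext) auto
      then show ?thesis using q that(1,2) by (auto simp: iso_def bij_betw_def dest: inj_onD)
    qed
    show "\<exists>x\<in>carrier M. \<forall>i\<in>{..<k}. factor_proj M k S i x = t i"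
      if t: "\<And>i. i \<in> {..<k} \<Longrightarrow> t i \<in> carrier (M\<lparr>carrier := S i\<rparr>)" for t
    proof -
      have "restrict t {..<k} \<in> carrier ?P" using t unfolding carP by simp
      then obtain x where x: "x \<in> carrier M" "q x = restrict t {..<k}"
        using surj by (metis imageE)
      then show ?thesis unfolding proj by (intro bexI[of _ x]) auto
    qed
    show "nonabelian_simple_group (M\<lparr>carrier := S i\<rparr>)" if "i \<in> {..<k}" for i using simple that by simp
  qed simp
qed

locale diagonal_group =
  fixes \<Omega> :: "'a set" and G M :: "('a \<Rightarrow> 'a) set" and k :: nat
    and S :: "nat \<Rightarrow> ('a \<Rightarrow> 'a) set" and T :: "('t, 'm) monoid_scheme"
  assumes finite_\<Omega>: "finite \<Omega>" and diagonal: "diagonal_type \<Omega> G M k S T"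
begin

sublocale B: group "BijGroup \<Omega>" by (rule group_BijGroup)

lemma G_subgroup: "subgroup G (BijGroup \<Omega>)"
  using diagonal by (simp add: diagonal_type_def innately_transitive_def permutation_group_def)

lemma G_Bij: "g \<in> G \<Longrightarrow> g \<in> Bij \<Omega>"
  using subgroup.mem_carrier[OF G_subgroup] by simp

lemma M_minimal: "minimal_normal_subgroup M (perm_grp \<Omega> G)"
  using diagonal by (simp add: diagonal_type_def plinth_def)

lemma M_normal: "M \<lhd> perm_grp \<Omega> G"
  using M_minimal by (simp add: minimal_normal_subgroup_def)

lemma M_subgroup: "subgroup M (BijGroup \<Omega>)" and M_sub_G: "M \<subseteq> G"
  and M_conj: "\<lbrakk>g \<in> G; x \<in> M\<rbrakk> \<Longrightarrow> B.conj_by g x \<in> M"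
  using M_normal unfolding B.normal_in_subgroup_iff[OF G_subgroup] by auto

lemma M_Bij: "x \<in> M \<Longrightarrow> x \<in> Bij \<Omega>"
  using subgroup.mem_carrier[OF M_subgroup] by simp

lemma normal_in_G_cases:
  assumes "subgroup N (BijGroup \<Omega>)" "N \<subseteq> M" "\<And>g x. \<lbrakk>g \<in> G; x \<in> N\<rbrakk> \<Longrightarrow> B.conj_by g x \<in> N"
  shows "N = {\<one>\<^bsub>BijGroup \<Omega>\<^esub>} \<or> N = M"
proof -
  have "N \<lhd> perm_grp \<Omega> G"
    unfolding B.normal_in_subgroup_iff[OF G_subgroup] using assms M_sub_G by blast
  then show ?thesis using M_minimal assms(2) unfolding minimal_normal_subgroup_def by auto
qed

lemma M_transitive: "\<lbrakk>\<alpha> \<in> \<Omega>; \<beta> \<in> \<Omega>\<rbrakk> \<Longrightarrow> \<exists>m\<in>M. m \<alpha> = \<beta>"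
  using diagonal transitive_action.unique_orbit[of "perm_grp \<Omega> M" \<Omega> "\<lambda>g. g"]
  by (simp add: diagonal_type_def plinth_def)

sublocale P: simple_product "perm_grp \<Omega> M" "{..<k}" "\<lambda>i. perm_grp \<Omega> (S i)" "factor_proj (perm_grp \<Omega> M) k S"
proof -
  have "group (perm_grp \<Omega> M)" using subgroup.subgroup_is_group[OF M_subgroup B.is_group] .
  moreover have "internal_direct_product (perm_grp \<Omega> M) k S"
    and "\<And>i. i < k \<Longrightarrow> nonabelian_simple_group (perm_grp \<Omega> M\<lparr>carrier := S i\<rparr>)"
    using diagonal by (simp_all add: diagonal_type_def)
  ultimately have "simple_product (perm_grp \<Omega> M) {..<k} (\<lambda>i. perm_grp \<Omega> M\<lparr>carrier := S i\<rparr>) (factor_proj (perm_grp \<Omega> M) k S)"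
    by (rule internal_direct_product_simple_product)
  then show "simple_product (perm_grp \<Omega> M) {..<k} (\<lambda>i. perm_grp \<Omega> (S i)) (factor_proj (perm_grp \<Omega> M) k S)"
    by simp
qed

lemma M_nontrivial: "M \<noteq> {\<one>\<^bsub>BijGroup \<Omega>\<^esub>}"
  using M_minimal by (simp add: minimal_normal_subgroup_def)

lemma k_pos: "0 < k"
proof (rule ccontr)
  assume "\<not> 0 < k"
  then have "x = \<one>\<^bsub>BijGroup \<Omega>\<^esub>" if "x \<in> M" for x
    using P.coords_eqI[of x "\<one>\<^bsub>BijGroup \<Omega>\<^esub>"] that subgroup.one_closed[OF M_subgroup] by simp
  then show False using M_nontrivial subgroup.one_closed[OF M_subgroup] by blast
qed

lemma \<Omega>_nonempty: "\<Omega> \<noteq> {}"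
proof
  assume "\<Omega> = {}"
  then have "x = \<one>\<^bsub>BijGroup \<Omega>\<^esub>" if "x \<in> M" for x
    using Bij_eqI[OF M_Bij[OF that], of "\<one>\<^bsub>BijGroup \<Omega>\<^esub>"] B.one_closed by simp
  then show False using M_nontrivial subgroup.one_closed[OF M_subgroup] by blast
qed

lemma finite_M: "finite M"
proof -
  have "finite (Bij \<Omega>)" using card_Bij[OF finite_\<Omega>] by (metis card.infinite fact_nonzero)
  then show ?thesis by (rule finite_subset[rotated]) (auto intro: M_Bij)
qed

lemma full_iff_subdirect: "P.full K \<longleftrightarrow> subdirect (perm_grp \<Omega> M) k S K"
  by (simp add: P.full_def subdirect_def Ball_def)

definition stab :: "'a \<Rightarrow> ('a \<Rightarrow> 'a) set" where
  "stab \<omega> = {x \<in> M. x \<omega> = \<omega>}"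

lemma stab_eq: "stab \<omega> = stabilizer (perm_grp \<Omega> M) (\<lambda>g. g) \<omega>"
  by (simp add: stab_def stabilizer_def)

lemma full_stab: "\<omega> \<in> \<Omega> \<Longrightarrow> P.full (stab \<omega>)"
  using diagonal by (simp add: full_iff_subdirect stab_eq diagonal_type_def)

lemma subgroup_stab: "\<omega> \<in> \<Omega> \<Longrightarrow> subgroup (stab \<omega>) (BijGroup \<Omega>)"
  using full_stab B.incl_subgroup[OF M_subgroup] by (simp add: P.full_def)

lemma conj_iso: "g \<in> G \<Longrightarrow> B.conj_by g \<in> iso (perm_grp \<Omega> M) (perm_grp \<Omega> M)"
  by (rule B.conj_by_iso[OF G_subgroup M_conj]) (use M_Bij in auto)

lemma conj_factor_ker: "\<lbrakk>g \<in> G; i < k\<rbrakk> \<Longrightarrow> \<exists>j<k. B.conj_by g ` P.factor_ker i = P.factor_ker j"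
  using P.iso_factor_ker[OF conj_iso, of g i] by auto

lemma factor_ker_sub: "P.factor_ker i \<subseteq> M"
  using P.factor_ker_subset by simp

lemma factor_ker_conj:
  assumes x: "x \<in> M" and i: "i < k" and y: "y \<in> P.factor_ker i"
  shows "B.conj_by x y \<in> P.factor_ker i"
  using P.factor_ker_normal[of i] i x y
  by (simp add: B.normal_in_subgroup_iff[OF M_subgroup])

lemma conj_factor_ker_M:
  assumes "x \<in> M" "i < k"
  shows "B.conj_by x ` P.factor_ker i = P.factor_ker i"
  by (rule B.conj_by_image[OF M_subgroup factor_ker_conj])
    (use assms factor_ker_sub M_Bij in auto)

lemma conj_by_image_mult:
  "\<lbrakk>g \<in> G; h \<in> G; K \<subseteq> M\<rbrakk> \<Longrightarrow> B.conj_by (g \<otimes>\<^bsub>BijGroup \<Omega>\<^esub> h) ` K = B.conj_by g ` (B.conj_by h ` K)"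
  unfolding image_image by (rule image_cong) (auto simp: B.conj_by_mult G_Bij M_Bij)

text \<open>The intersection of the kernels in one \<open>G\<close>-orbit is normal in \<open>G\<close> and proper in \<open>M\<close>, so it is trivial by
minimality of \<open>M\<close>. If the orbit missed some kernel \<open>j\<close>, the intersection would contain the factor \<open>j\<close>.\<close>

lemma G_transitive_factor_kers:
  assumes i: "i < k" and j: "j < k"
  shows "\<exists>g\<in>G. B.conj_by g ` P.factor_ker i = P.factor_ker j"
proof (rule ccontr)
  assume no: "\<not> ?thesis"
  define J where "J = {l. l < k \<and> (\<exists>g\<in>G. B.conj_by g ` P.factor_ker i = P.factor_ker l)}"
  have iJ: "i \<in> J"
    using i subgroup.one_closed[OF G_subgroup] conj_factor_ker_M[OF subgroup.one_closed[OF M_subgroup] i]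
    by (auto simp: J_def)
  have jJ: "j \<notin> J" using no by (auto simp: J_def)
  define N where "N = (\<Inter>l\<in>J. P.factor_ker l)"
  have Jk: "l < k" if "l \<in> J" for l using that by (simp add: J_def)
  have NM: "N \<subseteq> M" using iJ factor_ker_sub by (auto simp: N_def)
  have kersub: "subgroup (P.factor_ker l) (BijGroup \<Omega>)" if "l < k" for l
    using P.factor_ker_normal[of l] that by (simp add: B.normal_in_subgroup_iff[OF M_subgroup])
  have "subgroup N (BijGroup \<Omega>)"
    unfolding N_def by (rule B.subgroups_Inter) (use iJ kersub Jk in auto)
  moreover have "B.conj_by g x \<in> N" if g: "g \<in> G" and x: "x \<in> N" for g x
    unfolding N_def
  proof
    fix l assume l: "l \<in> J"
    then obtain h where h: "h \<in> G" "B.conj_by h ` P.factor_ker i = P.factor_ker l" by (auto simp: J_def)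
    have gi: "inv\<^bsub>BijGroup \<Omega>\<^esub> g \<in> G" using g by (rule subgroup.m_inv_closed[OF G_subgroup])
    obtain l' where l': "l' < k" "B.conj_by (inv\<^bsub>BijGroup \<Omega>\<^esub> g) ` P.factor_ker l = P.factor_ker l'"
      using conj_factor_ker[OF gi Jk[OF l]] by blast
    have "B.conj_by (inv\<^bsub>BijGroup \<Omega>\<^esub> g \<otimes>\<^bsub>BijGroup \<Omega>\<^esub> h) ` P.factor_ker i = P.factor_ker l'"
      using conj_by_image_mult[OF gi h(1) factor_ker_sub] h(2) l'(2) by simp
    then have "l' \<in> J" using l'(1) subgroup.m_closed[OF G_subgroup gi h(1)] by (auto simp: J_def)
    then have "x \<in> P.factor_ker l'" using x by (auto simp: N_def)
    then obtain y where y: "y \<in> P.factor_ker l" "x = B.conj_by (inv\<^bsub>BijGroup \<Omega>\<^esub> g) y"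
      using l'(2) by blast
    then have "B.conj_by g x = y"
      using B.conj_by_inv(1)[of g y] G_Bij[OF g] M_Bij[OF subsetD[OF factor_ker_sub y(1)]] by simp
    with y show "B.conj_by g x \<in> P.factor_ker l" by simp
  qed
  ultimately have "N = {\<one>\<^bsub>BijGroup \<Omega>\<^esub>} \<or> N = M" using normal_in_G_cases NM by blast
  moreover have "N \<noteq> M"
    using P.factor_ker_proper[of i] i iJ factor_ker_sub[of i] by (auto simp: N_def)
  moreover have "N \<noteq> {\<one>\<^bsub>BijGroup \<Omega>\<^esub>}"
  proof -
    obtain t where t: "t \<in> S j" "t \<noteq> \<one>\<^bsub>BijGroup \<Omega>\<^esub>" using P.T_nontrivial[of j] j by auto
    obtain x where x: "x \<in> M" "factor_proj (perm_grp \<Omega> M) k S j x = t"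
      "\<forall>l<k. l \<noteq> j \<longrightarrow> factor_proj (perm_grp \<Omega> M) k S l x = \<one>\<^bsub>BijGroup \<Omega>\<^esub>"
      using P.coords_single[of j t] j t(1) by auto
    then have "x \<in> N" using jJ Jk by (auto simp: N_def P.factor_ker_def)
    moreover have "x \<noteq> \<one>\<^bsub>BijGroup \<Omega>\<^esub>" using x(2) j t(2) P.p_one[of j] by auto
    ultimately show ?thesis by blast
  qed
  ultimately show False by blast
qed

text \<open>\<open>G\<close> is the product of \<open>M\<close> and the stabiliser of \<open>\<omega>\<close>, and \<open>M\<close> normalises each kernel.\<close>

lemma stab_transitive_factor_kers:
  assumes \<omega>: "\<omega> \<in> \<Omega>" and i: "i < k" and j: "j < k"
  shows "\<exists>h\<in>G. h \<omega> = \<omega> \<and> B.conj_by h ` P.factor_ker i = P.factor_ker j"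
proof -
  obtain g where g: "g \<in> G" "B.conj_by g ` P.factor_ker i = P.factor_ker j"
    using G_transitive_factor_kers[OF i j] by blast
  obtain m where m: "m \<in> M" "m (g \<omega>) = \<omega>"
    using M_transitive Bij_apply_mem[OF G_Bij[OF g(1)] \<omega>] \<omega> by blast
  have "(m \<otimes>\<^bsub>BijGroup \<Omega>\<^esub> g) \<omega> = \<omega>"
    using BijGroup_mult_apply[OF M_Bij[OF m(1)] G_Bij[OF g(1)] \<omega>] m by simp
  moreover have "B.conj_by (m \<otimes>\<^bsub>BijGroup \<Omega>\<^esub> g) ` P.factor_ker i = P.factor_ker j"
    using conj_by_image_mult[OF subsetD[OF M_sub_G m(1)] g(1) factor_ker_sub, of i]
      g(2) conj_factor_ker_M[OF m(1) j] by simp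
  moreover have "m \<otimes>\<^bsub>BijGroup \<Omega>\<^esub> g \<in> G" using m g M_sub_G subgroup.m_closed[OF G_subgroup] by blast
  ultimately show ?thesis by blast
qed

lemma conj_stab:
  assumes g: "g \<in> G" and \<omega>: "\<omega> \<in> \<Omega>"
  shows "B.conj_by g ` stab \<omega> = stab (g \<omega>)"
proof -
  have *: "B.conj_by h x \<in> stab (h \<alpha>)" if h: "h \<in> G" and x: "x \<in> stab \<alpha>" and \<alpha>: "\<alpha> \<in> \<Omega>" for h x \<alpha>
  proof -
    have xM: "x \<in> M" "x \<alpha> = \<alpha>" using x by (auto simp: stab_def)
    have hB: "h \<in> Bij \<Omega>" and xB: "x \<in> Bij \<Omega>" using h xM G_Bij M_Bij by auto
    have "B.conj_by h x (h \<alpha>) = h \<alpha>"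
      unfolding B.conj_by_def
      using hB xB \<alpha> xM BijGroup_inv_apply[OF hB] Bij_apply_mem[OF hB] B.m_closed[of h x]
      by (simp add: BijGroup_mult_apply)
    then show ?thesis using M_conj[OF h xM(1)] by (simp add: stab_def)
  qed
  show ?thesis
  proof
    show "B.conj_by g ` stab \<omega> \<subseteq> stab (g \<omega>)" using * g \<omega> by blast
    show "stab (g \<omega>) \<subseteq> B.conj_by g ` stab \<omega>"
    proof
      fix x assume x: "x \<in> stab (g \<omega>)"
      have gi: "inv\<^bsub>BijGroup \<Omega>\<^esub> g \<in> G" using g by (rule subgroup.m_inv_closed[OF G_subgroup])
      have "B.conj_by (inv\<^bsub>BijGroup \<Omega>\<^esub> g) x \<in> stab \<omega>"
        using *[OF gi x] Bij_apply_mem[OF G_Bij[OF g] \<omega>] BijGroup_inv_apply[OF G_Bij[OF g] \<omega>] by simp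
      moreover have "x = B.conj_by g (B.conj_by (inv\<^bsub>BijGroup \<Omega>\<^esub> g) x)"
        using x g G_Bij M_Bij by (simp add: stab_def)
      ultimately show "x \<in> B.conj_by g ` stab \<omega>" by blast
    qed
  qed
qed

section \<open>Quasiprimitivity\<close>

text \<open>If \<open>m \<in> M\<close> maps \<open>\<omega>\<close> to \<open>c \<omega>\<close>, then \<open>m\<close> and \<open>c\<close> conjugate the stabiliser of \<open>\<omega>\<close> to the same group. For \<open>c\<close>
this is the stabiliser itself, so \<open>m\<close> normalises it and hence lies in it.\<close>

lemma centralizer_trivial:
  assumes c: "c \<in> G" and comm: "\<And>x. x \<in> M \<Longrightarrow> B.conj_by c x = x"
  shows "c = \<one>\<^bsub>BijGroup \<Omega>\<^esub>"
proof (rule Bij_eqI)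
  show cB: "c \<in> Bij \<Omega>" using c by (rule G_Bij)
  show "\<one>\<^bsub>BijGroup \<Omega>\<^esub> \<in> Bij \<Omega>" using B.one_closed by simp
  fix \<omega> assume \<omega>: "\<omega> \<in> \<Omega>"
  obtain m where m: "m \<in> M" "m \<omega> = c \<omega>" using M_transitive[OF \<omega> Bij_apply_mem[OF cB \<omega>]] by blast
  have "B.conj_by c ` stab \<omega> = stab \<omega>" using comm by (force simp: stab_def)
  then have "stab (m \<omega>) = stab \<omega>" using conj_stab[OF c \<omega>] m by simp
  then have im: "B.conj_by m ` stab \<omega> = stab \<omega>" using conj_stab[OF _ \<omega>, of m] m M_sub_G by auto
  have "m \<in> stab \<omega>"
  proof (rule P.full_self_normalizing[OF full_stab[OF \<omega>]])
    show "m \<in> carrier (perm_grp \<Omega> M)" using m by simp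
    fix u assume "u \<in> stab \<omega>"
    then have "B.conj_by m u \<in> stab \<omega>" using im by blast
    then show "m \<otimes>\<^bsub>perm_grp \<Omega> M\<^esub> u \<otimes>\<^bsub>perm_grp \<Omega> M\<^esub> inv\<^bsub>perm_grp \<Omega> M\<^esub> m \<in> stab \<omega>"
      using m(1) M_subgroup by (simp add: B.conj_by_def)
  qed
  then show "c \<omega> = \<one>\<^bsub>BijGroup \<Omega>\<^esub> \<omega>" using m \<omega> by (simp add: stab_def BijGroup_one_apply)
qed

text \<open>A minimal normal subgroup \<open>N\<close> that meets \<open>M\<close> trivially commutes with \<open>M\<close>, because commutators of
elements of \<open>N\<close> and \<open>M\<close> lie in both; then \<open>centralizer_trivial\<close> makes \<open>N\<close> trivial. Hence \<open>N\<close> contains \<open>M\<close>,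
and it equals \<open>M\<close> by its own minimality.\<close>

lemma quasiprimitive: "quasiprimitive \<Omega> G"
  unfolding quasiprimitive_def
proof (intro conjI allI impI)
  show "permutation_group \<Omega> G" using G_subgroup by (simp add: permutation_group_def)
  fix N assume N: "minimal_normal_subgroup N (perm_grp \<Omega> G)"
  then have NB: "subgroup N (BijGroup \<Omega>)" and NG: "N \<subseteq> G"
    and Nc: "\<And>g x. g \<in> G \<Longrightarrow> x \<in> N \<Longrightarrow> B.conj_by g x \<in> N"
    and N1: "N \<noteq> {\<one>\<^bsub>BijGroup \<Omega>\<^esub>}"
    unfolding minimal_normal_subgroup_def B.normal_in_subgroup_iff[OF G_subgroup] by auto
  have "subgroup (N \<inter> M) (BijGroup \<Omega>)" using NB M_subgroup by (rule B.subgroups_Inter_pair)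
  then have "N \<inter> M = {\<one>\<^bsub>BijGroup \<Omega>\<^esub>} \<or> N \<inter> M = M"
    using normal_in_G_cases[of "N \<inter> M"] Nc M_conj by auto
  moreover have "N \<inter> M \<noteq> {\<one>\<^bsub>BijGroup \<Omega>\<^esub>}"
  proof
    assume i: "N \<inter> M = {\<one>\<^bsub>BijGroup \<Omega>\<^esub>}"
    have "c = \<one>\<^bsub>BijGroup \<Omega>\<^esub>" if c: "c \<in> N" for c
    proof (rule centralizer_trivial)
      show cG: "c \<in> G" using c NG by blast
      fix x assume x: "x \<in> M"
      have cB: "c \<in> Bij \<Omega>" "x \<in> Bij \<Omega>" using cG x G_Bij M_Bij by auto
      have "B.conj_by c x \<otimes>\<^bsub>BijGroup \<Omega>\<^esub> inv\<^bsub>BijGroup \<Omega>\<^esub> x \<in> M"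
        using M_conj[OF cG x] x by (simp add: subgroup.m_closed[OF M_subgroup] subgroup.m_inv_closed[OF M_subgroup])
      moreover have "B.conj_by c x \<otimes>\<^bsub>BijGroup \<Omega>\<^esub> inv\<^bsub>BijGroup \<Omega>\<^esub> x = c \<otimes>\<^bsub>BijGroup \<Omega>\<^esub> B.conj_by x (inv\<^bsub>BijGroup \<Omega>\<^esub> c)"
        using cB by (intro B.conj_by_commutator) simp_all
      moreover have "c \<otimes>\<^bsub>BijGroup \<Omega>\<^esub> B.conj_by x (inv\<^bsub>BijGroup \<Omega>\<^esub> c) \<in> N"
        using Nc[of x "inv\<^bsub>BijGroup \<Omega>\<^esub> c"] x c M_sub_G
        by (auto intro!: subgroup.m_closed[OF NB] simp: subgroup.m_inv_closed[OF NB])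
      ultimately have "B.conj_by c x \<otimes>\<^bsub>BijGroup \<Omega>\<^esub> inv\<^bsub>BijGroup \<Omega>\<^esub> x = \<one>\<^bsub>BijGroup \<Omega>\<^esub>" using i by auto
      then show "B.conj_by c x = x" using cB B.conj_by_closed[of c x] B.inv_solve_right'[of "\<one>\<^bsub>BijGroup \<Omega>\<^esub>" "B.conj_by c x" x] B.one_closed by simp
    qed
    then show False using N1 subgroup.one_closed[OF NB] by blast
  qed
  ultimately have "M \<subseteq> N" by blast
  then have "M = N" using N M_normal M_nontrivial unfolding minimal_normal_subgroup_def by auto
  then show "transitive_action (perm_grp \<Omega> N) \<Omega> (\<lambda>g. g)"
    using diagonal by (simp add: diagonal_type_def plinth_def)
qed

section \<open>The plinth fixes every partition of an invariant decomposition\<close>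

lemma inv_mult_mem_iff:
  assumes "x \<in> M" "y \<in> M" "\<alpha> \<in> \<Omega>"
  shows "(inv\<^bsub>BijGroup \<Omega>\<^esub> x \<otimes>\<^bsub>BijGroup \<Omega>\<^esub> y) \<alpha> = \<alpha> \<longleftrightarrow> x \<alpha> = y \<alpha>"
proof -
  have x: "x \<in> Bij \<Omega>" and y: "y \<in> Bij \<Omega>" using assms M_Bij by auto
  have "(inv\<^bsub>BijGroup \<Omega>\<^esub> x \<otimes>\<^bsub>BijGroup \<Omega>\<^esub> y) \<alpha> = (inv\<^bsub>BijGroup \<Omega>\<^esub> x) (y \<alpha>)"
    using BijGroup_mult_apply[OF BijGroup_inv_apply(3)[OF x assms(3)] y assms(3)] .
  then show ?thesis
    using BijGroup_inv_apply[OF x assms(3)] BijGroup_inv_apply[OF x Bij_apply_mem[OF y assms(3)]] by metis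
qed

lemma card_M_eq:
  assumes \<omega>: "\<omega> \<in> \<Omega>"
  shows "card M = card \<Omega> * card (stab \<omega>)"
proof -
  have "card (carrier (perm_grp \<Omega> M)) = card ((\<lambda>x. x \<omega>) ` carrier (perm_grp \<Omega> M)) * card (stab \<omega>)"
  proof (rule P.card_eq_card_image_times_fibre)
    show "finite (carrier (perm_grp \<Omega> M))" using finite_M by simp
    show "subgroup (stab \<omega>) (perm_grp \<Omega> M)" using full_stab[OF \<omega>] by (simp add: P.full_def)
    fix x y assume x: "x \<in> carrier (perm_grp \<Omega> M)" and y: "y \<in> carrier (perm_grp \<Omega> M)"
    have "inv\<^bsub>BijGroup \<Omega>\<^esub> x \<otimes>\<^bsub>BijGroup \<Omega>\<^esub> y \<in> M"
      using x y by (simp add: subgroup.m_closed[OF M_subgroup] subgroup.m_inv_closed[OF M_subgroup])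
    then show "x \<omega> = y \<omega> \<longleftrightarrow> inv\<^bsub>perm_grp \<Omega> M\<^esub> x \<otimes>\<^bsub>perm_grp \<Omega> M\<^esub> y \<in> stab \<omega>"
      using x y M_subgroup inv_mult_mem_iff[OF _ _ \<omega>] by (simp add: stab_def)
  qed
  moreover have "(\<lambda>x. x \<omega>) ` M = \<Omega>"
  proof
    show "(\<lambda>x. x \<omega>) ` M \<subseteq> \<Omega>" by (auto intro: Bij_apply_mem[OF M_Bij \<omega>])
    show "\<Omega> \<subseteq> (\<lambda>x. x \<omega>) ` M"
    proof
      fix \<beta> assume "\<beta> \<in> \<Omega>"
      then obtain m where "m \<in> M" "m \<omega> = \<beta>" using M_transitive[OF \<omega>] by blast
      then show "\<beta> \<in> (\<lambda>x. x \<omega>) ` M" by blast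
    qed
  qed
  ultimately show ?thesis by simp
qed

lemma CD_cartesian: "\<E> \<in> CD \<Omega> G \<Longrightarrow> cartesian_decomposition \<Omega> \<E>"
  by (simp add: CD_def)

lemma CD_act: "\<lbrakk>\<E> \<in> CD \<Omega> G; g \<in> G; \<Gamma> \<in> \<E>\<rbrakk> \<Longrightarrow> image (image g) \<Gamma> \<in> \<E>"
  unfolding CD_def by blast

lemma CD_partition: "\<lbrakk>\<E> \<in> CD \<Omega> G; \<Gamma> \<in> \<E>\<rbrakk> \<Longrightarrow> partition_on \<Omega> \<Gamma>"
  by (simp add: CD_def cartesian_decomposition_def)

lemma CD_block_subset: "\<lbrakk>\<E> \<in> CD \<Omega> G; \<Gamma> \<in> \<E>; \<gamma> \<in> \<Gamma>\<rbrakk> \<Longrightarrow> \<gamma> \<subseteq> \<Omega>"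
  using partition_onD1[OF CD_partition] by (metis Union_upper)

lemma CD_partition_subset: "\<lbrakk>\<E> \<in> CD \<Omega> G; \<Gamma> \<in> \<E>\<rbrakk> \<Longrightarrow> \<Gamma> \<subseteq> Pow \<Omega>"
  using CD_block_subset by (metis PowI subsetI)

lemma CD_block_nonempty:
  assumes "\<E> \<in> CD \<Omega> G" "\<Gamma> \<in> \<E>" "\<gamma> \<in> \<Gamma>"
  shows "\<exists>\<alpha>. \<alpha> \<in> \<gamma>"
  using partition_onD3[OF CD_partition[OF assms(1,2)]] assms(3) by (metis ex_in_conv)

lemma CD_block_unique:
  assumes "\<E> \<in> CD \<Omega> G" "\<Gamma> \<in> \<E>" "\<gamma> \<in> \<Gamma>" "\<delta> \<in> \<Gamma>" "\<alpha> \<in> \<gamma>" "\<alpha> \<in> \<delta>"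
  shows "\<gamma> = \<delta>"
proof -
  have "\<alpha> \<in> \<Omega>" using CD_block_subset[OF assms(1-3)] assms(5) by blast
  then show ?thesis
    using cartesian_decomposition_block[OF CD_cartesian[OF assms(1)] assms(2)] assms(3-6) by blast
qed

lemma CD_two_blocks:
  assumes "\<E> \<in> CD \<Omega> G" "\<Gamma> \<in> \<E>"
  obtains \<gamma> \<delta> where "\<gamma> \<in> \<Gamma>" "\<delta> \<in> \<Gamma>" "\<gamma> \<noteq> \<delta>"
proof -
  have "\<exists>\<gamma>\<in>\<Gamma>. \<exists>\<delta>\<in>\<Gamma>. \<gamma> \<noteq> \<delta>" using assms by (simp add: CD_def cartesian_decomposition_def)
  then show ?thesis using that by blast
qed

lemma CD_finite: "\<E> \<in> CD \<Omega> G \<Longrightarrow> finite \<E>"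
  by (simp add: CD_def cartesian_decomposition_def)

text \<open>Let \<open>X\<close> be the \<open>G\<close>-orbit of a partition that \<open>M\<close> moves. The kernel \<open>L\<close> of the action of \<open>M\<close> on \<open>X\<close> is normal in
\<open>G\<close> and proper in \<open>M\<close>, so it is trivial and \<open>card M\<close> divides the factorial of \<open>card X\<close>. On the other hand,
the partitions in \<open>X\<close> have the same number of blocks, and the product of these numbers divides
\<open>card \<Omega>\<close>, which divides \<open>card M\<close>. A prime divisor of the number of blocks gives a contradiction.\<close>

lemma M_fixes_partition:
  assumes E: "\<E> \<in> CD \<Omega> G" and \<Gamma>: "\<Gamma> \<in> \<E>" and x: "x \<in> M"
  shows "image (image x) \<Gamma> = \<Gamma>"
proof (rule ccontr)
  assume moved: "\<not> ?thesis"
  define X where "X = (\<lambda>g. image (image g) \<Gamma>) ` G"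
  have XE: "X \<subseteq> \<E>" using CD_act[OF E _ \<Gamma>] by (auto simp: X_def)
  have finX: "finite X" using XE CD_finite[OF E] by (rule finite_subset)
  have sub: "\<Delta> \<subseteq> Pow \<Omega>" if "\<Delta> \<in> X" for \<Delta> using CD_partition_subset[OF E] that XE by blast
  have act_one: "image (image \<one>\<^bsub>BijGroup \<Omega>\<^esub>) \<Delta> = \<Delta>" if "\<Delta> \<subseteq> Pow \<Omega>" for \<Delta>
  proof -
    have "image (image \<one>\<^bsub>BijGroup \<Omega>\<^esub>) \<Delta> = (\<lambda>\<gamma>. \<gamma>) ` \<Delta>"
      by (rule image_cong[OF refl]) (use BijGroup_one_image that in auto)
    then show ?thesis by simp
  qed
  have \<Gamma>X: "\<Gamma> \<in> X"
  proof -
    have "\<Gamma> = image (image \<one>\<^bsub>BijGroup \<Omega>\<^esub>) \<Gamma>" by (rule act_one[symmetric, OF CD_partition_subset[OF E \<Gamma>]])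
    then show ?thesis unfolding X_def using subgroup.one_closed[OF G_subgroup] by (rule image_eqI)
  qed
  have actX: "image (image g) \<Delta> \<in> X" if g: "g \<in> G" and \<Delta>: "\<Delta> \<in> X" for g \<Delta>
  proof -
    obtain h where h: "h \<in> G" "\<Delta> = image (image h) \<Gamma>" using \<Delta> by (auto simp: X_def)
    have "image (image g) \<Delta> = image (image (g \<otimes>\<^bsub>BijGroup \<Omega>\<^esub> h)) \<Gamma>"
      using BijGroup_act_mult[OF G_Bij[OF g] G_Bij[OF h(1)] CD_partition_subset[OF E \<Gamma>]] h(2) by simp
    then show ?thesis using subgroup.m_closed[OF G_subgroup g h(1)] by (auto simp: X_def)
  qed
  define L where "L = {y \<in> M. \<forall>\<Delta>\<in>X. image (image y) \<Delta> = \<Delta>}"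
  have "subgroup L (BijGroup \<Omega>)"
  proof (rule B.subgroupI)
    show "L \<subseteq> carrier (BijGroup \<Omega>)" using M_Bij by (auto simp: L_def)
    have "\<one>\<^bsub>BijGroup \<Omega>\<^esub> \<in> L"
      using subgroup.one_closed[OF M_subgroup] act_one[OF sub] by (simp add: L_def)
    then show "L \<noteq> {}" by blast
    fix a assume a: "a \<in> L"
    have aM: "a \<in> M" using a by (simp add: L_def)
    have "image (image (inv\<^bsub>BijGroup \<Omega>\<^esub> a)) \<Delta> = \<Delta>" if \<Delta>: "\<Delta> \<in> X" for \<Delta>
      using BijGroup_act_inv(1)[OF M_Bij[OF aM] sub[OF \<Delta>]] a \<Delta> by (simp add: L_def)
    then show "inv\<^bsub>BijGroup \<Omega>\<^esub> a \<in> L" using subgroup.m_inv_closed[OF M_subgroup aM] by (simp add: L_def)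
    fix b assume b: "b \<in> L"
    have bM: "b \<in> M" using b by (simp add: L_def)
    have "image (image (a \<otimes>\<^bsub>BijGroup \<Omega>\<^esub> b)) \<Delta> = \<Delta>" if \<Delta>: "\<Delta> \<in> X" for \<Delta>
      using BijGroup_act_mult[OF M_Bij[OF aM] M_Bij[OF bM] sub[OF \<Delta>]] a b \<Delta> by (simp add: L_def)
    then show "a \<otimes>\<^bsub>BijGroup \<Omega>\<^esub> b \<in> L" using subgroup.m_closed[OF M_subgroup aM bM] by (simp add: L_def)
  qed
  moreover have "B.conj_by g y \<in> L" if g: "g \<in> G" and y: "y \<in> L" for g y
  proof -
    have yM: "y \<in> M" using y by (simp add: L_def)
    have gi: "inv\<^bsub>BijGroup \<Omega>\<^esub> g \<in> G" using g by (rule subgroup.m_inv_closed[OF G_subgroup])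
    have "image (image (B.conj_by g y)) \<Delta> = \<Delta>" if \<Delta>: "\<Delta> \<in> X" for \<Delta>
    proof -
      let ?\<Delta> = "image (image (inv\<^bsub>BijGroup \<Omega>\<^esub> g)) \<Delta>"
      have \<Delta>': "?\<Delta> \<in> X" using actX[OF gi \<Delta>] .
      have "image (image (B.conj_by g y)) \<Delta> = image (image (g \<otimes>\<^bsub>BijGroup \<Omega>\<^esub> y)) ?\<Delta>"
        unfolding B.conj_by_def
        using B.m_closed[of g y] G_Bij[OF g] M_Bij[OF yM]
        by (intro BijGroup_act_mult[OF _ G_Bij[OF gi] sub[OF \<Delta>]]) simp
      also have "\<dots> = image (image g) (image (image y) ?\<Delta>)"
        by (rule BijGroup_act_mult[OF G_Bij[OF g] M_Bij[OF yM] sub[OF \<Delta>']])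
      also have "image (image y) ?\<Delta> = ?\<Delta>" using y \<Delta>' by (simp add: L_def)
      also have "image (image g) ?\<Delta> = \<Delta>" by (rule BijGroup_act_inv(2)[OF G_Bij[OF g] sub[OF \<Delta>]])
      finally show ?thesis .
    qed
    then show ?thesis using M_conj[OF g yM] by (simp add: L_def)
  qed
  ultimately have "L = {\<one>\<^bsub>BijGroup \<Omega>\<^esub>} \<or> L = M" by (intro normal_in_G_cases) (auto simp: L_def)
  moreover have "x \<notin> L" using moved \<Gamma>X unfolding L_def by blast
  ultimately have L1: "L = {\<one>\<^bsub>BijGroup \<Omega>\<^esub>}" using x by blast
  have "card (carrier (perm_grp \<Omega> M)) dvd fact (card X)"
  proof (rule P.card_dvd_fact_if_faithful[OF finX, of "\<lambda>y. image (image y)"])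
    fix y assume "y \<in> carrier (perm_grp \<Omega> M)"
    then have y: "y \<in> M" "y \<in> G" using M_sub_G by auto
    have yi: "inv\<^bsub>BijGroup \<Omega>\<^esub> y \<in> G" using y(2) by (rule subgroup.m_inv_closed[OF G_subgroup])
    show "bij_betw (image (image y)) X X"
      by (rule bij_betw_byWitness[where f' = "image (image (inv\<^bsub>BijGroup \<Omega>\<^esub> y))"])
        (use BijGroup_act_inv[OF M_Bij[OF y(1)] sub] actX[OF y(2)] actX[OF yi] in auto)
    show "y = \<one>\<^bsub>perm_grp \<Omega> M\<^esub>" if "\<And>\<Delta>. \<Delta> \<in> X \<Longrightarrow> image (image y) \<Delta> = \<Delta>"
    proof -
      have "y \<in> L" using that y(1) by (simp add: L_def)
      then show ?thesis using L1 by simp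
    qed
    fix z \<Delta> assume "z \<in> carrier (perm_grp \<Omega> M)" and \<Delta>: "\<Delta> \<in> X"
    then show "image (image (y \<otimes>\<^bsub>perm_grp \<Omega> M\<^esub> z)) \<Delta> = image (image y) (image (image z) \<Delta>)"
      using BijGroup_act_mult[OF M_Bij[OF y(1)] M_Bij sub[OF \<Delta>]] by simp
  qed
  then have dvd: "card M dvd fact (card X)" by simp
  have card_X: "card \<Delta> = card \<Gamma>" if "\<Delta> \<in> X" for \<Delta>
  proof -
    obtain g where g: "g \<in> G" "\<Delta> = image (image g) \<Gamma>" using \<open>\<Delta> \<in> X\<close> by (auto simp: X_def)
    have "inj_on (image g) \<Gamma>"
      by (rule inj_on_inverseI[where g = "image (inv\<^bsub>BijGroup \<Omega>\<^esub> g)"])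
        (use BijGroup_inv_image(1)[OF G_Bij[OF g(1)] CD_block_subset[OF E \<Gamma>]] in simp)
    then show ?thesis using g(2) by (simp add: card_image)
  qed
  obtain \<gamma> \<delta> where "\<gamma> \<in> \<Gamma>" "\<delta> \<in> \<Gamma>" "\<gamma> \<noteq> \<delta>" using CD_two_blocks[OF E \<Gamma>] .
  then have "card \<Gamma> \<noteq> 1" using card_1_singletonE by force
  then obtain q where q: "prime q" "q dvd card \<Gamma>" using prime_factor_nat by blast
  have "q ^ card X dvd card \<Gamma> ^ card X" using q(2) by (rule dvd_power_same)
  also have "card \<Gamma> ^ card X = (\<Prod>\<Delta>\<in>X. card \<Delta>)" using card_X by simp
  also have "\<dots> dvd (\<Prod>\<Delta>\<in>\<E>. card \<Delta>)" by (rule prod_dvd_prod_subset[OF CD_finite[OF E] XE])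
  also have "\<dots> = card \<Omega>" using card_cartesian_decomposition[OF CD_cartesian[OF E]] by simp
  also have "card \<Omega> dvd card M" using card_M_eq \<Omega>_nonempty by (metis dvd_triv_left ex_in_conv)
  also note dvd
  finally have "q ^ card X dvd fact (card X)" .
  moreover have "0 < card X" using \<Gamma>X finX by (auto simp: card_gt_0_iff)
  ultimately show False using prime_power_not_dvd_fact[OF q(1)] by blast
qed

section \<open>Stabilisers of blocks\<close>

definition block_stab :: "'a set \<Rightarrow> ('a \<Rightarrow> 'a) set" where
  "block_stab \<gamma> = {x \<in> M. x ` \<gamma> = \<gamma>}"

lemma block_stab_eq: "block_stab \<gamma> = stabilizer (perm_grp \<Omega> M) image \<gamma>"
  by (simp add: block_stab_def stabilizer_def)

lemma inv_mult_image_iff: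
  assumes "x \<in> M" "y \<in> M" "\<gamma> \<subseteq> \<Omega>"
  shows "(inv\<^bsub>BijGroup \<Omega>\<^esub> x \<otimes>\<^bsub>BijGroup \<Omega>\<^esub> y) ` \<gamma> = \<gamma> \<longleftrightarrow> x ` \<gamma> = y ` \<gamma>"
proof -
  have x: "x \<in> Bij \<Omega>" and y: "y \<in> Bij \<Omega>" using assms M_Bij by auto
  have xi: "inv\<^bsub>BijGroup \<Omega>\<^esub> x \<in> Bij \<Omega>" using B.inv_closed[of x] x by simp
  have "(inv\<^bsub>BijGroup \<Omega>\<^esub> x \<otimes>\<^bsub>BijGroup \<Omega>\<^esub> y) ` \<gamma> = (inv\<^bsub>BijGroup \<Omega>\<^esub> x) ` (y ` \<gamma>)"
    using BijGroup_mult_image[OF xi y assms(3)] .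
  then show ?thesis
    using BijGroup_inv_image[OF x assms(3)] BijGroup_inv_image[OF x Bij_image_subset[OF y assms(3)]] by metis
qed

lemma block_stab_subgroup:
  assumes \<gamma>: "\<gamma> \<subseteq> \<Omega>"
  shows "subgroup (block_stab \<gamma>) (perm_grp \<Omega> M)"
proof (rule B.subgroup_incl[OF _ M_subgroup])
  show "block_stab \<gamma> \<subseteq> M" by (auto simp: block_stab_def)
  show "subgroup (block_stab \<gamma>) (BijGroup \<Omega>)"
  proof (rule B.subgroupI)
    show "block_stab \<gamma> \<subseteq> carrier (BijGroup \<Omega>)" using M_Bij by (auto simp: block_stab_def)
    show "block_stab \<gamma> \<noteq> {}"
      using subgroup.one_closed[OF M_subgroup] BijGroup_one_image[OF \<gamma>] by (auto simp: block_stab_def)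
    fix a assume a: "a \<in> block_stab \<gamma>"
    then show "inv\<^bsub>BijGroup \<Omega>\<^esub> a \<in> block_stab \<gamma>"
      using BijGroup_inv_image(1)[OF M_Bij \<gamma>, of a] subgroup.m_inv_closed[OF M_subgroup, of a]
      by (simp add: block_stab_def)
    fix b assume b: "b \<in> block_stab \<gamma>"
    show "a \<otimes>\<^bsub>BijGroup \<Omega>\<^esub> b \<in> block_stab \<gamma>"
      using a b BijGroup_mult_image[OF M_Bij M_Bij \<gamma>, of a b] subgroup.m_closed[OF M_subgroup, of a b]
      by (simp add: block_stab_def)
  qed
qed

lemma conj_block_stab:
  assumes g: "g \<in> G" and \<gamma>: "\<gamma> \<subseteq> \<Omega>"
  shows "B.conj_by g ` block_stab \<gamma> = block_stab (g ` \<gamma>)"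
proof -
  have *: "B.conj_by h x \<in> block_stab (h ` \<gamma>)" if h: "h \<in> G" and x: "x \<in> block_stab \<gamma>" and \<gamma>: "\<gamma> \<subseteq> \<Omega>" for h x \<gamma>
  proof -
    have xM: "x \<in> M" "x ` \<gamma> = \<gamma>" using x by (auto simp: block_stab_def)
    have hB: "h \<in> Bij \<Omega>" and xB: "x \<in> Bij \<Omega>" using h xM G_Bij M_Bij by auto
    have hi: "inv\<^bsub>BijGroup \<Omega>\<^esub> h \<in> Bij \<Omega>" using B.inv_closed[of h] hB by simp
    have hx: "h \<otimes>\<^bsub>BijGroup \<Omega>\<^esub> x \<in> Bij \<Omega>" using B.m_closed[of h x] hB xB by simp
    have "B.conj_by h x ` (h ` \<gamma>) = h ` \<gamma>"
      unfolding B.conj_by_def BijGroup_mult_image[OF hx hi Bij_image_subset[OF hB \<gamma>]]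
        BijGroup_inv_image(1)[OF hB \<gamma>] BijGroup_mult_image[OF hB xB \<gamma>] xM(2) ..
    then show ?thesis using M_conj[OF h xM(1)] by (simp add: block_stab_def)
  qed
  show ?thesis
  proof
    show "B.conj_by g ` block_stab \<gamma> \<subseteq> block_stab (g ` \<gamma>)" using * g \<gamma> by blast
    show "block_stab (g ` \<gamma>) \<subseteq> B.conj_by g ` block_stab \<gamma>"
    proof
      fix x assume x: "x \<in> block_stab (g ` \<gamma>)"
      have gi: "inv\<^bsub>BijGroup \<Omega>\<^esub> g \<in> G" using g by (rule subgroup.m_inv_closed[OF G_subgroup])
      have "B.conj_by (inv\<^bsub>BijGroup \<Omega>\<^esub> g) x \<in> block_stab \<gamma>"
        using *[OF gi x Bij_image_subset[OF G_Bij[OF g] \<gamma>]] BijGroup_inv_image(1)[OF G_Bij[OF g] \<gamma>] by simp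
      moreover have "x = B.conj_by g (B.conj_by (inv\<^bsub>BijGroup \<Omega>\<^esub> g) x)"
        using x g G_Bij M_Bij by (simp add: block_stab_def)
      ultimately show "x \<in> B.conj_by g ` block_stab \<gamma>" by blast
    qed
  qed
qed

lemma M_act_block:
  assumes "\<E> \<in> CD \<Omega> G" "\<Gamma> \<in> \<E>" "\<gamma> \<in> \<Gamma>" "x \<in> M"
  shows "x ` \<gamma> \<in> \<Gamma>"
  using M_fixes_partition[OF assms(1,2,4)] assms(3) by blast

text \<open>As \<open>M\<close> fixes the partition, the stabiliser in \<open>M\<close> of a point fixes the block around this point.
So the stabiliser of the block contains a subdirect subgroup.\<close>

lemma full_block_stab:
  assumes E: "\<E> \<in> CD \<Omega> G" and \<Gamma>: "\<Gamma> \<in> \<E>" and \<gamma>: "\<gamma> \<in> \<Gamma>"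
  shows "P.full (block_stab \<gamma>)"
proof -
  obtain \<omega> where \<omega>: "\<omega> \<in> \<gamma>" using CD_block_nonempty[OF assms] by blast
  have \<omega>\<Omega>: "\<omega> \<in> \<Omega>" using CD_block_subset[OF assms] \<omega> by blast
  have "stab \<omega> \<subseteq> block_stab \<gamma>"
  proof
    fix x assume x: "x \<in> stab \<omega>"
    then have "x ` \<gamma> \<in> \<Gamma>" "\<omega> \<in> x ` \<gamma>"
      using M_act_block[OF assms] \<omega> by (simp_all add: stab_def image_iff) metis
    then have "x ` \<gamma> = \<gamma>" using CD_block_unique[OF E \<Gamma> _ \<gamma> _ \<omega>] by blast
    with x show "x \<in> block_stab \<gamma>" by (simp add: stab_def block_stab_def)
  qed
  then show ?thesis
    using P.full_mono[OF full_stab[OF \<omega>\<Omega>] block_stab_subgroup] CD_block_subset[OF assms] by blast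
qed

lemma M_transitive_blocks:
  assumes E: "\<E> \<in> CD \<Omega> G" and \<Gamma>: "\<Gamma> \<in> \<E>" and \<gamma>: "\<gamma> \<in> \<Gamma>" and \<delta>: "\<delta> \<in> \<Gamma>"
  shows "\<exists>x\<in>M. x ` \<gamma> = \<delta>"
proof -
  obtain \<alpha> \<beta> where \<alpha>: "\<alpha> \<in> \<gamma>" and \<beta>: "\<beta> \<in> \<delta>"
    using CD_block_nonempty[OF E \<Gamma>] \<gamma> \<delta> by metis
  then have "\<alpha> \<in> \<Omega>" "\<beta> \<in> \<Omega>" using CD_block_subset[OF E \<Gamma>] \<gamma> \<delta> by blast+
  then obtain x where x: "x \<in> M" "x \<alpha> = \<beta>" using M_transitive by blast
  then have "x ` \<gamma> = \<delta>"
    using CD_block_unique[OF E \<Gamma> M_act_block[OF E \<Gamma> \<gamma> x(1)] \<delta> _ \<beta>] \<alpha> by blast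
  with x show ?thesis by blast
qed

lemma card_M_eq_blocks:
  assumes E: "\<E> \<in> CD \<Omega> G" and \<Gamma>: "\<Gamma> \<in> \<E>" and \<gamma>: "\<gamma> \<in> \<Gamma>"
  shows "card M = card \<Gamma> * card (block_stab \<gamma>)"
proof -
  have \<gamma>\<Omega>: "\<gamma> \<subseteq> \<Omega>" using CD_block_subset[OF assms] .
  have "card (carrier (perm_grp \<Omega> M)) = card ((\<lambda>x. x ` \<gamma>) ` carrier (perm_grp \<Omega> M)) * card (block_stab \<gamma>)"
  proof (rule P.card_eq_card_image_times_fibre)
    show "finite (carrier (perm_grp \<Omega> M))" using finite_M by simp
    show "subgroup (block_stab \<gamma>) (perm_grp \<Omega> M)" using block_stab_subgroup[OF \<gamma>\<Omega>] .
    fix x y assume x: "x \<in> carrier (perm_grp \<Omega> M)" and y: "y \<in> carrier (perm_grp \<Omega> M)"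
    have "inv\<^bsub>BijGroup \<Omega>\<^esub> x \<otimes>\<^bsub>BijGroup \<Omega>\<^esub> y \<in> M"
      using x y by (simp add: subgroup.m_closed[OF M_subgroup] subgroup.m_inv_closed[OF M_subgroup])
    then show "x ` \<gamma> = y ` \<gamma> \<longleftrightarrow> inv\<^bsub>perm_grp \<Omega> M\<^esub> x \<otimes>\<^bsub>perm_grp \<Omega> M\<^esub> y \<in> block_stab \<gamma>"
      using x y M_subgroup inv_mult_image_iff[OF _ _ \<gamma>\<Omega>] by (simp add: block_stab_def)
  qed
  moreover have "(\<lambda>x. x ` \<gamma>) ` M = \<Gamma>"
    using M_transitive_blocks[OF assms] M_act_block[OF assms] by blast
  ultimately show ?thesis by simp
qed

lemma block_stab_proper:
  assumes E: "\<E> \<in> CD \<Omega> G" and \<Gamma>: "\<Gamma> \<in> \<E>" and \<gamma>: "\<gamma> \<in> \<Gamma>"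
  shows "block_stab \<gamma> \<noteq> M"
proof
  assume e: "block_stab \<gamma> = M"
  have "\<delta> = \<gamma>" if \<delta>: "\<delta> \<in> \<Gamma>" for \<delta>
    using M_transitive_blocks[OF assms \<delta>] e by (auto simp: block_stab_def)
  then show False using CD_two_blocks[OF E \<Gamma>] by metis
qed

lemma card_S: "i < k \<Longrightarrow> card (S i) = card (carrier T)"
  using diagonal iso_same_card[of "perm_grp \<Omega> (S i)" T] by (simp add: diagonal_type_def)

lemma card_T: "1 < card (carrier T)"
  using diagonal simple_group.order_gt_one[of T]
  by (simp add: diagonal_type_def nonabelian_simple_group_def order_def)

section \<open>Tied coordinates of an invariant decomposition\<close>

definition block :: "'a \<Rightarrow> 'a set set \<Rightarrow> 'a set" where
  "block \<omega> \<Gamma> = (THE \<gamma>. \<gamma> \<in> \<Gamma> \<and> \<omega> \<in> \<gamma>)"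

abbreviation tied_at :: "'a \<Rightarrow> 'a set set \<Rightarrow> nat set" where
  "tied_at \<omega> \<Gamma> \<equiv> P.tied (block_stab (block \<omega> \<Gamma>))"

context
  fixes \<E> :: "'a set set set" and \<omega> :: 'a
  assumes E: "\<E> \<in> CD \<Omega> G" and \<omega>: "\<omega> \<in> \<Omega>"
begin

lemma block_mem:
  assumes "\<Gamma> \<in> \<E>"
  shows "block \<omega> \<Gamma> \<in> \<Gamma>" "\<omega> \<in> block \<omega> \<Gamma>" "block \<omega> \<Gamma> \<subseteq> \<Omega>"
proof -
  have "block \<omega> \<Gamma> \<in> \<Gamma> \<and> \<omega> \<in> block \<omega> \<Gamma>"
    unfolding block_def by (rule theI') (rule cartesian_decomposition_block[OF CD_cartesian[OF E] assms \<omega>])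
  then show "block \<omega> \<Gamma> \<in> \<Gamma>" "\<omega> \<in> block \<omega> \<Gamma>" by auto
  then show "block \<omega> \<Gamma> \<subseteq> \<Omega>" using CD_block_subset[OF E assms] by blast
qed

lemma block_eqI: "\<lbrakk>\<Gamma> \<in> \<E>; \<gamma> \<in> \<Gamma>; \<omega> \<in> \<gamma>\<rbrakk> \<Longrightarrow> block \<omega> \<Gamma> = \<gamma>"
  using CD_block_unique[OF E] block_mem by metis

lemma tied_at_sub: "tied_at \<omega> \<Gamma> \<subseteq> {..<k}"
  by (auto simp: P.tied_def)

lemma tied_at_move:
  assumes h: "h \<in> G" "h \<omega> = \<omega>" and \<Gamma>: "\<Gamma> \<in> \<E>" and i: "i \<in> tied_at \<omega> \<Gamma>" and j: "j < k"
    and ij: "B.conj_by h ` P.factor_ker i = P.factor_ker j"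
  shows "j \<in> tied_at \<omega> (image (image h) \<Gamma>)"
proof -
  have "block \<omega> (image (image h) \<Gamma>) = h ` block \<omega> \<Gamma>"
  proof (rule block_eqI)
    show "image (image h) \<Gamma> \<in> \<E>" using CD_act[OF E h(1) \<Gamma>] .
    show "h ` block \<omega> \<Gamma> \<in> image (image h) \<Gamma>" using block_mem(1)[OF \<Gamma>] by blast
    show "\<omega> \<in> h ` block \<omega> \<Gamma>" using block_mem(2)[OF \<Gamma>] h(2) by (metis imageI)
  qed
  moreover have "j \<in> P.tied (B.conj_by h ` block_stab (block \<omega> \<Gamma>))"
    by (rule P.iso_tied[OF conj_iso[OF h(1)] _ i _ ij]) (use j in \<open>auto simp: block_stab_def\<close>)
  ultimately show ?thesis using conj_block_stab[OF h(1) block_mem(3)[OF \<Gamma>]] by simp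
qed

text \<open>An element of \<open>G\<close> that fixes \<open>\<omega>\<close> and takes the kernel \<open>i\<close> to the kernel \<open>j\<close> maps the partitions for which
\<open>i\<close> is tied to those for which \<open>j\<close> is tied. By symmetry the two numbers are equal.\<close>

lemma card_tied_at_le:
  assumes i: "i < k" and j: "j < k"
  shows "card {\<Gamma> \<in> \<E>. i \<in> tied_at \<omega> \<Gamma>} \<le> card {\<Gamma> \<in> \<E>. j \<in> tied_at \<omega> \<Gamma>}"
proof -
  obtain h where h: "h \<in> G" "h \<omega> = \<omega>" "B.conj_by h ` P.factor_ker i = P.factor_ker j"
    using stab_transitive_factor_kers[OF \<omega> i j] by blast
  have "inj_on (image (image h)) {\<Gamma> \<in> \<E>. i \<in> tied_at \<omega> \<Gamma>}"
    by (rule inj_on_inverseI[where g = "image (image (inv\<^bsub>BijGroup \<Omega>\<^esub> h))"])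
      (use BijGroup_act_inv(1)[OF G_Bij[OF h(1)]] CD_partition_subset[OF E] in simp)
  moreover have "image (image h) ` {\<Gamma> \<in> \<E>. i \<in> tied_at \<omega> \<Gamma>} \<subseteq> {\<Gamma> \<in> \<E>. j \<in> tied_at \<omega> \<Gamma>}"
    using CD_act[OF E h(1)] tied_at_move[OF h(1,2) _ _ j h(3)] by auto
  moreover have "finite {\<Gamma> \<in> \<E>. j \<in> tied_at \<omega> \<Gamma>}" using CD_finite[OF E] by simp
  ultimately show ?thesis by (rule card_inj_on_le)
qed

text \<open>With \<open>K\<close> the stabiliser of the block of \<open>\<Gamma>\<close> at \<open>\<omega>\<close>, the bound on \<open>card K\<close> gives
\<open>t ^ card (tied_at \<omega> \<Gamma>) \<le> card \<Gamma> ^ 2\<close>. The product over all \<open>\<Gamma>\<close> of the right-hand sides is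
\<open>card \<Omega> ^ 2\<close>. This is less than \<open>t ^ (2 * k)\<close>, as \<open>M\<close> is not regular on \<open>\<Omega>\<close>.\<close>

lemma sum_card_tied_at_less: "(\<Sum>\<Gamma>\<in>\<E>. card (tied_at \<omega> \<Gamma>)) < 2 * k"
proof -
  define t where "t = card (carrier T)"
  have t: "1 < t" using card_T by (simp add: t_def)
  have cS: "card (carrier (perm_grp \<Omega> (S i))) = t" if "i \<in> {..<k}" for i
    using that card_S by (simp add: t_def)
  have cM: "card M = t ^ k" using P.card_carrier[of t] cS by simp
  have tied_le: "t ^ card (tied_at \<omega> \<Gamma>) \<le> card \<Gamma> ^ 2" if \<Gamma>: "\<Gamma> \<in> \<E>" for \<Gamma>
  proof -
    let ?K = "block_stab (block \<omega> \<Gamma>)"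
    have sK: "subgroup ?K (perm_grp \<Omega> M)" using block_stab_subgroup[OF block_mem(3)[OF \<Gamma>]] .
    have cK: "card M = card \<Gamma> * card ?K" using card_M_eq_blocks[OF E \<Gamma> block_mem(1)[OF \<Gamma>]] .
    then have pos: "0 < card ?K ^ 2" using cM t by (cases "card ?K = 0") auto
    have "card ?K ^ 2 * t ^ card (tied_at \<omega> \<Gamma>) \<le> t ^ (2 * card {..<k})"
      using P.card_subgroup_tied_le[OF sK, of t] cS t by simp
    also have "\<dots> = card M ^ 2" by (simp add: cM power_mult[symmetric] mult.commute)
    also have "\<dots> = card ?K ^ 2 * card \<Gamma> ^ 2" by (simp add: cK power_mult_distrib)
    finally show ?thesis using pos by simp
  qed
  \<comment> \<open>The stabiliser of \<open>\<omega>\<close> is nontrivial, as it projects onto \<open>S 0\<close>.\<close>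
  have "card \<Omega> < card M"
  proof -
    obtain s where s: "s \<in> S 0" "s \<noteq> \<one>\<^bsub>BijGroup \<Omega>\<^esub>" using P.T_nontrivial[of 0] k_pos by auto
    obtain x where x: "x \<in> stab \<omega>" "factor_proj (perm_grp \<Omega> M) k S 0 x = s"
      using P.full_ex[OF full_stab[OF \<omega>], of 0 s] s k_pos by auto
    have "x \<noteq> \<one>\<^bsub>BijGroup \<Omega>\<^esub>" using x(2) s(2) P.p_one[of 0] k_pos by auto
    moreover have "\<one>\<^bsub>BijGroup \<Omega>\<^esub> \<in> stab \<omega>" using subgroup.one_closed[OF subgroup_stab[OF \<omega>]] .
    moreover have "finite (stab \<omega>)" using finite_M by (rule finite_subset[rotated]) (auto simp: stab_def)
    ultimately have "2 \<le> card (stab \<omega>)"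
      using x(1) card_mono[of "stab \<omega>" "{\<one>\<^bsub>BijGroup \<Omega>\<^esub>, x}"] by auto
    moreover have "0 < card \<Omega>" using finite_\<Omega> \<Omega>_nonempty by (simp add: card_gt_0_iff)
    ultimately show ?thesis unfolding card_M_eq[OF \<omega>] by simp
  qed
  have "t ^ (\<Sum>\<Gamma>\<in>\<E>. card (tied_at \<omega> \<Gamma>)) = (\<Prod>\<Gamma>\<in>\<E>. t ^ card (tied_at \<omega> \<Gamma>))"
    by (rule power_sum)
  also have "\<dots> \<le> (\<Prod>\<Gamma>\<in>\<E>. card \<Gamma> ^ 2)" using tied_le by (intro prod_mono) auto
  also have "\<dots> = card \<Omega> ^ 2"
    using card_cartesian_decomposition[OF CD_cartesian[OF E]] by (simp add: prod_power_distrib)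
  also have "\<dots> < card M ^ 2" using \<open>card \<Omega> < card M\<close> by (intro power_strict_mono) auto
  also have "\<dots> = t ^ (2 * k)" by (simp add: cM power_mult[symmetric] mult.commute)
  finally show ?thesis using t by simp
qed

text \<open>Each coordinate is tied for the same number \<open>d\<close> of partitions, so the sum in
\<open>sum_card_tied_at_less\<close> is \<open>d * k\<close>, which forces \<open>d \<le> 1\<close>.\<close>

lemma tied_at_disjoint:
  assumes i: "i < k" and "\<Gamma> \<in> \<E>" "i \<in> tied_at \<omega> \<Gamma>" "\<Delta> \<in> \<E>" "i \<in> tied_at \<omega> \<Delta>"
  shows "\<Gamma> = \<Delta>"
proof -
  define d where "d = card {\<Gamma> \<in> \<E>. i \<in> tied_at \<omega> \<Gamma>}"
  have d: "card {\<Gamma> \<in> \<E>. j \<in> tied_at \<omega> \<Gamma>} = d" if "j < k" for j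
    unfolding d_def using card_tied_at_le[OF i that] card_tied_at_le[OF that i] by simp
  have "d * k = (\<Sum>\<Gamma>\<in>\<E>. card {j \<in> {..<k}. j \<in> tied_at \<omega> \<Gamma>})"
    using sum_multicount[OF CD_finite[OF E], of "{..<k}" "\<lambda>\<Gamma> j. j \<in> tied_at \<omega> \<Gamma>" d] d by simp
  also have "\<dots> = (\<Sum>\<Gamma>\<in>\<E>. card (tied_at \<omega> \<Gamma>))"
  proof (rule sum.cong[OF refl])
    fix \<Gamma>
    have "{j \<in> {..<k}. j \<in> tied_at \<omega> \<Gamma>} = tied_at \<omega> \<Gamma>" using tied_at_sub[of \<Gamma>] by blast
    then show "card {j \<in> {..<k}. j \<in> tied_at \<omega> \<Gamma>} = card (tied_at \<omega> \<Gamma>)" by simp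
  qed
  also have "\<dots> < 2 * k" by (rule sum_card_tied_at_less)
  finally have "d \<le> 1" by simp
  moreover have "finite {\<Gamma> \<in> \<E>. i \<in> tied_at \<omega> \<Gamma>}" using CD_finite[OF E] by simp
  ultimately show ?thesis using assms(2-5) unfolding d_def by (auto simp: card_le_Suc0_iff_eq)
qed

lemma tied_at_nonempty:
  assumes \<Gamma>: "\<Gamma> \<in> \<E>"
  shows "\<exists>i<k. i \<in> tied_at \<omega> \<Gamma>"
proof -
  have "tied_at \<omega> \<Gamma> \<noteq> {}"
    using P.tied_nonempty[OF full_block_stab[OF E \<Gamma> block_mem(1)[OF \<Gamma>]]]
      block_stab_proper[OF E \<Gamma> block_mem(1)[OF \<Gamma>]] by simp
  then show ?thesis using tied_at_sub[of \<Gamma>] by blast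
qed

text \<open>A partition is determined by any one of its tied coordinates.\<close>

lemma G_transitive_partitions:
  assumes \<Gamma>: "\<Gamma> \<in> \<E>" and \<Delta>: "\<Delta> \<in> \<E>"
  shows "\<exists>g\<in>G. image (image g) \<Gamma> = \<Delta>"
proof -
  obtain i j where i: "i < k" "i \<in> tied_at \<omega> \<Gamma>" and j: "j < k" "j \<in> tied_at \<omega> \<Delta>"
    using tied_at_nonempty[OF \<Gamma>] tied_at_nonempty[OF \<Delta>] by blast
  obtain h where h: "h \<in> G" "h \<omega> = \<omega>" "B.conj_by h ` P.factor_ker i = P.factor_ker j"
    using stab_transitive_factor_kers[OF \<omega> i(1) j(1)] by blast
  have "image (image h) \<Gamma> = \<Delta>"
    using tied_at_disjoint[OF j(1) CD_act[OF E h(1) \<Gamma>] tied_at_move[OF h(1,2) \<Gamma> i(2) j(1) h(3)] \<Delta> j(2)] .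
  with h show ?thesis by blast
qed

lemma mem_stab_if_mem_block_stabs:
  assumes x: "x \<in> M" and mem: "\<And>\<Gamma>. \<Gamma> \<in> \<E> \<Longrightarrow> x \<in> block_stab (block \<omega> \<Gamma>)"
  shows "x \<in> stab \<omega>"
proof -
  obtain \<alpha> where \<alpha>: "(\<Inter>\<Gamma>\<in>\<E>. block \<omega> \<Gamma>) = {\<alpha>}"
    using cartesian_decomposition_meet[OF CD_cartesian[OF E], of "block \<omega>"] block_mem by blast
  have "x \<omega> \<in> block \<omega> \<Gamma>" if "\<Gamma> \<in> \<E>" for \<Gamma>
    using mem[OF that] block_mem(2)[OF that] unfolding block_stab_def by blast
  then have "x \<omega> \<in> (\<Inter>\<Gamma>\<in>\<E>. block \<omega> \<Gamma>)" by blast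
  moreover have "\<omega> \<in> (\<Inter>\<Gamma>\<in>\<E>. block \<omega> \<Gamma>)" using block_mem(2) by blast
  ultimately have "x \<omega> = \<omega>" unfolding \<alpha> by simp
  with x show ?thesis by (simp add: stab_def)
qed

lemma stab_sub_block_stab:
  assumes \<Gamma>: "\<Gamma> \<in> \<E>" and x: "x \<in> stab \<omega>"
  shows "x \<in> block_stab (block \<omega> \<Gamma>)"
proof -
  have xM: "x \<in> M" "x \<omega> = \<omega>" using x by (auto simp: stab_def)
  have "\<omega> \<in> x ` block \<omega> \<Gamma>" using block_mem(2)[OF \<Gamma>] xM(2) by (metis imageI)
  then have "block \<omega> \<Gamma> = x ` block \<omega> \<Gamma>"
    using block_eqI[OF \<Gamma> M_act_block[OF E \<Gamma> block_mem(1)[OF \<Gamma>] xM(1)]] by blast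
  then show ?thesis using xM(1) by (simp add: block_stab_def)
qed

text \<open>Take an element \<open>x\<close> of the stabiliser of \<open>\<omega>\<close> that is nontrivial at a tied coordinate of one partition \<open>\<Gamma>\<close>, and
make it trivial at all coordinates that are not tied for \<open>\<Gamma>\<close>. The result \<open>y\<close> still lies in each block
stabiliser: in that of \<open>\<Gamma>\<close> since it agrees with \<open>x\<close> at the tied coordinates, and in the others since
it agrees with the identity there. It is trivial at the tied coordinates of a second partition. But if
the stabiliser were isomorphic to \<open>T\<close>, all its projections would be injective, by counting.\<close>

lemma stab_not_iso_T: "\<not> perm_grp \<Omega> (stab \<omega>) \<cong> T"
proof
  assume iso: "perm_grp \<Omega> (stab \<omega>) \<cong> T"
  let ?p = "factor_proj (perm_grp \<Omega> M) k S"
  obtain \<Gamma> \<Delta> where \<Gamma>\<Delta>: "\<Gamma> \<in> \<E>" "\<Delta> \<in> \<E>" "\<Gamma> \<noteq> \<Delta>"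
  proof -
    have "2 \<le> card \<E>" using CD_cartesian[OF E] by (simp add: cartesian_decomposition_def)
    then have "\<not> card \<E> \<le> Suc 0" by simp
    then show ?thesis using that card_le_Suc0_iff_eq[OF CD_finite[OF E]] by blast
  qed
  obtain i j where i: "i < k" "i \<in> tied_at \<omega> \<Gamma>" and j: "j < k" "j \<in> tied_at \<omega> \<Delta>"
    using tied_at_nonempty[OF \<Gamma>\<Delta>(1)] tied_at_nonempty[OF \<Gamma>\<Delta>(2)] by blast
  have j\<Gamma>: "j \<notin> tied_at \<omega> \<Gamma>" using tied_at_disjoint[OF j(1) \<Gamma>\<Delta>(1) _ \<Gamma>\<Delta>(2) j(2)] \<Gamma>\<Delta>(3) by blast
  have full: "P.full (stab \<omega>)" using full_stab[OF \<omega>] .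
  obtain s where s: "s \<in> S i" "s \<noteq> \<one>\<^bsub>BijGroup \<Omega>\<^esub>" using P.T_nontrivial[of i] i(1) by auto
  obtain x where x: "x \<in> stab \<omega>" "?p i x = s" using P.full_ex[OF full, of i s] s i(1) by auto
  have xM: "x \<in> M" using x(1) by (simp add: stab_def)
  let ?t = "\<lambda>l. if l \<in> tied_at \<omega> \<Gamma> then ?p l x else \<one>\<^bsub>BijGroup \<Omega>\<^esub>"
  have "\<exists>y\<in>carrier (perm_grp \<Omega> M). \<forall>l\<in>{..<k}. ?p l y = ?t l"
  proof (rule P.coords_ex)
    show "?t l \<in> carrier (perm_grp \<Omega> (S l))" if "l \<in> {..<k}" for l
      using P.p_closed[of l x] P.T_one(1)[of l] that xM by simp
  qed
  then obtain y where y: "y \<in> M" "\<forall>l\<in>{..<k}. ?p l y = ?t l" by auto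
  have "y \<in> stab \<omega>"
  proof (rule mem_stab_if_mem_block_stabs[OF y(1)])
    fix \<Theta> assume \<Theta>: "\<Theta> \<in> \<E>"
    have fullK: "P.full (block_stab (block \<omega> \<Theta>))" using full_block_stab[OF E \<Theta> block_mem(1)[OF \<Theta>]] .
    show "y \<in> block_stab (block \<omega> \<Theta>)"
    proof (cases "\<Theta> = \<Gamma>")
      case True
      show ?thesis
        by (rule P.mem_if_agree_on_tied[OF fullK stab_sub_block_stab[OF \<Theta> x(1)]])
          (use True y tied_at_sub[of \<Gamma>] in auto)
    next
      case False
      have "\<one>\<^bsub>BijGroup \<Omega>\<^esub> \<in> block_stab (block \<omega> \<Theta>)"
        using stab_sub_block_stab[OF \<Theta>] subgroup.one_closed[OF subgroup_stab[OF \<omega>]] by blast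
      then show ?thesis
      proof (rule P.mem_if_agree_on_tied[OF fullK])
        show "y \<in> carrier (perm_grp \<Omega> M)" using y(1) by simp
        fix l assume l: "l \<in> tied_at \<omega> \<Theta>"
        then have lk: "l < k" using tied_at_sub[of \<Theta>] by blast
        have "l \<notin> tied_at \<omega> \<Gamma>" using tied_at_disjoint[OF lk \<Theta> l \<Gamma>\<Delta>(1)] False by blast
        then show "?p l y = ?p l \<one>\<^bsub>BijGroup \<Omega>\<^esub>" using y(2) lk P.p_one[of l] by simp
      qed
    qed
  qed
  moreover have "\<one>\<^bsub>BijGroup \<Omega>\<^esub> \<in> stab \<omega>" using subgroup.one_closed[OF subgroup_stab[OF \<omega>]] .
  moreover have "?p j y = ?p j \<one>\<^bsub>BijGroup \<Omega>\<^esub>" using y(2) j(1) j\<Gamma> P.p_one[of j] by simp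
  moreover have "inj_on (?p j) (stab \<omega>)"
  proof (rule eq_card_imp_inj_on)
    show "finite (stab \<omega>)" using finite_M by (rule finite_subset[rotated]) (auto simp: stab_def)
    have "?p j ` stab \<omega> = S j" using full j(1) by (simp add: P.full_def)
    then show "card (?p j ` stab \<omega>) = card (stab \<omega>)" using iso_same_card[OF iso] card_S[OF j(1)] by simp
  qed
  ultimately have "y = \<one>\<^bsub>BijGroup \<Omega>\<^esub>" by (auto dest: inj_onD)
  then have "?p i x = \<one>\<^bsub>BijGroup \<Omega>\<^esub>" using y(2) i P.p_one[of i] by simp
  with x s show False by simp
qed

end

lemma CD_subset_CD_S: "CD \<Omega> G \<subseteq> CD_S \<Omega> G M k S"
proof
  fix \<E> assume E: "\<E> \<in> CD \<Omega> G"
  obtain \<omega> where \<omega>: "\<omega> \<in> \<Omega>" using \<Omega>_nonempty by blast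
  have "subdirect (perm_grp \<Omega> M) k S K" if "K \<in> block_stabilizers \<Omega> M \<alpha> \<E>" for K \<alpha>
    using that full_block_stab[OF E]
    by (auto simp: block_stabilizers_def block_stab_eq[symmetric] full_iff_subdirect[symmetric])
  then show "\<E> \<in> CD_S \<Omega> G M k S"
    using E G_transitive_partitions[OF E \<omega>] by (simp add: CD_S_def)
qed

lemma compound_if_CD_nonempty:
  assumes "CD \<Omega> G \<noteq> {}"
  shows "compound_diagonal_type \<Omega> G M k S T"
proof -
  obtain \<E> where E: "\<E> \<in> CD \<Omega> G" using assms by blast
  obtain \<omega> where \<omega>: "\<omega> \<in> \<Omega>" using \<Omega>_nonempty by blast
  have "\<not> perm_grp \<Omega> (stabilizer (perm_grp \<Omega> M) (\<lambda>g. g) \<omega>) \<cong> T"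
    using stab_not_iso_T[OF E \<omega>] by (simp add: stab_eq)
  then show ?thesis
    using diagonal \<omega> by (auto simp: compound_diagonal_type_def simple_diagonal_type_def)
qed

section \<open>The decomposition given by the strips of a point stabiliser\<close>

text \<open>The stabilisers of two points are conjugate in \<open>M\<close>, and \<open>M\<close> normalises each kernel.\<close>

lemma linked_stab_indep:
  assumes \<alpha>: "\<alpha> \<in> \<Omega>" and \<beta>: "\<beta> \<in> \<Omega>" and i: "i < k" and j: "j < k" and "P.linked (stab \<alpha>) i j"
  shows "P.linked (stab \<beta>) i j"
proof -
  obtain m where m: "m \<in> M" "m \<alpha> = \<beta>" using M_transitive[OF \<alpha> \<beta>] by blast
  have "P.linked (B.conj_by m ` stab \<alpha>) i j"
    by (rule P.iso_linked[OF conj_iso _ assms(5) conj_factor_ker_M conj_factor_ker_M])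
      (use m M_sub_G i j in \<open>auto simp: stab_def\<close>)
  then show ?thesis using conj_stab[OF subsetD[OF M_sub_G m(1)] \<alpha>] m(2) by simp
qed

text \<open>A point used to define \<open>same_strip\<close>; every point gives the same relation, by \<open>same_strip_iff\<close>.\<close>

definition base_point :: 'a where
  "base_point = (SOME \<omega>. \<omega> \<in> \<Omega>)"

lemma base_point: "base_point \<in> \<Omega>"
  unfolding base_point_def using \<Omega>_nonempty by (rule some_in_eq[THEN iffD2])

definition same_strip :: "nat \<Rightarrow> nat \<Rightarrow> bool" where
  "same_strip i j \<longleftrightarrow> i < k \<and> j < k \<and> P.linked (stab base_point) i j"

lemma same_strip_iff:
  "\<alpha> \<in> \<Omega> \<Longrightarrow> i < k \<Longrightarrow> j < k \<Longrightarrow> same_strip i j \<longleftrightarrow> P.linked (stab \<alpha>) i j"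
  using linked_stab_indep[OF base_point] linked_stab_indep[OF _ base_point]
  unfolding same_strip_def by blast

lemma same_strip_refl: "i < k \<Longrightarrow> same_strip i i"
  and same_strip_sym: "same_strip i j \<Longrightarrow> same_strip j i"
  and same_strip_trans: "same_strip i j \<Longrightarrow> same_strip j l \<Longrightarrow> same_strip i l"
  by (auto simp: same_strip_def P.linked_def)

lemma same_strip_conj:
  assumes g: "g \<in> G" and "same_strip i j" and ij': "i' < k" "j' < k"
    and i: "B.conj_by g ` P.factor_ker i = P.factor_ker i'"
    and j: "B.conj_by g ` P.factor_ker j = P.factor_ker j'"
  shows "same_strip i' j'"
proof -
  have "P.linked (B.conj_by g ` stab base_point) i' j'"
    by (rule P.iso_linked[OF conj_iso[OF g] _ _ i j]) (use assms(2) in \<open>auto simp: stab_def same_strip_def\<close>)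
  then show ?thesis
    using conj_stab[OF g base_point] same_strip_iff[OF Bij_apply_mem[OF G_Bij[OF g] base_point] ij'] by simp
qed

text \<open>The elements of \<open>M\<close> that are trivial on the class of \<open>i\<close>, that is, the product of the factors outside of
it. It depends on the class only, and \<open>G\<close> permutes these groups.\<close>

definition off_strip :: "nat \<Rightarrow> ('a \<Rightarrow> 'a) set" where
  "off_strip i = {x \<in> M. \<forall>j. same_strip i j \<longrightarrow> x \<in> P.factor_ker j}"

lemma off_strip_iff:
  assumes "x \<in> M" "y \<in> M"
  shows "x \<otimes>\<^bsub>BijGroup \<Omega>\<^esub> inv\<^bsub>BijGroup \<Omega>\<^esub> y \<in> off_strip i \<longleftrightarrow>
    (\<forall>j. same_strip i j \<longrightarrow> factor_proj (perm_grp \<Omega> M) k S j x = factor_proj (perm_grp \<Omega> M) k S j y)"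
proof -
  have "x \<otimes>\<^bsub>BijGroup \<Omega>\<^esub> inv\<^bsub>BijGroup \<Omega>\<^esub> y \<in> M"
    using assms by (simp add: subgroup.m_closed[OF M_subgroup] subgroup.m_inv_closed[OF M_subgroup])
  moreover have "x \<otimes>\<^bsub>BijGroup \<Omega>\<^esub> inv\<^bsub>BijGroup \<Omega>\<^esub> y \<in> P.factor_ker j \<longleftrightarrow>
      factor_proj (perm_grp \<Omega> M) k S j x = factor_proj (perm_grp \<Omega> M) k S j y" if "same_strip i j" for j
  proof -
    have "j < k" using that by (simp add: same_strip_def)
    then show ?thesis
      using P.p_diff_eq_one[of j x y] assms M_subgroup calculation by (simp add: P.factor_ker_def)
  qed
  ultimately show ?thesis by (auto simp: off_strip_def)
qed

lemma off_strip_subgroup: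
  assumes i: "i < k"
  shows "subgroup (off_strip i) (BijGroup \<Omega>)"
proof -
  have "off_strip i = (\<Inter>j\<in>{j. same_strip i j}. P.factor_ker j)"
    using same_strip_refl[OF i] factor_ker_sub by (auto simp: off_strip_def)
  moreover have "subgroup (P.factor_ker j) (BijGroup \<Omega>)" if "same_strip i j" for j
    using P.factor_ker_normal[of j] that
    by (simp add: same_strip_def B.normal_in_subgroup_iff[OF M_subgroup])
  ultimately show ?thesis
    using same_strip_refl[OF i] by (auto intro!: B.subgroups_Inter)
qed

lemma off_strip_M: "off_strip i \<subseteq> M"
  by (auto simp: off_strip_def)

lemma off_strip_cong:
  assumes "same_strip i j"
  shows "off_strip i = off_strip j"
proof -
  have "same_strip i l \<longleftrightarrow> same_strip j l" for l
    using assms same_strip_sym same_strip_trans by blast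
  then show ?thesis by (simp add: off_strip_def)
qed

lemma conj_inv_factor_ker:
  assumes g: "g \<in> G" and i: "B.conj_by g ` P.factor_ker i = P.factor_ker j"
  shows "B.conj_by (inv\<^bsub>BijGroup \<Omega>\<^esub> g) ` P.factor_ker j = P.factor_ker i"
proof -
  have "B.conj_by (inv\<^bsub>BijGroup \<Omega>\<^esub> g) ` (B.conj_by g ` P.factor_ker i) = (\<lambda>x. x) ` P.factor_ker i"
    unfolding image_image
    by (rule image_cong[OF refl])
      (use B.conj_by_inv(2)[of g] G_Bij[OF g] M_Bij[OF subsetD[OF factor_ker_sub]] in simp)
  then show ?thesis by (simp add: i)
qed

lemma conj_off_strip:
  assumes g: "g \<in> G" and ij: "i < k" "j < k" "B.conj_by g ` P.factor_ker i = P.factor_ker j"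
    and x: "x \<in> off_strip i"
  shows "B.conj_by g x \<in> off_strip j"
proof -
  have gi: "inv\<^bsub>BijGroup \<Omega>\<^esub> g \<in> G" using g by (rule subgroup.m_inv_closed[OF G_subgroup])
  have "B.conj_by g x \<in> P.factor_ker l" if l: "same_strip j l" for l
  proof -
    have lk: "l < k" using l by (simp add: same_strip_def)
    obtain l' where l': "l' < k" "B.conj_by (inv\<^bsub>BijGroup \<Omega>\<^esub> g) ` P.factor_ker l = P.factor_ker l'"
      using conj_factor_ker[OF gi lk] by blast
    have "same_strip i l'" using same_strip_conj[OF gi l ij(1) l'(1) conj_inv_factor_ker[OF g ij(3)] l'(2)] .
    then have "x \<in> P.factor_ker l'" using x by (simp add: off_strip_def)
    moreover have "B.conj_by g ` P.factor_ker l' = P.factor_ker l"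
      using conj_inv_factor_ker[OF gi l'(2)] B.inv_inv[of g] G_Bij[OF g] by simp
    ultimately show ?thesis by blast
  qed
  then show ?thesis using M_conj[OF g] x by (auto simp: off_strip_def)
qed

definition strip_orbit :: "nat \<Rightarrow> 'a \<Rightarrow> 'a set" where
  "strip_orbit i \<alpha> = (\<lambda>x. x \<alpha>) ` off_strip i"

definition strip_partition :: "nat \<Rightarrow> 'a set set" where
  "strip_partition i = strip_orbit i ` \<Omega>"

lemma strip_orbit_refl:
  assumes "i < k" "\<alpha> \<in> \<Omega>"
  shows "\<alpha> \<in> strip_orbit i \<alpha>"
proof -
  have "\<alpha> = \<one>\<^bsub>BijGroup \<Omega>\<^esub> \<alpha>" using assms(2) by (simp add: BijGroup_one_apply)
  then show ?thesis
    using subgroup.one_closed[OF off_strip_subgroup[OF assms(1)]] unfolding strip_orbit_def by blast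
qed

lemma strip_orbit_sub:
  assumes "\<alpha> \<in> \<Omega>"
  shows "strip_orbit i \<alpha> \<subseteq> \<Omega>"
  unfolding strip_orbit_def
  by (rule image_subsetI) (rule Bij_apply_mem[OF M_Bij[OF subsetD[OF off_strip_M]] assms])

text \<open>This and \<open>strip_orbit_refl\<close>, \<open>strip_orbit_sym\<close> make the orbits of \<open>off_strip i\<close> a partition of \<open>\<Omega>\<close>.\<close>

lemma strip_orbit_step:
  assumes i: "i < k" and \<alpha>: "\<alpha> \<in> \<Omega>" and \<beta>: "\<beta> \<in> strip_orbit i \<alpha>" and \<delta>: "\<delta> \<in> strip_orbit i \<beta>"
  shows "\<delta> \<in> strip_orbit i \<alpha>"
proof -
  obtain x y where x: "x \<in> off_strip i" "\<beta> = x \<alpha>" and y: "y \<in> off_strip i" "\<delta> = y \<beta>"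
    using \<beta> \<delta> by (auto simp: strip_orbit_def)
  have "\<delta> = (y \<otimes>\<^bsub>BijGroup \<Omega>\<^esub> x) \<alpha>"
    using BijGroup_mult_apply[OF M_Bij[OF subsetD[OF off_strip_M y(1)]] M_Bij[OF subsetD[OF off_strip_M x(1)]] \<alpha>]
      x y by simp
  then show ?thesis
    using subgroup.m_closed[OF off_strip_subgroup[OF i] y(1) x(1)] by (auto simp: strip_orbit_def)
qed

lemma strip_orbit_sym:
  assumes i: "i < k" and \<alpha>: "\<alpha> \<in> \<Omega>" and \<beta>: "\<beta> \<in> strip_orbit i \<alpha>"
  shows "\<alpha> \<in> strip_orbit i \<beta>"
proof -
  obtain x where x: "x \<in> off_strip i" "\<beta> = x \<alpha>" using \<beta> by (auto simp: strip_orbit_def)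
  have "\<alpha> = (inv\<^bsub>BijGroup \<Omega>\<^esub> x) \<beta>"
    using BijGroup_inv_apply(1)[OF M_Bij[OF subsetD[OF off_strip_M x(1)]] \<alpha>] x by simp
  then show ?thesis
    using subgroup.m_inv_closed[OF off_strip_subgroup[OF i] x(1)] by (auto simp: strip_orbit_def)
qed

lemma strip_orbit_eq:
  assumes i: "i < k" and \<alpha>: "\<alpha> \<in> \<Omega>" and \<beta>: "\<beta> \<in> strip_orbit i \<alpha>"
  shows "strip_orbit i \<beta> = strip_orbit i \<alpha>"
proof -
  have \<beta>\<Omega>: "\<beta> \<in> \<Omega>" using strip_orbit_sub[OF \<alpha>] \<beta> by blast
  show ?thesis
    using strip_orbit_step[OF i \<alpha> \<beta>] strip_orbit_step[OF i \<beta>\<Omega> strip_orbit_sym[OF i \<alpha> \<beta>]] by blast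
qed

lemma strip_partition_on:
  assumes i: "i < k"
  shows "partition_on \<Omega> (strip_partition i)"
proof (rule partition_onI)
  show "\<Union> (strip_partition i) = \<Omega>"
    using strip_orbit_refl[OF i] strip_orbit_sub unfolding strip_partition_def by blast
  show "{} \<notin> strip_partition i"
    using strip_orbit_refl[OF i] unfolding strip_partition_def by blast
  show "disjnt p q" if pq: "p \<in> strip_partition i" "q \<in> strip_partition i" "p \<noteq> q" for p q
  proof (rule ccontr)
    assume "\<not> disjnt p q"
    then obtain \<delta> where \<delta>: "\<delta> \<in> p" "\<delta> \<in> q" unfolding disjnt_def by blast
    obtain \<alpha> \<beta> where "\<alpha> \<in> \<Omega>" "p = strip_orbit i \<alpha>" "\<beta> \<in> \<Omega>" "q = strip_orbit i \<beta>"
      using pq(1,2) unfolding strip_partition_def by blast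
    then have "p = q" using strip_orbit_eq[OF i] \<delta> by metis
    then show False using pq(3) by simp
  qed
qed

lemma strip_partition_cong: "same_strip i j \<Longrightarrow> strip_partition i = strip_partition j"
  using off_strip_cong by (simp add: strip_partition_def strip_orbit_def[abs_def])

lemma act_strip_orbit:
  assumes g: "g \<in> G" and ij: "i < k" "j < k" "B.conj_by g ` P.factor_ker i = P.factor_ker j"
    and \<alpha>: "\<alpha> \<in> \<Omega>"
  shows "g ` strip_orbit i \<alpha> \<subseteq> strip_orbit j (g \<alpha>)"
proof
  fix \<delta> assume "\<delta> \<in> g ` strip_orbit i \<alpha>"
  then obtain x where x: "x \<in> off_strip i" "\<delta> = g (x \<alpha>)" by (auto simp: strip_orbit_def)
  have gB: "g \<in> Bij \<Omega>" and xB: "x \<in> Bij \<Omega>" using g G_Bij M_Bij[OF subsetD[OF off_strip_M x(1)]] by auto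
  have gi: "inv\<^bsub>BijGroup \<Omega>\<^esub> g \<in> Bij \<Omega>" using B.inv_closed[of g] gB by simp
  have gx: "g \<otimes>\<^bsub>BijGroup \<Omega>\<^esub> x \<in> Bij \<Omega>" using B.m_closed[of g x] gB xB by simp
  have "\<delta> = B.conj_by g x (g \<alpha>)"
    unfolding B.conj_by_def x(2) BijGroup_mult_apply[OF gx gi Bij_apply_mem[OF gB \<alpha>]]
      BijGroup_inv_apply(1)[OF gB \<alpha>] BijGroup_mult_apply[OF gB xB \<alpha>] ..
  then show "\<delta> \<in> strip_orbit j (g \<alpha>)" using conj_off_strip[OF g ij x(1)] by (auto simp: strip_orbit_def)
qed

lemma act_strip_partition:
  assumes g: "g \<in> G" and ij: "i < k" "j < k" "B.conj_by g ` P.factor_ker i = P.factor_ker j"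
  shows "image (image g) (strip_partition i) = strip_partition j"
proof -
  have gB: "g \<in> Bij \<Omega>" using g by (rule G_Bij)
  have gi: "inv\<^bsub>BijGroup \<Omega>\<^esub> g \<in> G" using g by (rule subgroup.m_inv_closed[OF G_subgroup])
  have orb: "g ` strip_orbit i \<alpha> = strip_orbit j (g \<alpha>)" if \<alpha>: "\<alpha> \<in> \<Omega>" for \<alpha>
  proof
    show "g ` strip_orbit i \<alpha> \<subseteq> strip_orbit j (g \<alpha>)" by (rule act_strip_orbit[OF g ij \<alpha>])
    have g\<alpha>: "g \<alpha> \<in> \<Omega>" using Bij_apply_mem[OF gB \<alpha>] .
    have "(inv\<^bsub>BijGroup \<Omega>\<^esub> g) ` strip_orbit j (g \<alpha>) \<subseteq> strip_orbit i \<alpha>"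
      using act_strip_orbit[OF gi ij(2,1) conj_inv_factor_ker[OF g ij(3)] g\<alpha>]
        BijGroup_inv_apply(1)[OF gB \<alpha>] by simp
    then have "g ` ((inv\<^bsub>BijGroup \<Omega>\<^esub> g) ` strip_orbit j (g \<alpha>)) \<subseteq> g ` strip_orbit i \<alpha>" by (rule image_mono)
    then show "strip_orbit j (g \<alpha>) \<subseteq> g ` strip_orbit i \<alpha>"
      unfolding BijGroup_inv_image(2)[OF gB strip_orbit_sub[OF g\<alpha>]] .
  qed
  have "image (image g) (strip_partition i) = (\<lambda>\<alpha>. strip_orbit j (g \<alpha>)) ` \<Omega>"
    unfolding strip_partition_def image_image by (rule image_cong[OF refl orb])
  also have "\<dots> = strip_orbit j ` (g ` \<Omega>)" by (simp add: image_image)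
  also have "g ` \<Omega> = \<Omega>" using gB by (simp add: Bij_def bij_betw_def)
  finally show ?thesis by (simp add: strip_partition_def)
qed

text \<open>If \<open>m \<in> M\<close> maps \<open>\<alpha>\<close> to \<open>\<beta>\<close>, then for each class \<open>m\<close> differs from an element of the stabiliser of \<open>\<alpha>\<close> by
an element that is trivial on the class. So \<open>m\<close> agrees on each class with an element of the
stabiliser, which puts it into the stabiliser.\<close>

lemma strip_orbits_meet_unique:
  assumes \<alpha>: "\<alpha> \<in> \<Omega>" and \<beta>: "\<And>i. i < k \<Longrightarrow> \<beta> \<in> strip_orbit i \<alpha>"
  shows "\<beta> = \<alpha>"
proof -
  let ?p = "factor_proj (perm_grp \<Omega> M) k S"
  have "\<beta> \<in> \<Omega>" using strip_orbit_sub[OF \<alpha>] \<beta>[OF k_pos] by blast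
  then obtain m where m: "m \<in> M" "m \<alpha> = \<beta>" using M_transitive[OF \<alpha>] by blast
  have "m \<in> stab \<alpha>"
  proof (rule P.mem_if_linked_agree[OF full_stab[OF \<alpha>]])
    show "m \<in> carrier (perm_grp \<Omega> M)" using m by simp
    fix i j assume ij: "i \<in> {..<k}" "j \<in> {..<k}" "P.linked (stab \<alpha>) i j"
    obtain n where n: "n \<in> off_strip i" "\<beta> = n \<alpha>" using \<beta>[of i] ij by (auto simp: strip_orbit_def)
    have nM: "n \<in> M" using n off_strip_M by blast
    let ?y = "inv\<^bsub>BijGroup \<Omega>\<^esub> n \<otimes>\<^bsub>BijGroup \<Omega>\<^esub> m"
    have yM: "?y \<in> M"
      using nM m by (simp add: subgroup.m_closed[OF M_subgroup] subgroup.m_inv_closed[OF M_subgroup])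
    have "?y \<in> stab \<alpha>" using inv_mult_mem_iff[OF nM m(1) \<alpha>] n m yM by (simp add: stab_def)
    moreover have "?p l ?y = ?p l m" if l: "same_strip i l" for l
    proof -
      have lk: "l \<in> {..<k}" using l by (simp add: same_strip_def)
      have nl: "?p l n = \<one>\<^bsub>BijGroup \<Omega>\<^esub>" using n(1) l by (simp add: off_strip_def P.factor_ker_def)
      show ?thesis
        using P.p_mult[OF lk, of "inv\<^bsub>perm_grp \<Omega> M\<^esub> n" m] P.p_inv[OF lk, of n] P.T_one[OF lk]
          P.T_mult_one(2)[OF lk, of "?p l m"] P.p_closed[OF lk, of m] P.inv_closed[of n] nl nM m(1) M_subgroup
        by simp
    qed
    moreover have "same_strip i i" "same_strip i j"
      using same_strip_refl same_strip_iff[OF \<alpha>] ij by auto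
    ultimately show "\<exists>y\<in>stab \<alpha>. ?p i y = ?p i m \<and> ?p j y = ?p j m" by blast
  qed
  then show ?thesis using m by (simp add: stab_def)
qed

text \<open>If one of the groups \<open>off_strip i\<close> were transitive, all would be, as \<open>G\<close> permutes them transitively. Then
any two points would lie in the same orbit of each of them, and so be equal.\<close>

lemma off_strip_intransitive:
  assumes i: "i < k"
  shows "\<exists>\<alpha>\<in>\<Omega>. \<exists>\<beta>\<in>\<Omega>. \<beta> \<notin> strip_orbit i \<alpha>"
proof (rule ccontr)
  assume "\<not> ?thesis"
  then have all: "strip_orbit i \<alpha> = \<Omega>" if "\<alpha> \<in> \<Omega>" for \<alpha> using that strip_orbit_sub[OF that, of i] by blast
  then have P: "strip_partition i = {\<Omega>}" using \<Omega>_nonempty by (auto simp: strip_partition_def)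
  have "\<beta> \<in> strip_orbit j \<alpha>" if \<alpha>: "\<alpha> \<in> \<Omega>" and \<beta>: "\<beta> \<in> \<Omega>" and j: "j < k" for \<alpha> \<beta> j
  proof -
    obtain g where g: "g \<in> G" "B.conj_by g ` P.factor_ker i = P.factor_ker j"
      using G_transitive_factor_kers[OF i j] by blast
    have "strip_partition j = {g ` \<Omega>}" using act_strip_partition[OF g(1) i j g(2)] P by simp
    moreover have "g ` \<Omega> = \<Omega>" using G_Bij[OF g(1)] by (simp add: Bij_def bij_betw_def)
    ultimately show ?thesis using \<alpha> \<beta> by (auto simp: strip_partition_def)
  qed
  then have eq: "\<beta> = \<alpha>" if "\<alpha> \<in> \<Omega>" "\<beta> \<in> \<Omega>" for \<alpha> \<beta> using strip_orbits_meet_unique that by blast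
  have "x = \<one>\<^bsub>BijGroup \<Omega>\<^esub>" if x: "x \<in> M" for x
  proof (rule Bij_eqI[OF M_Bij[OF x]])
    show "\<one>\<^bsub>BijGroup \<Omega>\<^esub> \<in> Bij \<Omega>" using B.one_closed by simp
    show "x \<alpha> = \<one>\<^bsub>BijGroup \<Omega>\<^esub> \<alpha>" if "\<alpha> \<in> \<Omega>" for \<alpha>
      using eq[OF that Bij_apply_mem[OF M_Bij[OF x] that]] that by (simp add: BijGroup_one_apply)
  qed
  then show False using M_nontrivial subgroup.one_closed[OF M_subgroup] by blast
qed

text \<open>For distinct classes, \<open>M\<close> is the product of the two groups \<open>off_strip i\<close> and \<open>off_strip j\<close>. If they had the
same orbits, these would be orbits of \<open>M\<close>, against \<open>off_strip_intransitive\<close>.\<close>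

lemma strip_partition_inj:
  assumes i: "i < k" and j: "j < k" and ij: "\<not> same_strip i j"
  shows "strip_partition i \<noteq> strip_partition j"
proof
  assume e: "strip_partition i = strip_partition j"
  let ?p = "factor_proj (perm_grp \<Omega> M) k S"
  have orb: "strip_orbit i \<alpha> = strip_orbit j \<alpha>" if \<alpha>: "\<alpha> \<in> \<Omega>" for \<alpha>
  proof -
    have "strip_orbit i \<alpha> \<in> strip_partition j" using \<alpha> e by (auto simp: strip_partition_def)
    then obtain \<beta> where \<beta>: "\<beta> \<in> \<Omega>" "strip_orbit i \<alpha> = strip_orbit j \<beta>" by (auto simp: strip_partition_def)
    then have "\<alpha> \<in> strip_orbit j \<beta>" using strip_orbit_refl[OF i \<alpha>] by simp
    then show ?thesis using strip_orbit_eq[OF j \<beta>(1)] \<beta>(2) by simp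
  qed
  have "\<beta> \<in> strip_orbit i \<alpha>" if \<alpha>: "\<alpha> \<in> \<Omega>" and \<beta>: "\<beta> \<in> \<Omega>" for \<alpha> \<beta>
  proof -
    obtain m where m: "m \<in> M" "m \<alpha> = \<beta>" using M_transitive[OF \<alpha> \<beta>] by blast
    let ?t = "\<lambda>l. if same_strip i l then ?p l m else \<one>\<^bsub>BijGroup \<Omega>\<^esub>"
    have "\<exists>n\<in>carrier (perm_grp \<Omega> M). \<forall>l\<in>{..<k}. ?p l n = ?t l"
    proof (rule P.coords_ex)
      show "?t l \<in> carrier (perm_grp \<Omega> (S l))" if "l \<in> {..<k}" for l
        using P.p_closed[of l m] P.T_one(1)[of l] that m by simp
    qed
    then obtain n where n: "n \<in> M" "\<forall>l\<in>{..<k}. ?p l n = ?t l" by auto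
    have nj: "n \<in> off_strip j"
    proof -
      have "n \<in> P.factor_ker l" if l: "same_strip j l" for l
      proof -
        have "\<not> same_strip i l" using l ij same_strip_sym same_strip_trans by blast
        moreover have "l < k" using l by (simp add: same_strip_def)
        ultimately show ?thesis using n by (simp add: P.factor_ker_def)
      qed
      then show ?thesis using n(1) by (simp add: off_strip_def)
    qed
    have mn: "m \<otimes>\<^bsub>BijGroup \<Omega>\<^esub> inv\<^bsub>BijGroup \<Omega>\<^esub> n \<in> off_strip i"
      unfolding off_strip_iff[OF m(1) n(1)] using n(2) by (simp add: same_strip_def)
    have n\<alpha>: "n \<alpha> \<in> strip_orbit i \<alpha>" using orb[OF \<alpha>] nj by (auto simp: strip_orbit_def)
    have n\<Omega>: "n \<alpha> \<in> \<Omega>" using Bij_apply_mem[OF M_Bij[OF n(1)] \<alpha>] .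
    have "\<beta> = (m \<otimes>\<^bsub>BijGroup \<Omega>\<^esub> inv\<^bsub>BijGroup \<Omega>\<^esub> n) (n \<alpha>)"
      using BijGroup_mult_apply[OF M_Bij[OF m(1)] BijGroup_inv_apply(3)[OF M_Bij[OF n(1)] \<alpha>] n\<Omega>]
        BijGroup_inv_apply(1)[OF M_Bij[OF n(1)] \<alpha>] m(2) by simp
    then have "\<beta> \<in> strip_orbit i (n \<alpha>)" using mn by (auto simp: strip_orbit_def)
    then show ?thesis using strip_orbit_step[OF i \<alpha> n\<alpha>] by blast
  qed
  then show False using off_strip_intransitive[OF i] by blast
qed

text \<open>For each class, pick an element of \<open>M\<close> that maps the base point into the given block. An element \<open>x\<close> of \<open>M\<close>
that has the coordinates of the chosen element on each class maps the base point into all blocks.\<close>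

lemma strip_blocks_meet:
  assumes c: "\<And>i. i < k \<Longrightarrow> c (strip_partition i) \<in> strip_partition i"
  shows "\<exists>\<alpha>\<in>\<Omega>. \<forall>i<k. \<alpha> \<in> c (strip_partition i)"
proof -
  let ?p = "factor_proj (perm_grp \<Omega> M) k S"
  have "\<exists>m\<in>M. m base_point \<in> c (strip_partition i)" if i: "i < k" for i
  proof -
    obtain \<alpha> where \<alpha>: "\<alpha> \<in> \<Omega>" "c (strip_partition i) = strip_orbit i \<alpha>"
      using c[OF i] unfolding strip_partition_def by blast
    then obtain m where m: "m \<in> M" "m base_point = \<alpha>" using M_transitive[OF base_point] by blast
    then show ?thesis using \<alpha> strip_orbit_refl[OF i \<alpha>(1)] by auto
  qed
  then obtain \<mu>' where \<mu>': "\<And>i. i < k \<Longrightarrow> \<mu>' i \<in> M \<and> \<mu>' i base_point \<in> c (strip_partition i)" by metis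
  \<comment> \<open>One element of \<open>M\<close> must serve a whole class, hence the passage to representatives \<open>r i\<close>.\<close>
  define r where "r i = (SOME j. same_strip i j)" for i
  have r: "same_strip i (r i)" if "i < k" for i
    unfolding r_def by (rule someI[of _ i]) (rule same_strip_refl[OF that])
  have r_cong: "r i = r j" if "same_strip i j" for i j
  proof -
    have "same_strip i = same_strip j" using that same_strip_sym same_strip_trans by blast
    then show ?thesis by (simp add: r_def)
  qed
  define \<mu> where "\<mu> i = \<mu>' (r i)" for i
  have \<mu>: "\<mu> i \<in> M" "\<mu> i base_point \<in> c (strip_partition i)" if "i < k" for i
    using \<mu>'[of "r i"] r[OF that] strip_partition_cong[OF r[OF that]] by (auto simp: \<mu>_def same_strip_def)
  have "\<exists>x\<in>carrier (perm_grp \<Omega> M). \<forall>i\<in>{..<k}. ?p i x = ?p i (\<mu> i)"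
  proof (rule P.coords_ex)
    show "?p i (\<mu> i) \<in> carrier (perm_grp \<Omega> (S i))" if "i \<in> {..<k}" for i
      using P.p_closed[OF that, of "\<mu> i"] \<mu>(1) that by simp
  qed
  then obtain x where x: "x \<in> M" "\<forall>i\<in>{..<k}. ?p i x = ?p i (\<mu> i)" by auto
  have "x base_point \<in> c (strip_partition i)" if i: "i < k" for i
  proof -
    have "?p j x = ?p j (\<mu> i)" if j: "same_strip i j" for j
      using x(2) j r_cong[OF j] by (simp add: same_strip_def \<mu>_def)
    then have off: "x \<otimes>\<^bsub>BijGroup \<Omega>\<^esub> inv\<^bsub>BijGroup \<Omega>\<^esub> \<mu> i \<in> off_strip i"
      unfolding off_strip_iff[OF x(1) \<mu>(1)[OF i]] by blast
    have \<mu>B: "\<mu> i \<in> Bij \<Omega>" using M_Bij[OF \<mu>(1)[OF i]] .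
    have "x base_point = (x \<otimes>\<^bsub>BijGroup \<Omega>\<^esub> inv\<^bsub>BijGroup \<Omega>\<^esub> \<mu> i) (\<mu> i base_point)"
      using BijGroup_mult_apply[OF M_Bij[OF x(1)] BijGroup_inv_apply(3)[OF \<mu>B base_point] Bij_apply_mem[OF \<mu>B base_point]]
        BijGroup_inv_apply(1)[OF \<mu>B base_point] by simp
    then have "x base_point \<in> strip_orbit i (\<mu> i base_point)" using off by (auto simp: strip_orbit_def)
    moreover have "strip_orbit i (\<mu> i base_point) = c (strip_partition i)"
    proof -
      obtain \<alpha> where \<alpha>: "\<alpha> \<in> \<Omega>" "c (strip_partition i) = strip_orbit i \<alpha>"
        using c[OF i] unfolding strip_partition_def by blast
      then show ?thesis using strip_orbit_eq[OF i \<alpha>(1)] \<mu>(2)[OF i] by simp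
    qed
    ultimately show ?thesis by simp
  qed
  then show ?thesis using Bij_apply_mem[OF M_Bij[OF x(1)] base_point] by blast
qed

lemma strip_decomposition_in_CD:
  assumes ij: "i0 < k" "j0 < k" "\<not> same_strip i0 j0"
  shows "strip_partition ` {..<k} \<in> CD \<Omega> G"
proof -
  let ?E = "strip_partition ` {..<k}"
  have "2 \<le> card ?E"
  proof -
    have "card {strip_partition i0, strip_partition j0} \<le> card ?E"
      using ij by (intro card_mono) auto
    then show ?thesis using strip_partition_inj[OF ij] by simp
  qed
  moreover have "partition_on \<Omega> \<Gamma> \<and> (\<exists>\<gamma>\<in>\<Gamma>. \<exists>\<delta>\<in>\<Gamma>. \<gamma> \<noteq> \<delta>)" if "\<Gamma> \<in> ?E" for \<Gamma>
  proof -
    obtain i where i: "i < k" "\<Gamma> = strip_partition i" using \<open>\<Gamma> \<in> ?E\<close> by auto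
    obtain \<alpha> \<beta> where \<alpha>\<beta>: "\<alpha> \<in> \<Omega>" "\<beta> \<in> \<Omega>" "\<beta> \<notin> strip_orbit i \<alpha>"
      using off_strip_intransitive[OF i(1)] by blast
    then have "strip_orbit i \<alpha> \<noteq> strip_orbit i \<beta>" using strip_orbit_refl[OF i(1)] by blast
    then show ?thesis using strip_partition_on[OF i(1)] i(2) \<alpha>\<beta> unfolding strip_partition_def by blast
  qed
  moreover have "card (\<Inter>\<Gamma>\<in>?E. c \<Gamma>) = 1" if c: "\<forall>\<Gamma>\<in>?E. c \<Gamma> \<in> \<Gamma>" for c
  proof -
    have c': "c (strip_partition i) \<in> strip_partition i" if "i < k" for i using c that by blast
    obtain \<alpha> where \<alpha>: "\<alpha> \<in> \<Omega>" "\<forall>i<k. \<alpha> \<in> c (strip_partition i)"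
      using strip_blocks_meet[of c] c' by blast
    have "\<beta> = \<alpha>" if \<beta>: "\<beta> \<in> (\<Inter>\<Gamma>\<in>?E. c \<Gamma>)" for \<beta>
    proof (rule strip_orbits_meet_unique[OF \<alpha>(1)])
      fix i assume i: "i < k"
      obtain \<delta> where \<delta>: "\<delta> \<in> \<Omega>" "c (strip_partition i) = strip_orbit i \<delta>"
        using c'[OF i] unfolding strip_partition_def by blast
      moreover have "\<alpha> \<in> c (strip_partition i)" using \<alpha>(2) i by blast
      ultimately have "strip_orbit i \<alpha> = c (strip_partition i)" using strip_orbit_eq[OF i \<delta>(1)] by simp
      then show "\<beta> \<in> strip_orbit i \<alpha>" using \<beta> i by auto
    qed
    moreover have "\<alpha> \<in> (\<Inter>\<Gamma>\<in>?E. c \<Gamma>)" using \<alpha>(2) by auto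
    ultimately have "(\<Inter>\<Gamma>\<in>?E. c \<Gamma>) = {\<alpha>}" by blast
    then show ?thesis by simp
  qed
  ultimately have "cartesian_decomposition \<Omega> ?E" by (simp add: cartesian_decomposition_def)
  moreover have "image (image g) ` ?E = ?E" if g: "g \<in> G" for g
  proof
    show sub: "image (image g) ` ?E \<subseteq> ?E"
    proof
      fix \<Gamma> assume "\<Gamma> \<in> image (image g) ` ?E"
      then obtain i where i: "i < k" "\<Gamma> = image (image g) (strip_partition i)" by auto
      obtain j where j: "j < k" "B.conj_by g ` P.factor_ker i = P.factor_ker j"
        using conj_factor_ker[OF g i(1)] by blast
      then show "\<Gamma> \<in> ?E" using act_strip_partition[OF g i(1) j] i(2) by auto
    qed
    show "?E \<subseteq> image (image g) ` ?E"
    proof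
      fix \<Gamma> assume "\<Gamma> \<in> ?E"
      then obtain j where j: "j < k" "\<Gamma> = strip_partition j" by auto
      have gi: "inv\<^bsub>BijGroup \<Omega>\<^esub> g \<in> G" using g by (rule subgroup.m_inv_closed[OF G_subgroup])
      obtain i where i: "i < k" "B.conj_by (inv\<^bsub>BijGroup \<Omega>\<^esub> g) ` P.factor_ker j = P.factor_ker i"
        using conj_factor_ker[OF gi j(1)] by blast
      have "B.conj_by g ` P.factor_ker i = P.factor_ker j"
        using conj_inv_factor_ker[OF gi i(2)] B.inv_inv[of g] G_Bij[OF g] by simp
      then have "\<Gamma> = image (image g) (strip_partition i)" using act_strip_partition[OF g i(1) j(1)] j(2) by simp
      then show "\<Gamma> \<in> image (image g) ` ?E" using i(1) by blast
    qed
  qed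
  ultimately show ?thesis by (simp add: CD_def)
qed

text \<open>If all coordinates are linked, the stabiliser of \<open>\<omega>\<close> is a full diagonal subgroup.\<close>

lemma stab_iso_T_if_one_strip:
  assumes \<omega>: "\<omega> \<in> \<Omega>" and one: "\<And>i j. i < k \<Longrightarrow> j < k \<Longrightarrow> same_strip i j"
  shows "perm_grp \<Omega> (stab \<omega>) \<cong> T"
proof -
  let ?p = "factor_proj (perm_grp \<Omega> M) k S"
  have full: "P.full (stab \<omega>)" using full_stab[OF \<omega>] .
  have sM: "stab \<omega> \<subseteq> M" by (auto simp: stab_def)
  have "inj_on (?p 0) (stab \<omega>)"
  proof (rule inj_onI)
    fix x y assume x: "x \<in> stab \<omega>" and y: "y \<in> stab \<omega>" and e: "?p 0 x = ?p 0 y"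
    show "x = y"
    proof (rule P.coords_eqI)
      show "x \<in> carrier (perm_grp \<Omega> M)" "y \<in> carrier (perm_grp \<Omega> M)" using x y sM by auto
      fix i assume i: "i \<in> {..<k}"
      then have "P.linked (stab \<omega>) 0 i" using one[of 0 i] same_strip_iff[OF \<omega>, of 0 i] k_pos by simp
      then show "?p i x = ?p i y"
        by (rule P.linked_agree[OF _ _ _ i x y e]) (use full k_pos in \<open>auto simp: P.full_def\<close>)
    qed
  qed
  moreover have "?p 0 ` stab \<omega> = S 0" using full k_pos by (simp add: P.full_def)
  moreover have "?p 0 \<in> hom (perm_grp \<Omega> (stab \<omega>)) (perm_grp \<Omega> (S 0))"
    using P.p_hom[of 0] k_pos sM by (auto simp: hom_def subset_iff)
  ultimately have "?p 0 \<in> iso (perm_grp \<Omega> (stab \<omega>)) (perm_grp \<Omega> (S 0))"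
    by (simp add: iso_def bij_betw_def)
  then have "perm_grp \<Omega> (stab \<omega>) \<cong> perm_grp \<Omega> (S 0)" by (rule is_isoI)
  moreover have "perm_grp \<Omega> (S 0) \<cong> T" using diagonal k_pos by (simp add: diagonal_type_def)
  ultimately show ?thesis by (rule iso_trans)
qed

lemma CD_nonempty_if_compound:
  assumes "compound_diagonal_type \<Omega> G M k S T"
  shows "CD \<Omega> G \<noteq> {}"
proof -
  obtain \<omega> where \<omega>: "\<omega> \<in> \<Omega>" "\<not> perm_grp \<Omega> (stab \<omega>) \<cong> T"
    using assms by (auto simp: compound_diagonal_type_def simple_diagonal_type_def stab_eq)
  obtain i j where "i < k" "j < k" "\<not> same_strip i j"
    using stab_iso_T_if_one_strip[OF \<omega>(1)] \<omega>(2) by blast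
  then show ?thesis using strip_decomposition_in_CD by blast
qed

end

theorem theorem7p3:
  fixes \<Omega> :: "'a set"
    and G M :: "('a \<Rightarrow> 'a) set"
    and k :: nat
    and S :: "nat \<Rightarrow> ('a \<Rightarrow> 'a) set"
    and T :: "('t, 'm) monoid_scheme"
  assumes "finite \<Omega>"
    and "diagonal_type \<Omega> G M k S T"
  shows "(CD \<Omega> G \<noteq> {} \<longleftrightarrow> quasiprimitive \<Omega> G \<and> compound_diagonal_type \<Omega> G M k S T) \<and>
         (compound_diagonal_type \<Omega> G M k S T \<longrightarrow>
            CD \<Omega> G = CD_S \<Omega> G M k S \<and> CD_S \<Omega> G M k S \<noteq> {})"
proof -
  interpret diagonal_group \<Omega> G M k S T using assms by (rule diagonal_group.intro)
  have "CD \<Omega> G = CD_S \<Omega> G M k S" using CD_subset_CD_S by (auto simp: CD_S_def)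
  then show ?thesis using quasiprimitive compound_if_CD_nonempty CD_nonempty_if_compound by auto
qed

end
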